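(* Let $\mathcal T=(\mathbb T,\mathcal V,\xi)$ be a topological theory with $\bot\neq k$ in $\mathcal V$ and $T1=1$. Then $\mathbb V=(V,\mathsf h,\mathsf w)$ is a monad on $\mathcal T\text{-}\mathsf{Cat}$ and (by restriction) on $\mathcal T\text{-}\mathsf{ReprCat}$, and this monad is, in both cases, of Kock-Zöberlein type.
   Context: **Theory.** A topological theory $\mathcal T=(\mathbb T,\mathcal V,\xi)$ consists of a monad $\mathbb T=(T,e,m)$ on $\mathsf{Set}$, a commutative unital quantale $\mathcal V=(\mathcal V,\otimes,k)$ (complete lattice, commutative monoid, $\otimes$ preserves suprema in each variable; $x\otimes y\le z\iff x\le\hom(y,z)$) and a map $\xi:T\mathcal V\to\mathcal V$ such that (a) $T$ preserves weak pullbacks and every naturality square of $m$ is a weak pullback; (b) $(\mathcal V,\xi)$ is an Eilenberg–Moore $\mathbb T$-algebra, $\xi\cdot T(\otimes)=\otimes\cdot\langle\xi\cdot T\pi_1,\xi\cdot T\pi_2\rangle$ on $T(\mathcal V\times\mathcal V)$, and $\xi\cdot T(k)$ is constant $k$ on $T1$ (with $k:1\to\mathcal V$); (c) for every map $f:X\to Y$ and $\varphi:X\to\mathcal V$, $\xi\cdot T(f_!\varphi)=(Tf)_!(\xi\cdot T\varphi)$, where $f_!\varphi(y)=\bigvee_{f(x)=y}\varphi(x)$. **Relations.** A $\mathcal V$-relation $r:X\nrightarrow Y$ is a map $X\times Y\to\mathcal V$, ordered pointwise; $(s\cdot r)(x,z)=\bigvee_y r(x,y)\otimes s(y,z)$;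 $r^\circ(y,x)=r(x,y)$; a map $f$ is identified with the relation with value $k$ if $f(x)=y$ and $\bot$ otherwise. $T_\xi r:TX\nrightarrow TY$ is $T_\xi r(\mathfrak x,\mathfrak y)=\bigvee\{\xi\cdot Tr(\mathfrak w)\mid \mathfrak w\in T(X\times Y),T\pi_1(\mathfrak w)=\mathfrak x,T\pi_2(\mathfrak w)=\mathfrak y\}$. **$\mathcal T$-categories.** A $\mathcal T$-category is $(X,a)$ with $a:TX\nrightarrow X$, $e_X^\circ\le a$ and $a\cdot T_\xi a\cdot m_X^\circ\le a$; a $\mathcal T$-functor $f:(X,a)\to(Y,b)$ is a map with $a(\mathfrak x,x)\le b(Tf(\mathfrak x),f(x))$. They form $\mathcal T\text{-}\mathsf{Cat}$. Put $a_0=a\cdot e_X$. For maps into $(Y,b)$: $f\le g$ iff $k\le b_0(f(x),g(x))$ for all $x$; $f\simeq g$ iff $f\le g$ and $g\le f$. This order makes $\mathcal T\text{-}\mathsf{Cat}$ a 2-category; $f\dashv g$ means $1\le g f$ and $fg\le 1$. **Representable.** For a $\mathcal T$-category $X=(X,a)$ let $TX=(TX,T_\xi a\cdot m_X^\circ\cdot m_X)$, a $\mathcal T$-category. $X$ is representable if $e_X:X\to TX$ has a left adjoint $\alpha:TX\to X$ in $\mathcal T\text{-}\mathsf{Cat}$. A $\mathcal T$-functor $f$ between representable $\mathcal T$-categories (with left adjoints $\alpha,\beta$) is a pseudo-homomorphism if $\beta\cdot Tf\simeq f\cdot\alpha$. $\mathcal T\text{-}\mathsf{ReprCat}$ is the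 category of representable $\mathcal T$-categories and pseudo-homomorphisms, with the same order on hom-sets. **The monad.** $\mathcal V$ is a $\mathcal T$-category with structure $\hom_\xi(\mathfrak v,v)=\hom(\xi(\mathfrak v),v)$. For a $\mathcal T$-category $X=(X,a)$, $\mathcal V^X$ denotes the set of $\mathcal T$-functors $\varphi:X\to\mathcal V$, $\mathrm{ev}:\mathcal V^X\nrightarrow X$ is $\mathrm{ev}(\varphi,x)=\varphi(x)$, and $\mu=a\cdot T_\xi\mathrm{ev}:T(\mathcal V^X)\nrightarrow X$. $VX$ is the $\mathcal T$-category with underlying set $\mathcal V^X$ and structure $(\mathfrak p,\varphi)\mapsto\bigwedge_{x\in X}\hom(\varphi(x),\mu(\mathfrak p,x))$; it is representable if $X$ is. For a $\mathcal T$-functor $f:(X,a)\to(Y,b)$, $Vf(\varphi)(y)=\bigvee_{\mathfrak x\in TX}\xi(T\varphi(\mathfrak x))\otimes b(Tf(\mathfrak x),y)$. The unit is $\mathsf h_X:X\to VX$, $x\mapsto a_0(x,-)$, and the multiplication is $\mathsf w_X:VVX\to VX$, $\mathsf w_X(\Phi)(x)=\Phi(\mathsf h_X(x))$. **Kock-Zöberlein type.** A monad $(D,\eta,\nu)$ on an order-enriched category is of Kock-Zöberlein type if $D$ is monotone on hom-sets (a 2-functor) and the multiplication is adjoint to the unit, i.e. $\nu_X\dashv\eta_{DX}$ for all $X$, or $\eta_{DX}\dashv\nu_X$ for all $X$. *)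

theory Defs
  imports "HOL-Library.FuncSet" "HOL-Library.Countable_Set" "HOL-Library.Nat_Bijection"
begin

section \<open>Categories, order-enriched categories, monads\<close>

record ('o, 'm) category =
  Ob :: "'o set"
  Hom :: "'o \<Rightarrow> 'o \<Rightarrow> 'm set"
  ident :: "'o \<Rightarrow> 'm"
  cmp :: "'o \<Rightarrow> 'o \<Rightarrow> 'o \<Rightarrow> 'm \<Rightarrow> 'm \<Rightarrow> 'm"
    \<comment> \<open>\<open>cmp C A B D g f\<close> is the composite of \<open>f : A \<rightarrow> B\<close> and \<open>g : B \<rightarrow> D\<close>\<close>

record ('o, 'm) ord_category = "('o, 'm) category" +
  le :: "'o \<Rightarrow> 'o \<Rightarrow> 'm \<Rightarrow> 'm \<Rightarrow> bool"

record ('o, 'm) monad_data =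
  Fob :: "'o \<Rightarrow> 'o"
  Fmap :: "'o \<Rightarrow> 'o \<Rightarrow> 'm \<Rightarrow> 'm"
  unit :: "'o \<Rightarrow> 'm"
  mult :: "'o \<Rightarrow> 'm"

definition is_category :: "('o, 'm, 'z) category_scheme \<Rightarrow> bool" where
  "is_category C \<longleftrightarrow>
    (\<forall>A\<in>Ob C. ident C A \<in> Hom C A A) \<and>
    (\<forall>A\<in>Ob C. \<forall>B\<in>Ob C. \<forall>D\<in>Ob C. \<forall>f\<in>Hom C A B. \<forall>g\<in>Hom C B D. cmp C A B D g f \<in> Hom C A D) \<and>
    (\<forall>A\<in>Ob C. \<forall>B\<in>Ob C. \<forall>f\<in>Hom C A B.
        cmp C A A B f (ident C A) = f \<and> cmp C A B B (ident C B) f = f) \<and>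
    (\<forall>A\<in>Ob C. \<forall>B\<in>Ob C. \<forall>D\<in>Ob C. \<forall>E\<in>Ob C.
        \<forall>f\<in>Hom C A B. \<forall>g\<in>Hom C B D. \<forall>h\<in>Hom C D E.
        cmp C A D E h (cmp C A B D g f) = cmp C A B E (cmp C B D E h g) f)"

definition is_ord_category :: "('o, 'm, 'z) ord_category_scheme \<Rightarrow> bool" where
  "is_ord_category C \<longleftrightarrow> is_category C \<and>
    (\<forall>A\<in>Ob C. \<forall>B\<in>Ob C. \<forall>f\<in>Hom C A B. le C A B f f) \<and>
    (\<forall>A\<in>Ob C. \<forall>B\<in>Ob C. \<forall>f\<in>Hom C A B. \<forall>g\<in>Hom C A B. \<forall>h\<in>Hom C A B.
        le C A B f g \<longrightarrow> le C A B g h \<longrightarrow> le C A B f h) \<and>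
    (\<forall>A\<in>Ob C. \<forall>B\<in>Ob C. \<forall>D\<in>Ob C.
        \<forall>f\<in>Hom C A B. \<forall>f'\<in>Hom C A B. \<forall>g\<in>Hom C B D. \<forall>g'\<in>Hom C B D.
        le C A B f f' \<longrightarrow> le C B D g g' \<longrightarrow> le C A D (cmp C A B D g f) (cmp C A B D g' f'))"

definition is_endofunctor ::
    "('o, 'm, 'z) category_scheme \<Rightarrow> ('o \<Rightarrow> 'o) \<Rightarrow> ('o \<Rightarrow> 'o \<Rightarrow> 'm \<Rightarrow> 'm) \<Rightarrow> bool" where
  "is_endofunctor C F Fm \<longleftrightarrow> is_category C \<and>
    (\<forall>A\<in>Ob C. F A \<in> Ob C) \<and>
    (\<forall>A\<in>Ob C. \<forall>B\<in>Ob C. \<forall>f\<in>Hom C A B. Fm A B f \<in> Hom C (F A) (F B)) \<and>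
    (\<forall>A\<in>Ob C. Fm A A (ident C A) = ident C (F A)) \<and>
    (\<forall>A\<in>Ob C. \<forall>B\<in>Ob C. \<forall>D\<in>Ob C. \<forall>f\<in>Hom C A B. \<forall>g\<in>Hom C B D.
        Fm A D (cmp C A B D g f) = cmp C (F A) (F B) (F D) (Fm B D g) (Fm A B f))"

definition is_monad ::
    "('o, 'm, 'z) category_scheme \<Rightarrow> ('o, 'm, 'y) monad_data_scheme \<Rightarrow> bool" where
  "is_monad C M \<longleftrightarrow> is_endofunctor C (Fob M) (Fmap M) \<and>
    (\<forall>A\<in>Ob C. unit M A \<in> Hom C A (Fob M A)) \<and>
    (\<forall>A\<in>Ob C. mult M A \<in> Hom C (Fob M (Fob M A)) (Fob M A)) \<and>
    (\<forall>A\<in>Ob C. \<forall>B\<in>Ob C. \<forall>f\<in>Hom C A B.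
        cmp C A (Fob M A) (Fob M B) (Fmap M A B f) (unit M A)
          = cmp C A B (Fob M B) (unit M B) f) \<and>
    (\<forall>A\<in>Ob C. \<forall>B\<in>Ob C. \<forall>f\<in>Hom C A B.
        cmp C (Fob M (Fob M A)) (Fob M A) (Fob M B) (Fmap M A B f) (mult M A)
          = cmp C (Fob M (Fob M A)) (Fob M (Fob M B)) (Fob M B)
              (mult M B) (Fmap M (Fob M A) (Fob M B) (Fmap M A B f))) \<and>
    (\<forall>A\<in>Ob C. cmp C (Fob M A) (Fob M (Fob M A)) (Fob M A) (mult M A) (unit M (Fob M A))
        = ident C (Fob M A)) \<and>
    (\<forall>A\<in>Ob C. cmp C (Fob M A) (Fob M (Fob M A)) (Fob M A)
          (mult M A) (Fmap M A (Fob M A) (unit M A))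
        = ident C (Fob M A)) \<and>
    (\<forall>A\<in>Ob C. cmp C (Fob M (Fob M (Fob M A))) (Fob M (Fob M A)) (Fob M A)
          (mult M A) (mult M (Fob M A))
        = cmp C (Fob M (Fob M (Fob M A))) (Fob M (Fob M A)) (Fob M A)
          (mult M A) (Fmap M (Fob M (Fob M A)) (Fob M A) (mult M A)))"

definition left_adjoint :: \<comment> \<open>\<open>f \<stileturn> g\<close> with \<open>f : A \<rightarrow> B\<close>\<close>
    "('o, 'm, 'z) ord_category_scheme \<Rightarrow> 'o \<Rightarrow> 'o \<Rightarrow> 'm \<Rightarrow> 'm \<Rightarrow> bool" where
  "left_adjoint C A B f g \<longleftrightarrow> f \<in> Hom C A B \<and> g \<in> Hom C B A \<and>
    le C A A (ident C A) (cmp C A B A g f) \<and> le C B B (cmp C B A B f g) (ident C B)"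

definition kock_zoeberlein ::
    "('o, 'm, 'z) ord_category_scheme \<Rightarrow> ('o, 'm, 'y) monad_data_scheme \<Rightarrow> bool" where
  "kock_zoeberlein C M \<longleftrightarrow> is_ord_category C \<and> is_monad C M \<and>
    (\<forall>A\<in>Ob C. \<forall>B\<in>Ob C. \<forall>f\<in>Hom C A B. \<forall>g\<in>Hom C A B.
        le C A B f g \<longrightarrow> le C (Fob M A) (Fob M B) (Fmap M A B f) (Fmap M A B g)) \<and>
    ((\<forall>A\<in>Ob C. left_adjoint C (Fob M (Fob M A)) (Fob M A) (mult M A) (unit M (Fob M A))) \<or>
     (\<forall>A\<in>Ob C. left_adjoint C (Fob M A) (Fob M (Fob M A)) (unit M (Fob M A)) (mult M A)))"

definition is_weak_pullback ::
    \<comment> \<open>the square \<open>f p = g q\<close> with \<open>p : P \<rightarrow> A\<close>, \<open>q : P \<rightarrow> B\<close>, \<open>f : A \<rightarrow> D\<close>, \<open>g : B \<rightarrow> D\<close>\<close>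
    "('o, 'm, 'z) category_scheme \<Rightarrow> 'o \<Rightarrow> 'o \<Rightarrow> 'o \<Rightarrow> 'o \<Rightarrow> 'm \<Rightarrow> 'm \<Rightarrow> 'm \<Rightarrow> 'm \<Rightarrow> bool" where
  "is_weak_pullback C P A B D p q f g \<longleftrightarrow>
    p \<in> Hom C P A \<and> q \<in> Hom C P B \<and> f \<in> Hom C A D \<and> g \<in> Hom C B D \<and>
    cmp C P A D f p = cmp C P B D g q \<and>
    (\<forall>Q\<in>Ob C. \<forall>u\<in>Hom C Q A. \<forall>v\<in>Hom C Q B. cmp C Q A D f u = cmp C Q B D g v \<longrightarrow>
      (\<exists>h\<in>Hom C Q P. cmp C Q P A p h = u \<and> cmp C Q P B q h = v))"

definition is_em_algebra ::
    "('o, 'm, 'z) category_scheme \<Rightarrow> ('o, 'm, 'y) monad_data_scheme \<Rightarrow> 'o \<Rightarrow> 'm \<Rightarrow> bool" where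
  "is_em_algebra C M A \<alpha> \<longleftrightarrow> A \<in> Ob C \<and> \<alpha> \<in> Hom C (Fob M A) A \<and>
    cmp C A (Fob M A) A \<alpha> (unit M A) = ident C A \<and>
    cmp C (Fob M (Fob M A)) (Fob M A) A \<alpha> (Fmap M (Fob M A) A \<alpha>)
      = cmp C (Fob M (Fob M A)) (Fob M A) A \<alpha> (mult M A)"


section \<open>The category of sets\<close>

text \<open>
  HOL has no type of all sets, so \<open>Set\<close> is the category of the small subsets of a type \<open>'u\<close>.
  Small sets are only required to contain the singletons and to be closed under subsets, binary
  products and function sets (both encoded in \<open>'u\<close>). Every model of set theory yields an
  instance: small sets are the extensions of the elements of the model, pairs and functions are
  encoded by their set-theoretic counterparts.
\<close>

class set_universe =
  fixes small :: "'a set \<Rightarrow> bool"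
    and pair :: "'a \<times> 'a \<Rightarrow> 'a"
    and fcode :: "('a \<Rightarrow> 'a) \<Rightarrow> 'a"
  assumes small_singleton: "small {x}"
    and small_subset: "small X \<Longrightarrow> Y \<subseteq> X \<Longrightarrow> small Y"
    and inj_pair: "inj pair"
    and small_pair: "small X \<Longrightarrow> small Y \<Longrightarrow> small (pair ` (X \<times> Y))"
    and inj_on_fcode: "small X \<Longrightarrow> small Y \<Longrightarrow> inj_on fcode (X \<rightarrow>\<^sub>E Y)"
    and small_fcode: "small X \<Longrightarrow> small Y \<Longrightarrow> small (fcode ` (X \<rightarrow>\<^sub>E Y))"

text \<open>The hereditarily finite case, which shows that the axioms are satisfiable.\<close>

instantiation nat :: set_universe
begin

definition small_nat :: "nat set \<Rightarrow> bool" where "small_nat = finite"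
definition pair_nat :: "nat \<times> nat \<Rightarrow> nat" where "pair_nat = prod_encode"
definition fcode_nat :: "(nat \<Rightarrow> nat) \<Rightarrow> nat" where
  "fcode_nat = to_nat_on (\<Union>(X, Y)\<in>{X. finite X} \<times> {Y. finite Y}. X \<rightarrow>\<^sub>E Y)"

instance
proof
  fix X Y :: "nat set"
  assume *: "small X" "small Y"
  have "countable (\<Union>(X, Y)\<in>{X. finite X} \<times> {Y. finite Y}. X \<rightarrow>\<^sub>E (Y :: nat set) :: (nat \<Rightarrow> nat) set)"
    by (intro countable_UN countable_SIGMA)
      (auto simp: countable_Collect_finite intro!: countable_finite finite_PiE)
  from inj_on_to_nat_on[OF this] show "inj_on fcode (X \<rightarrow>\<^sub>E Y)"
    unfolding fcode_nat_def by (rule inj_on_subset) (use * in \<open>auto simp: small_nat_def\<close>)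
  show "small (fcode ` (X \<rightarrow>\<^sub>E Y))"
    using * by (auto simp: small_nat_def intro!: finite_PiE)
qed (auto simp: small_nat_def pair_nat_def inj_prod_encode intro: finite_subset)

end

definition SET :: "('u::set_universe set, 'u \<Rightarrow> 'u) category" where
  "SET = \<lparr> Ob = {X. small X}, Hom = (\<lambda>X Y. X \<rightarrow>\<^sub>E Y), ident = (\<lambda>X. restrict id X),
           cmp = (\<lambda>X Y Z g f. compose X g f) \<rparr>"

definition prod_set :: "'u::set_universe set \<Rightarrow> 'u set \<Rightarrow> 'u set" where
  "prod_set X Y = pair ` (X \<times> Y)"

definition proj1 :: "'u::set_universe set \<Rightarrow> 'u set \<Rightarrow> 'u \<Rightarrow> 'u" where
  "proj1 X Y = restrict (\<lambda>p. fst (inv pair p)) (prod_set X Y)"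

definition proj2 :: "'u::set_universe set \<Rightarrow> 'u set \<Rightarrow> 'u \<Rightarrow> 'u" where
  "proj2 X Y = restrict (\<lambda>p. snd (inv pair p)) (prod_set X Y)"


section \<open>Quantales and relations\<close>

text \<open>The tensor is \<open>*\<close> and its neutral element \<open>k\<close> is \<open>1\<close>.\<close>

class comm_quantale = comm_monoid_mult + complete_lattice +
  assumes mult_Sup: "x * Sup S = (SUP y\<in>S. x * y)"

definition qhom :: "'v::comm_quantale \<Rightarrow> 'v \<Rightarrow> 'v" where
  "qhom y z = Sup {x. x * y \<le> z}"

text \<open>
  A relation \<open>X \<nrightarrow> Y\<close> is a map on \<open>X \<times> Y\<close>; it is represented by its extension by \<open>bot\<close>, so that
  equality of relations is equality in HOL.
\<close>

definition vrel :: "'u set \<Rightarrow> 'u set \<Rightarrow> ('u \<Rightarrow> 'u \<Rightarrow> 'v::comm_quantale) set" where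
  "vrel X Y = {r. \<forall>x y. \<not> (x \<in> X \<and> y \<in> Y) \<longrightarrow> r x y = bot}"

definition vcomp :: \<comment> \<open>\<open>vcomp Y s r\<close> is \<open>s \<cdot> r\<close> for \<open>r : X \<nrightarrow> Y\<close> and \<open>s : Y \<nrightarrow> Z\<close>\<close>
    "'u set \<Rightarrow> ('u \<Rightarrow> 'u \<Rightarrow> 'v::comm_quantale) \<Rightarrow> ('u \<Rightarrow> 'u \<Rightarrow> 'v) \<Rightarrow> 'u \<Rightarrow> 'u \<Rightarrow> 'v" where
  "vcomp Y s r = (\<lambda>x z. SUP y\<in>Y. r x y * s y z)"

definition vconv :: "('u \<Rightarrow> 'u \<Rightarrow> 'v::comm_quantale) \<Rightarrow> 'u \<Rightarrow> 'u \<Rightarrow> 'v" where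
  "vconv r = (\<lambda>y x. r x y)"

definition vgraph :: "'u set \<Rightarrow> ('u \<Rightarrow> 'u) \<Rightarrow> 'u \<Rightarrow> 'u \<Rightarrow> 'v::comm_quantale" where
  "vgraph X f = (\<lambda>x y. if x \<in> X \<and> f x = y then 1 else bot)"

definition direct_image :: \<comment> \<open>\<open>f\<^sub>! \<phi>\<close> for \<open>f\<close> defined on \<open>X\<close>\<close>
    "'u set \<Rightarrow> ('u \<Rightarrow> 'u) \<Rightarrow> ('u \<Rightarrow> 'v::comm_quantale) \<Rightarrow> 'u \<Rightarrow> 'v" where
  "direct_image X f \<phi> = (\<lambda>y. SUP x\<in>{x\<in>X. f x = y}. \<phi> x)"


section \<open>Topological theories\<close>

text \<open>
  The quantale is a type \<open>'v\<close>, embedded into the universe by \<open>emb\<close> so that the functor can be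
  applied to it; \<open>xi\<close> takes its values in \<open>'v\<close> directly.
\<close>

record ('u, 'v) top_theory =
  tmon :: "('u set, 'u \<Rightarrow> 'u) monad_data"
  emb :: "'v \<Rightarrow> 'u"
  xi :: "'u \<Rightarrow> 'v"

abbreviation T where "T \<T> \<equiv> Fob (tmon \<T>)"
abbreviation Tmap where "Tmap \<T> \<equiv> Fmap (tmon \<T>)"
abbreviation Te where "Te \<T> \<equiv> unit (tmon \<T>)"
abbreviation Tm where "Tm \<T> \<equiv> mult (tmon \<T>)"

definition Vset :: "('u::set_universe, 'v::comm_quantale) top_theory \<Rightarrow> 'u set" where
  "Vset \<T> = range (emb \<T>)"

definition val :: "('u::set_universe, 'v::comm_quantale) top_theory \<Rightarrow> 'u \<Rightarrow> 'v" where
  "val \<T> = inv (emb \<T>)"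

definition vmap :: \<comment> \<open>the map \<open>\<phi> : X \<rightarrow> 'v\<close> as a morphism of \<open>SET\<close>\<close>
    "('u::set_universe, 'v::comm_quantale) top_theory \<Rightarrow> 'u set \<Rightarrow> ('u \<Rightarrow> 'v) \<Rightarrow> 'u \<Rightarrow> 'u" where
  "vmap \<T> X \<phi> = restrict (\<lambda>x. emb \<T> (\<phi> x)) X"

definition xiT :: \<comment> \<open>\<open>\<xi> \<cdot> T\<phi>\<close> for \<open>\<phi> : X \<rightarrow> 'v\<close>\<close>
    "('u::set_universe, 'v::comm_quantale) top_theory \<Rightarrow> 'u set \<Rightarrow> ('u \<Rightarrow> 'v) \<Rightarrow> 'u \<Rightarrow> 'v" where
  "xiT \<T> X \<phi> = (\<lambda>\<xx>. xi \<T> (Tmap \<T> X (Vset \<T>) (vmap \<T> X \<phi>) \<xx>))"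

definition topological_theory :: "('u::set_universe, 'v::comm_quantale) top_theory \<Rightarrow> bool" where
  "topological_theory \<T> \<longleftrightarrow>
    is_monad SET (tmon \<T>) \<and> inj (emb \<T>) \<and> small (Vset \<T>) \<and>
    (\<forall>P A B D p q f g. small P \<longrightarrow> small A \<longrightarrow> small B \<longrightarrow> small D \<longrightarrow>
      is_weak_pullback SET P A B D p q f g \<longrightarrow>
      is_weak_pullback SET (T \<T> P) (T \<T> A) (T \<T> B) (T \<T> D)
        (Tmap \<T> P A p) (Tmap \<T> P B q) (Tmap \<T> A D f) (Tmap \<T> B D g)) \<and>
    (\<forall>X Y f. small X \<longrightarrow> small Y \<longrightarrow> f \<in> X \<rightarrow>\<^sub>E Y \<longrightarrow>
      is_weak_pullback SET (T \<T> (T \<T> X)) (T \<T> X) (T \<T> (T \<T> Y)) (T \<T> Y)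
        (Tm \<T> X) (Tmap \<T> (T \<T> X) (T \<T> Y) (Tmap \<T> X Y f)) (Tmap \<T> X Y f) (Tm \<T> Y)) \<and>
    is_em_algebra SET (tmon \<T>) (Vset \<T>) (vmap \<T> (T \<T> (Vset \<T>)) (xi \<T>)) \<and>
    (let V = Vset \<T>; VV = prod_set V V in
      \<forall>\<ww>\<in>T \<T> VV. xiT \<T> VV (\<lambda>p. val \<T> (proj1 V V p) * val \<T> (proj2 V V p)) \<ww>
        = xi \<T> (Tmap \<T> VV V (proj1 V V) \<ww>) * xi \<T> (Tmap \<T> VV V (proj2 V V) \<ww>)) \<and>
    (\<forall>x. \<forall>\<tt>\<in>T \<T> {x}. xiT \<T> {x} (\<lambda>_. 1) \<tt> = 1) \<and>
    (\<forall>X Y f \<phi>. small X \<longrightarrow> small Y \<longrightarrow> f \<in> X \<rightarrow>\<^sub>E Y \<longrightarrow>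
      (\<forall>\<yy>\<in>T \<T> Y. xiT \<T> Y (direct_image X f \<phi>) \<yy>
        = direct_image (T \<T> X) (Tmap \<T> X Y f) (xiT \<T> X \<phi>) \<yy>))"

definition Txi :: \<comment> \<open>\<open>T\<^sub>\<xi> r\<close> for \<open>r : X \<nrightarrow> Y\<close>\<close>
    "('u::set_universe, 'v::comm_quantale) top_theory \<Rightarrow> 'u set \<Rightarrow> 'u set
      \<Rightarrow> ('u \<Rightarrow> 'u \<Rightarrow> 'v) \<Rightarrow> 'u \<Rightarrow> 'u \<Rightarrow> 'v" where
  "Txi \<T> X Y r = (\<lambda>\<xx> \<yy>.
    SUP \<ww>\<in>{\<ww>\<in>T \<T> (prod_set X Y). Tmap \<T> (prod_set X Y) X (proj1 X Y) \<ww> = \<xx> \<and>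
                              Tmap \<T> (prod_set X Y) Y (proj2 X Y) \<ww> = \<yy>}.
      xiT \<T> (prod_set X Y) (\<lambda>p. r (proj1 X Y p) (proj2 X Y p)) \<ww>)"


section \<open>\<open>\<T>\<close>-categories\<close>

type_synonym ('u, 'v) tcat = "'u set \<times> ('u \<Rightarrow> 'u \<Rightarrow> 'v)"

definition is_tcat ::
    "('u::set_universe, 'v::comm_quantale) top_theory \<Rightarrow> ('u, 'v) tcat \<Rightarrow> bool" where
  "is_tcat \<T> = (\<lambda>(X, a). small X \<and> a \<in> vrel (T \<T> X) X \<and>
    vconv (vgraph X (Te \<T> X)) \<le> a \<and>
    vcomp (T \<T> X) a (vcomp (T \<T> (T \<T> X)) (Txi \<T> (T \<T> X) X a)
      (vconv (vgraph (T \<T> (T \<T> X)) (Tm \<T> X)))) \<le> a)"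

definition tfunctors ::
    "('u::set_universe, 'v::comm_quantale) top_theory \<Rightarrow> ('u, 'v) tcat \<Rightarrow> ('u, 'v) tcat
      \<Rightarrow> ('u \<Rightarrow> 'u) set" where
  "tfunctors \<T> = (\<lambda>(X, a) (Y, b).
    {f \<in> X \<rightarrow>\<^sub>E Y. \<forall>\<xx>\<in>T \<T> X. \<forall>x\<in>X. a \<xx> x \<le> b (Tmap \<T> X Y f \<xx>) (f x)})"

definition under :: \<comment> \<open>the relation \<open>a\<^sub>0 : X \<nrightarrow> X\<close>\<close>
    "('u::set_universe, 'v::comm_quantale) top_theory \<Rightarrow> ('u, 'v) tcat \<Rightarrow> 'u \<Rightarrow> 'u \<Rightarrow> 'v" where
  "under \<T> = (\<lambda>(X, a). vcomp (T \<T> X) a (vgraph X (Te \<T> X)))"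

definition TCat ::
    "('u::set_universe, 'v::comm_quantale) top_theory
      \<Rightarrow> (('u, 'v) tcat, 'u \<Rightarrow> 'u) ord_category" where
  "TCat \<T> = \<lparr> Ob = {A. is_tcat \<T> A}, Hom = tfunctors \<T>, ident = (\<lambda>A. restrict id (fst A)),
    cmp = (\<lambda>A B C g f. compose (fst A) g f),
    le = (\<lambda>A B f g. \<forall>x\<in>fst A. 1 \<le> under \<T> B (f x) (g x)) \<rparr>"

definition Tobj ::
    "('u::set_universe, 'v::comm_quantale) top_theory \<Rightarrow> ('u, 'v) tcat \<Rightarrow> ('u, 'v) tcat" where
  "Tobj \<T> = (\<lambda>(X, a). (T \<T> X,
    let m = vgraph (T \<T> (T \<T> X)) (Tm \<T> X)
    in vcomp (T \<T> (T \<T> X)) (Txi \<T> (T \<T> X) X a) (vcomp (T \<T> X) (vconv m) m)))"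

definition representation :: \<comment> \<open>\<open>\<alpha> \<stileturn> e\<^sub>X\<close> in \<open>\<T>-Cat\<close>\<close>
    "('u::set_universe, 'v::comm_quantale) top_theory \<Rightarrow> ('u, 'v) tcat \<Rightarrow> ('u \<Rightarrow> 'u) \<Rightarrow> bool" where
  "representation \<T> A \<alpha> \<longleftrightarrow> left_adjoint (TCat \<T>) (Tobj \<T> A) A \<alpha> (Te \<T> (fst A))"

definition representable ::
    "('u::set_universe, 'v::comm_quantale) top_theory \<Rightarrow> ('u, 'v) tcat \<Rightarrow> bool" where
  "representable \<T> A \<longleftrightarrow> (\<exists>\<alpha>. representation \<T> A \<alpha>)"

definition pseudo_homomorphism ::
    "('u::set_universe, 'v::comm_quantale) top_theory \<Rightarrow> ('u, 'v) tcat \<Rightarrow> ('u, 'v) tcat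
      \<Rightarrow> ('u \<Rightarrow> 'u) \<Rightarrow> bool" where
  "pseudo_homomorphism \<T> A B f \<longleftrightarrow> f \<in> tfunctors \<T> A B \<and>
    (\<forall>\<alpha> \<beta>. representation \<T> A \<alpha> \<longrightarrow> representation \<T> B \<beta> \<longrightarrow>
      (let TA = Tobj \<T> A; TB = Tobj \<T> B;
           \<beta>Tf = cmp (TCat \<T>) TA TB B \<beta> (Tmap \<T> (fst A) (fst B) f);
           f\<alpha> = cmp (TCat \<T>) TA A B f \<alpha>
       in le (TCat \<T>) TA B \<beta>Tf f\<alpha> \<and> le (TCat \<T>) TA B f\<alpha> \<beta>Tf))"

definition ReprCat ::
    "('u::set_universe, 'v::comm_quantale) top_theory
      \<Rightarrow> (('u, 'v) tcat, 'u \<Rightarrow> 'u) ord_category" where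
  "ReprCat \<T> = (TCat \<T>)\<lparr> Ob := {A. is_tcat \<T> A \<and> representable \<T> A},
    Hom := (\<lambda>A B. {f. pseudo_homomorphism \<T> A B f}) \<rparr>"


section \<open>The monad\<close>

definition Vtcat :: "('u::set_universe, 'v::comm_quantale) top_theory \<Rightarrow> ('u, 'v) tcat" where
  "Vtcat \<T> = (Vset \<T>, \<lambda>\<vv> v. if \<vv> \<in> T \<T> (Vset \<T>) \<and> v \<in> Vset \<T> then qhom (xi \<T> \<vv>) (val \<T> v) else bot)"

text \<open>The elements of \<open>Vpow \<T> A\<close> are the codes of the \<open>\<T>\<close>-functors from \<open>A\<close> to the quantale.\<close>

definition Vpow :: "('u::set_universe, 'v::comm_quantale) top_theory \<Rightarrow> ('u, 'v) tcat \<Rightarrow> 'u set" where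
  "Vpow \<T> A = fcode ` tfunctors \<T> A (Vtcat \<T>)"

definition vencode ::
    "('u::set_universe, 'v::comm_quantale) top_theory \<Rightarrow> 'u set \<Rightarrow> ('u \<Rightarrow> 'v) \<Rightarrow> 'u" where
  "vencode \<T> X \<phi> = fcode (vmap \<T> X \<phi>)"

definition vdecode ::
    "('u::set_universe, 'v::comm_quantale) top_theory \<Rightarrow> 'u set \<Rightarrow> 'u \<Rightarrow> 'u \<Rightarrow> 'v" where
  "vdecode \<T> X c = (\<lambda>x. val \<T> (inv_into (X \<rightarrow>\<^sub>E Vset \<T>) fcode c x))"

definition ev ::
    "('u::set_universe, 'v::comm_quantale) top_theory \<Rightarrow> ('u, 'v) tcat \<Rightarrow> 'u \<Rightarrow> 'u \<Rightarrow> 'v" where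
  "ev \<T> A = (\<lambda>c x. if c \<in> Vpow \<T> A \<and> x \<in> fst A then vdecode \<T> (fst A) c x else bot)"

definition ev_mu :: \<comment> \<open>\<open>\<mu> = a \<cdot> T\<^sub>\<xi> ev\<close>\<close>
    "('u::set_universe, 'v::comm_quantale) top_theory \<Rightarrow> ('u, 'v) tcat \<Rightarrow> 'u \<Rightarrow> 'u \<Rightarrow> 'v" where
  "ev_mu \<T> = (\<lambda>(X, a). vcomp (T \<T> X) a (Txi \<T> (Vpow \<T> (X, a)) X (ev \<T> (X, a))))"

definition Vobj ::
    "('u::set_universe, 'v::comm_quantale) top_theory \<Rightarrow> ('u, 'v) tcat \<Rightarrow> ('u, 'v) tcat" where
  "Vobj \<T> A = (Vpow \<T> A, \<lambda>\<pp> c. if \<pp> \<in> T \<T> (Vpow \<T> A) \<and> c \<in> Vpow \<T> A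
    then (INF x\<in>fst A. qhom (vdecode \<T> (fst A) c x) (ev_mu \<T> A \<pp> x)) else bot)"

definition Vfun ::
    "('u::set_universe, 'v::comm_quantale) top_theory \<Rightarrow> ('u, 'v) tcat \<Rightarrow> ('u, 'v) tcat
      \<Rightarrow> ('u \<Rightarrow> 'u) \<Rightarrow> 'u \<Rightarrow> 'u" where
  "Vfun \<T> = (\<lambda>(X, a) (Y, b) f. restrict (\<lambda>c. vencode \<T> Y
      (\<lambda>y. SUP \<xx>\<in>T \<T> X. xiT \<T> X (vdecode \<T> X c) \<xx> * b (Tmap \<T> X Y f \<xx>) y))
    (Vpow \<T> (X, a)))"

definition Vunit ::
    "('u::set_universe, 'v::comm_quantale) top_theory \<Rightarrow> ('u, 'v) tcat \<Rightarrow> 'u \<Rightarrow> 'u" where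
  "Vunit \<T> A = restrict (\<lambda>x. vencode \<T> (fst A) (under \<T> A x)) (fst A)"

definition Vmult ::
    "('u::set_universe, 'v::comm_quantale) top_theory \<Rightarrow> ('u, 'v) tcat \<Rightarrow> 'u \<Rightarrow> 'u" where
  "Vmult \<T> A = restrict
    (\<lambda>c. vencode \<T> (fst A) (\<lambda>x. vdecode \<T> (Vpow \<T> A) c (Vunit \<T> A x)))
    (Vpow \<T> (Vobj \<T> A))"

definition Vmonad ::
    "('u::set_universe, 'v::comm_quantale) top_theory
      \<Rightarrow> (('u, 'v) tcat, 'u \<Rightarrow> 'u) monad_data" where
  "Vmonad \<T> = \<lparr> Fob = Vobj \<T>, Fmap = Vfun \<T>, unit = Vunit \<T>, mult = Vmult \<T> \<rparr>"

end

theory Submission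
  imports Defs
begin

text \<open>
  For a map \<open>\<phi> : X \<rightarrow> \<V>\<close> let \<open>\<phi>'\<close> be its extension \<open>\<xi> \<cdot> T\<phi>\<close> to \<open>TX\<close>. On a \<open>\<T>\<close>-category \<open>(X, a)\<close> the maps
  that are \<open>\<T>\<close>-functors into \<open>\<V>\<close> are the closed elements of the closure operator
  \<open>\<phi> \<mapsto> (x \<mapsto> SUP \<xx>. \<phi>' \<xx> * a \<xx> x)\<close>, and \<open>Vf \<phi>\<close> is the closure of the direct image of \<open>\<phi>\<close> along \<open>f\<close>.
  Hence, for the pointwise order, \<open>Vf\<close> is left adjoint to precomposition with \<open>f\<close>
  (\<open>Vfun_adjunction\<close>). With \<open>[\<phi>, \<psi>] = (INF x. hom (\<phi> x) (\<psi> x))\<close>, the Yoneda lemma \<open>[\<h> x, \<psi>] = \<psi> x\<close> makes the multiplication \<open>\<w>\<^sub>X\<close> left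
  adjoint to the unit \<open>\<h>\<close> at \<open>VX\<close> (\<open>Vmult_adjunction\<close>); both adjunctions hold in the stronger form in
  which both sides are scaled by an element of the quantale. Left adjoints are determined by their
  right adjoints, so each equation between composites of maps \<open>Vf\<close> and \<open>\<w>\<close> follows by comparing right
  adjoints; concretely, two elements of \<open>VX\<close> are equal as soon as they lie below the same elements. The
  naturality of \<open>\<h>\<close> and the law \<open>\<w> \<cdot> \<h> = 1\<close> are direct consequences of the Yoneda lemma.

  The order that \<open>VX\<close> carries as a \<open>\<T>\<close>-category is the opposite of the pointwise one. Read in this
  order, the second adjunction says that the unit at \<open>VX\<close> is left adjoint to the multiplication,
  and monotonicity of \<open>f \<mapsto> Vf\<close> comes from the monotonicity of \<open>\<T>\<close>-functors into \<open>\<V>\<close>. This is the Kock-Zoeberlein property.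

  That all the maps are \<open>\<T>\<close>-functors, and pseudo-homomorphisms, is a statement about relations. A
  relation \<open>r\<close> from \<open>S\<close> to \<open>X\<close> is lifted to the relation \<open>a \<cdot> T\<^sub>\<xi> r\<close> from \<open>TS\<close> to \<open>X\<close>; its rows
  are again \<open>\<T>\<close>-functors into \<open>\<V>\<close> (\<open>vfunctor_lift\<close>), and lifting twice is bounded by lifting once along
  the multiplication of the monad (\<open>lift_lift_le\<close>). The relation \<open>\<mu>\<close> that defines the structure
  of \<open>VX\<close> is the lift of evaluation, and for any map \<open>f\<close> into \<open>VX\<close> both conditions are inequalities between
  lifts (\<open>tfunctor_Vobj_iff\<close>, \<open>pseudo_homomorphism_VobjI\<close>). This needs that \<open>T\<^sub>\<xi>\<close> preserves
  composition and that \<open>T\<^sub>\<xi> r\<close> at \<open>e x\<close> is the extension of the row \<open>r x\<close>; the latter is where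
  \<open>T1 = 1\<close> enters.

  Since \<open>\<mu> \<pp>\<close> is an element of \<open>VX\<close>, the structure of \<open>VX\<close> is \<open>(\<pp>, \<phi>) \<mapsto> [\<phi>, \<mu> \<pp>]\<close>, so that
  \<open>\<mu>\<close> is the only candidate for the left adjoint of \<open>e\<close>. It is a \<open>\<T>\<close>-functor once \<open>a \<cdot> T\<^sub>\<xi> a = a \<cdot> m\<close>, and
  this equation holds for representable \<open>X\<close>, where \<open>a = a\<^sub>0 \<cdot> \<alpha>\<close>
  (\<open>lift_lift_representable\<close>, \<open>Vrep_representation\<close>).
\<close>

section \<open>Restricting a Kock-Zoeberlein monad to a subcategory\<close>

text \<open>All laws and inequalities are inherited from the ambient category; only closure under the
  operations has to be checked.\<close>

lemma kock_zoeberlein_subcategory: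
  fixes C :: "('o, 'm, 'z) ord_category_scheme"
  assumes C: "is_ord_category C" and M: "is_monad C M"
    and mono: "\<And>A B f g. A \<in> Ob C \<Longrightarrow> B \<in> Ob C \<Longrightarrow> f \<in> Hom C A B \<Longrightarrow> g \<in> Hom C A B \<Longrightarrow> le C A B f g \<Longrightarrow>
        le C (Fob M A) (Fob M B) (Fmap M A B f) (Fmap M A B g)"
    and adj: "\<And>A. A \<in> Ob C \<Longrightarrow> left_adjoint C (Fob M A) (Fob M (Fob M A)) (unit M (Fob M A)) (mult M A)"
    and O: "P \<subseteq> Ob C" and H: "\<And>A B f. A \<in> P \<Longrightarrow> B \<in> P \<Longrightarrow> f \<in> H A B \<Longrightarrow> f \<in> Hom C A B"
    and id: "\<And>A. A \<in> P \<Longrightarrow> ident C A \<in> H A A"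
    and comp: "\<And>A B D f g. A \<in> P \<Longrightarrow> B \<in> P \<Longrightarrow> D \<in> P \<Longrightarrow> f \<in> H A B \<Longrightarrow> g \<in> H B D \<Longrightarrow> cmp C A B D g f \<in> H A D"
    and Fob: "\<And>A. A \<in> P \<Longrightarrow> Fob M A \<in> P"
    and Fmap: "\<And>A B f. A \<in> P \<Longrightarrow> B \<in> P \<Longrightarrow> f \<in> H A B \<Longrightarrow> Fmap M A B f \<in> H (Fob M A) (Fob M B)"
    and unit: "\<And>A. A \<in> P \<Longrightarrow> unit M A \<in> H A (Fob M A)"
    and mult: "\<And>A. A \<in> P \<Longrightarrow> mult M A \<in> H (Fob M (Fob M A)) (Fob M A)"
  shows "kock_zoeberlein (C\<lparr>Ob := P, Hom := H\<rparr>) M"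
proof -
  let ?D = "C\<lparr>Ob := P, Hom := H\<rparr>"
  have Ob: "A \<in> Ob C" if "A \<in> P" for A using O that by blast
  note C' = C[unfolded is_ord_category_def is_category_def]
  note C_laws = C'[THEN conjunct1]
  have cat: "is_category ?D"
    unfolding is_category_def
  proof (intro conjI ballI)
    fix A B f assume "A \<in> Ob ?D" "B \<in> Ob ?D" "f \<in> Hom ?D A B"
    then have *: "A \<in> Ob C" "B \<in> Ob C" "f \<in> Hom C A B" using Ob H by simp_all
    show "cmp ?D A A B f (ident ?D A) = f" "cmp ?D A B B (ident ?D B) f = f"
      using C_laws[THEN conjunct2, THEN conjunct2, THEN conjunct1] * by simp_all
  next
    fix A B D E f g h assume "A \<in> Ob ?D" "B \<in> Ob ?D" "D \<in> Ob ?D" "E \<in> Ob ?D"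
      "f \<in> Hom ?D A B" "g \<in> Hom ?D B D" "h \<in> Hom ?D D E"
    then have *: "A \<in> Ob C" "B \<in> Ob C" "D \<in> Ob C" "E \<in> Ob C" "f \<in> Hom C A B" "g \<in> Hom C B D" "h \<in> Hom C D E"
      using Ob H by simp_all
    show "cmp ?D A D E h (cmp ?D A B D g f) = cmp ?D A B E (cmp ?D B D E h g) f"
      using C_laws[THEN conjunct2, THEN conjunct2, THEN conjunct2] * by simp
  qed (auto intro: id comp)
  have ord: "is_ord_category ?D"
    unfolding is_ord_category_def
  proof (intro conjI cat ballI impI)
    fix A B f assume "A \<in> Ob ?D" "B \<in> Ob ?D" "f \<in> Hom ?D A B"
    then have *: "A \<in> Ob C" "B \<in> Ob C" "f \<in> Hom C A B" using Ob H by simp_all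
    show "le ?D A B f f" using C'[THEN conjunct2, THEN conjunct1] * by simp
  next
    fix A B f g h assume "A \<in> Ob ?D" "B \<in> Ob ?D" "f \<in> Hom ?D A B" "g \<in> Hom ?D A B" "h \<in> Hom ?D A B"
      and le: "le ?D A B f g" "le ?D A B g h"
    then have *: "A \<in> Ob C" "B \<in> Ob C" "f \<in> Hom C A B" "g \<in> Hom C A B" "h \<in> Hom C A B" using Ob H by simp_all
    from le have "le C A B f g" "le C A B g h" by simp_all
    with C'[THEN conjunct2, THEN conjunct2, THEN conjunct1] * have "le C A B f h" by blast
    then show "le ?D A B f h" by simp
  next
    fix A B D f f' g g' assume "A \<in> Ob ?D" "B \<in> Ob ?D" "D \<in> Ob ?D"
      "f \<in> Hom ?D A B" "f' \<in> Hom ?D A B" "g \<in> Hom ?D B D" "g' \<in> Hom ?D B D"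
      and le: "le ?D A B f f'" "le ?D B D g g'"
    then have *: "A \<in> Ob C" "B \<in> Ob C" "D \<in> Ob C" "f \<in> Hom C A B" "f' \<in> Hom C A B" "g \<in> Hom C B D" "g' \<in> Hom C B D"
      using Ob H by simp_all
    from le have "le C A B f f'" "le C B D g g'" by simp_all
    with C'[THEN conjunct2, THEN conjunct2, THEN conjunct2] * show "le ?D A D (cmp ?D A B D g f) (cmp ?D A B D g' f')"
      by simp
  qed
  note M' = M[unfolded is_monad_def is_endofunctor_def]
  note M_functor = M'[THEN conjunct1, THEN conjunct2]
  note M_laws = M'[THEN conjunct2, THEN conjunct2, THEN conjunct2]
  have monad: "is_monad ?D M"
    unfolding is_monad_def is_endofunctor_def
  proof (intro conjI cat ballI)
    fix A assume "A \<in> Ob ?D"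
    then have A: "A \<in> Ob C" using Ob by simp
    show "Fmap M A A (ident ?D A) = ident ?D (Fob M A)"
      using M_functor[THEN conjunct2, THEN conjunct2, THEN conjunct1] A by simp
    show "cmp ?D (Fob M A) (Fob M (Fob M A)) (Fob M A) (mult M A) (monad_data.unit M (Fob M A)) = ident ?D (Fob M A)"
      using M_laws[THEN conjunct2, THEN conjunct2, THEN conjunct1] A by simp
    show "cmp ?D (Fob M A) (Fob M (Fob M A)) (Fob M A) (mult M A) (Fmap M A (Fob M A) (monad_data.unit M A))
        = ident ?D (Fob M A)"
      using M_laws[THEN conjunct2, THEN conjunct2, THEN conjunct2, THEN conjunct1] A by simp
    show "cmp ?D (Fob M (Fob M (Fob M A))) (Fob M (Fob M A)) (Fob M A) (mult M A) (mult M (Fob M A))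
        = cmp ?D (Fob M (Fob M (Fob M A))) (Fob M (Fob M A)) (Fob M A)
          (mult M A) (Fmap M (Fob M (Fob M A)) (Fob M A) (mult M A))"
      using M_laws[THEN conjunct2, THEN conjunct2, THEN conjunct2, THEN conjunct2] A by simp
  next
    fix A B f assume "A \<in> Ob ?D" "B \<in> Ob ?D" "f \<in> Hom ?D A B"
    then have *: "A \<in> Ob C" "B \<in> Ob C" "f \<in> Hom C A B" using Ob H by simp_all
    show "cmp ?D A (Fob M A) (Fob M B) (Fmap M A B f) (monad_data.unit M A) = cmp ?D A B (Fob M B) (monad_data.unit M B) f"
      using M_laws[THEN conjunct1] * by simp
    show "cmp ?D (Fob M (Fob M A)) (Fob M A) (Fob M B) (Fmap M A B f) (mult M A)
          = cmp ?D (Fob M (Fob M A)) (Fob M (Fob M B)) (Fob M B)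
              (mult M B) (Fmap M (Fob M A) (Fob M B) (Fmap M A B f))"
      using M_laws[THEN conjunct2, THEN conjunct1] * by simp
  next
    fix A B D f g assume "A \<in> Ob ?D" "B \<in> Ob ?D" "D \<in> Ob ?D" "f \<in> Hom ?D A B" "g \<in> Hom ?D B D"
    then have *: "A \<in> Ob C" "B \<in> Ob C" "D \<in> Ob C" "f \<in> Hom C A B" "g \<in> Hom C B D" using Ob H by simp_all
    show "Fmap M A D (cmp ?D A B D g f) = cmp ?D (Fob M A) (Fob M B) (Fob M D) (Fmap M B D g) (Fmap M A B f)"
      using M_functor[THEN conjunct2, THEN conjunct2, THEN conjunct2] * by simp
  qed (auto intro: Fob Fmap unit mult)
  have "\<forall>A\<in>Ob ?D. left_adjoint ?D (Fob M A) (Fob M (Fob M A)) (monad_data.unit M (Fob M A)) (mult M A)"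
  proof
    fix A assume "A \<in> Ob ?D"
    then have A: "A \<in> P" by simp
    show "left_adjoint ?D (Fob M A) (Fob M (Fob M A)) (monad_data.unit M (Fob M A)) (mult M A)"
      using adj[OF Ob[OF A]] unit[OF Fob[OF A]] mult[OF A] by (simp add: left_adjoint_def)
  qed
  moreover have "\<forall>A\<in>Ob ?D. \<forall>B\<in>Ob ?D. \<forall>f\<in>Hom ?D A B. \<forall>g\<in>Hom ?D A B.
        le ?D A B f g \<longrightarrow> le ?D (Fob M A) (Fob M B) (Fmap M A B f) (Fmap M A B g)"
    using mono Ob H by simp
  ultimately show ?thesis
    unfolding kock_zoeberlein_def using ord monad by blast
qed

section \<open>Quantales\<close>

lemma quantale_mult_mono:
  fixes x x' y y' :: "'v::comm_quantale"
  assumes "x \<le> x'" and "y \<le> y'"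
  shows "x * y \<le> x' * y'"
proof -
  have mono: "u * v \<le> u * v'" if "v \<le> v'" for u v v' :: 'v
  proof -
    have "u * v' = u * Sup {v, v'}" using that by (simp add: sup_absorb2)
    also have "\<dots> = sup (u * v) (u * v')" unfolding mult_Sup by simp
    finally show ?thesis by (metis sup_ge1)
  qed
  have "x * y \<le> x * y'" using assms(2) by (rule mono)
  also have "\<dots> \<le> x' * y'" using mono[OF assms(1), of y'] by (simp add: mult.commute)
  finally show ?thesis .
qed

lemma quantale_mult_SUP: "x * (SUP i\<in>I. f i) = (SUP i\<in>I. x * f i)" for x :: "'v::comm_quantale"
  by (simp add: mult_Sup image_image)

lemma quantale_SUP_mult: "(SUP i\<in>I. f i) * x = (SUP i\<in>I. f i * x)" for x :: "'v::comm_quantale"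
  by (simp add: quantale_mult_SUP mult.commute)

lemma quantale_mult_bot [simp]:
  fixes x :: "'v::comm_quantale"
  shows "x * bot = bot" "bot * x = bot"
  using mult_Sup[of x "{}"] by (simp_all add: mult.commute)

lemma le_qhom_iff: "x \<le> qhom y z \<longleftrightarrow> x * y \<le> z" for x y z :: "'v::comm_quantale"
proof
  assume "x \<le> qhom y z"
  then have "x * y \<le> qhom y z * y" by (simp add: quantale_mult_mono)
  also have "\<dots> = (SUP x\<in>{x. x * y \<le> z}. x * y)"
    unfolding qhom_def using quantale_SUP_mult[of "\<lambda>x. x" "{x. x * y \<le> z}" y] by simp
  also have "\<dots> \<le> z" by (auto intro: SUP_least)
  finally show "x * y \<le> z" .
qed (auto simp: qhom_def intro: Sup_upper)

text \<open>Values of internal homs are only accessible through what lies below them; this turns such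
  descriptions into equations.\<close>

lemma eq_if_same_lower_bounds:
  fixes v w :: "'v::order"
  assumes "\<And>u. u \<le> v \<longleftrightarrow> u \<le> w"
  shows "v = w"
  using assms[of v] assms[of w] by (intro antisym) auto

section \<open>Relations\<close>

text \<open>Both sides are the supremum of \<open>r x y * s y z * t z w\<close> over all \<open>y\<close> and \<open>z\<close>.\<close>

lemma vcomp_assoc: "vcomp Z t (vcomp Y s r) = vcomp Y (vcomp Z t s) r"
proof (intro ext)
  fix x w
  have "vcomp Z t (vcomp Y s r) x w = (SUP z\<in>Z. SUP y\<in>Y. r x y * s y z * t z w)"
    by (simp add: vcomp_def quantale_SUP_mult)
  also have "\<dots> = (SUP y\<in>Y. SUP z\<in>Z. r x y * s y z * t z w)"
    by (rule SUP_commute)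
  also have "\<dots> = vcomp Y (vcomp Z t s) r x w"
    by (simp add: vcomp_def quantale_mult_SUP mult.assoc)
  finally show "vcomp Z t (vcomp Y s r) x w = vcomp Y (vcomp Z t s) r x w" .
qed

lemma vcomp_mono: "s \<le> s' \<Longrightarrow> r \<le> r' \<Longrightarrow> vcomp Y s r \<le> vcomp Y s' r'"
  unfolding vcomp_def le_fun_def by (blast intro: SUP_mono quantale_mult_mono)

lemma vcomp_upper: "y \<in> Y \<Longrightarrow> r x y * s y z \<le> vcomp Y s r x z"
  unfolding vcomp_def by (rule SUP_upper)

lemma vcomp_vgraph:
  assumes "f \<in> X \<rightarrow> Y" and "x \<in> X"
  shows "vcomp Y s (vgraph X f) x z = s (f x) z"
proof (rule antisym)
  show "vcomp Y s (vgraph X f) x z \<le> s (f x) z"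
    unfolding vcomp_def vgraph_def by (rule SUP_least) auto
  have "1 * s (f x) z \<le> vcomp Y s (vgraph X f) x z"
    using vcomp_upper[of "f x" Y "vgraph X f" x s z] assms by (auto simp: vgraph_def)
  then show "s (f x) z \<le> vcomp Y s (vgraph X f) x z" by simp
qed

lemma vgraph_vcomp:
  assumes "y \<in> Y"
  shows "r x y \<le> vcomp Y (vgraph Y f) r x (f y)"
  using vcomp_upper[of y Y r x "vgraph Y f" "f y"] assms by (simp add: vgraph_def)

lemma vcomp_le_iff:
  "vcomp Y s r x z \<le> u \<longleftrightarrow> (\<forall>y\<in>Y. r x y * s y z \<le> u)"
  unfolding vcomp_def by (rule SUP_le_iff)

section \<open>The functor and the monad, elementwise\<close>

lemma pair_eq_iff [simp]: "pair p = pair q \<longleftrightarrow> p = q"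
  by (simp add: inj_eq[OF inj_pair])

lemma pair_inverse [simp]: "inv pair (pair p) = p"
  by (simp add: inj_pair)

lemma prod_set_iff: "p \<in> prod_set X Y \<longleftrightarrow> (\<exists>x\<in>X. \<exists>y\<in>Y. p = pair (x, y))"
  unfolding prod_set_def by auto

lemma pair_in_prod_set [simp]: "pair (x, y) \<in> prod_set X Y \<longleftrightarrow> x \<in> X \<and> y \<in> Y"
  unfolding prod_set_def by auto

lemma proj_pair [simp]:
  "x \<in> X \<Longrightarrow> y \<in> Y \<Longrightarrow> proj1 X Y (pair (x, y)) = x"
  "x \<in> X \<Longrightarrow> y \<in> Y \<Longrightarrow> proj2 X Y (pair (x, y)) = y"
  by (simp_all add: proj1_def proj2_def)

lemma proj1_in: "proj1 X Y \<in> prod_set X Y \<rightarrow>\<^sub>E X"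
  and proj2_in: "proj2 X Y \<in> prod_set X Y \<rightarrow>\<^sub>E Y"
  by (auto simp: proj1_def proj2_def prod_set_iff)

lemma small_prod_set: "small X \<Longrightarrow> small Y \<Longrightarrow> small (prod_set X Y)"
  unfolding prod_set_def by (rule small_pair)

lemma compose_restrict: "f \<in> X \<rightarrow> Y \<Longrightarrow> compose X (restrict g Y) (restrict f X) = restrict (\<lambda>x. g (f x)) X"
  by (auto simp: compose_def fun_eq_iff Pi_iff)

text \<open>Weak pullbacks of sets are the commuting squares whose comparison map into the pullback
  is onto; one half needs choice and the other half tests against a one-point set.\<close>

lemma weak_pullback_SET_I:
  assumes "p \<in> P \<rightarrow> A" "q \<in> P \<rightarrow> B" "f \<in> A \<rightarrow> D" "g \<in> B \<rightarrow> D"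
    and "\<And>w. w \<in> P \<Longrightarrow> f (p w) = g (q w)"
    and ex: "\<And>a b. a \<in> A \<Longrightarrow> b \<in> B \<Longrightarrow> f a = g b \<Longrightarrow> \<exists>w\<in>P. p w = a \<and> q w = b"
  shows "is_weak_pullback SET P A B D (restrict p P) (restrict q P) (restrict f A) (restrict g B)"
  unfolding is_weak_pullback_def SET_def
proof (simp add: compose_restrict assms, intro conjI ballI allI impI)
  show "restrict (\<lambda>x. f (p x)) P = restrict (\<lambda>x. g (q x)) P"
    using assms(5) by (auto simp: fun_eq_iff)
next
  fix Q u v assume u: "u \<in> Q \<rightarrow>\<^sub>E A" and v: "v \<in> Q \<rightarrow>\<^sub>E B"
    and eq: "compose Q (restrict f A) u = compose Q (restrict g B) v"
  have "\<exists>w\<in>P. p w = u x \<and> q w = v x" if "x \<in> Q" for x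
  proof (rule ex)
    show uA: "u x \<in> A" and vB: "v x \<in> B" using u v that by auto
    show "f (u x) = g (v x)" using fun_cong[OF eq, of x] that uA vB by (simp add: compose_def)
  qed
  then obtain h where h: "\<And>x. x \<in> Q \<Longrightarrow> h x \<in> P \<and> p (h x) = u x \<and> q (h x) = v x"
    by metis
  have "compose Q (restrict p P) (restrict h Q) = u"
    using h u by (auto simp: compose_def fun_eq_iff PiE_def extensional_def)
  moreover have "compose Q (restrict q P) (restrict h Q) = v"
    using h v by (auto simp: compose_def fun_eq_iff PiE_def extensional_def)
  moreover have "restrict h Q \<in> Q \<rightarrow>\<^sub>E P" using h by auto
  ultimately show "\<exists>h\<in>Q \<rightarrow>\<^sub>E P. compose Q (restrict p P) h = u \<and> compose Q (restrict q P) h = v"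
    by blast
qed

lemma weak_pullback_SET_D:
  fixes P :: "'u::set_universe set"
  assumes "is_weak_pullback SET P A B D p q f g"
    and a: "a \<in> A" and b: "b \<in> B" and eq: "f a = g b"
  shows "\<exists>w\<in>P. p w = a \<and> q w = b"
proof -
  fix o' :: 'u
  let ?Q = "{o'}" and ?u = "restrict (\<lambda>_. a) {o'}" and ?v = "restrict (\<lambda>_. b) {o'}"
  have lift: "\<forall>Q\<in>Collect (small :: 'u set \<Rightarrow> bool). \<forall>u\<in>Q \<rightarrow>\<^sub>E A. \<forall>v\<in>Q \<rightarrow>\<^sub>E B. compose Q f u = compose Q g v
      \<longrightarrow> (\<exists>h\<in>Q \<rightarrow>\<^sub>E P. compose Q p h = u \<and> compose Q q h = v)"
    using assms(1) unfolding is_weak_pullback_def SET_def category.simps by (elim conjE)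
  obtain h where h: "h \<in> ?Q \<rightarrow>\<^sub>E P" "compose ?Q p h = ?u" "compose ?Q q h = ?v"
    using bspec[OF bspec[OF bspec[OF lift, of ?Q], of ?u], of ?v] a b eq by (auto simp: small_singleton compose_def fun_eq_iff)
  from fun_cong[OF h(2), of o'] fun_cong[OF h(3), of o'] have "p (h o') = a" "q (h o') = b"
    by (simp_all add: compose_def)
  with h(1) show ?thesis by blast
qed

locale top_theory_context =
  fixes \<T> :: "('u::set_universe, 'v::comm_quantale) top_theory"
  assumes topological_theory: "topological_theory \<T>"
begin

abbreviation tm :: "'u set \<Rightarrow> 'u set \<Rightarrow> ('u \<Rightarrow> 'u) \<Rightarrow> 'u \<Rightarrow> 'u" where
  "tm X Y f \<equiv> Tmap \<T> X Y (restrict f X)"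

text \<open>The conjuncts of the definition of a topological theory, and then those of the definition of a
  monad on sets, in the order in which they are listed there.\<close>

lemmas topological_theory_laws = topological_theory[unfolded topological_theory_def Let_def]
lemmas SET_monad =
  topological_theory_laws[THEN conjunct1, rule_format]
lemmas inj_emb =
  topological_theory_laws[THEN conjunct2, THEN conjunct1, rule_format]
lemmas Vset_small [simp] =
  topological_theory_laws[THEN conjunct2, THEN conjunct2, THEN conjunct1, rule_format]
lemmas T_preserves_weak_pullback =
  topological_theory_laws[THEN conjunct2, THEN conjunct2, THEN conjunct2,
    THEN conjunct1, rule_format]
lemmas Tm_is_weak_pullback =
  topological_theory_laws[THEN conjunct2, THEN conjunct2, THEN conjunct2, THEN conjunct2,
    THEN conjunct1, rule_format]
lemmas xi_algebra =
  topological_theory_laws[THEN conjunct2, THEN conjunct2, THEN conjunct2, THEN conjunct2,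
    THEN conjunct2, THEN conjunct1, rule_format]
lemmas xi_mult =
  topological_theory_laws[THEN conjunct2, THEN conjunct2, THEN conjunct2, THEN conjunct2,
    THEN conjunct2, THEN conjunct2, THEN conjunct1, rule_format]
lemmas xi_one =
  topological_theory_laws[THEN conjunct2, THEN conjunct2, THEN conjunct2, THEN conjunct2,
    THEN conjunct2, THEN conjunct2, THEN conjunct2, THEN conjunct1, rule_format]
lemmas xi_direct_image =
  topological_theory_laws[THEN conjunct2, THEN conjunct2, THEN conjunct2, THEN conjunct2,
    THEN conjunct2, THEN conjunct2, THEN conjunct2, THEN conjunct2, rule_format]

lemmas SET_monad_laws =
  SET_monad[unfolded is_monad_def is_endofunctor_def SET_def, simplified, THEN conjunct2]
lemmas T_small [simp] =
  SET_monad_laws[THEN conjunct1, rule_format]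
lemmas Tmap_in =
  SET_monad_laws[THEN conjunct2, THEN conjunct1, rule_format]
lemmas Tmap_id =
  SET_monad_laws[THEN conjunct2, THEN conjunct2, THEN conjunct1, rule_format]
lemmas Tmap_compose =
  SET_monad_laws[THEN conjunct2, THEN conjunct2, THEN conjunct2, THEN conjunct1, rule_format]
lemmas Te_in =
  SET_monad_laws[THEN conjunct2, THEN conjunct2, THEN conjunct2, THEN conjunct2,
    THEN conjunct1, rule_format]
lemmas Tm_in =
  SET_monad_laws[THEN conjunct2, THEN conjunct2, THEN conjunct2, THEN conjunct2,
    THEN conjunct2, THEN conjunct1, rule_format]
lemmas Te_naturality =
  SET_monad_laws[THEN conjunct2, THEN conjunct2, THEN conjunct2, THEN conjunct2,
    THEN conjunct2, THEN conjunct2, THEN conjunct1, rule_format]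
lemmas Tm_naturality =
  SET_monad_laws[THEN conjunct2, THEN conjunct2, THEN conjunct2, THEN conjunct2,
    THEN conjunct2, THEN conjunct2, THEN conjunct2, THEN conjunct1, rule_format]
lemmas Tm_comp_Te =
  SET_monad_laws[THEN conjunct2, THEN conjunct2, THEN conjunct2, THEN conjunct2,
    THEN conjunct2, THEN conjunct2, THEN conjunct2, THEN conjunct2, THEN conjunct1, rule_format]
lemmas Tm_comp_TTe =
  SET_monad_laws[THEN conjunct2, THEN conjunct2, THEN conjunct2, THEN conjunct2,
    THEN conjunct2, THEN conjunct2, THEN conjunct2, THEN conjunct2, THEN conjunct2,
    THEN conjunct1, rule_format]

lemma tm_in: "small X \<Longrightarrow> small Y \<Longrightarrow> f \<in> X \<rightarrow> Y \<Longrightarrow> tm X Y f \<in> T \<T> X \<rightarrow>\<^sub>E T \<T> Y"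
  by (intro Tmap_in) auto

lemma tm_mem: "small X \<Longrightarrow> small Y \<Longrightarrow> f \<in> X \<rightarrow> Y \<Longrightarrow> \<xx> \<in> T \<T> X \<Longrightarrow> tm X Y f \<xx> \<in> T \<T> Y"
  using tm_in by blast

lemma tm_ident:
  assumes "small X" and "\<And>x. x \<in> X \<Longrightarrow> f x = x" and "\<xx> \<in> T \<T> X"
  shows "tm X X f \<xx> = \<xx>"
proof -
  have "restrict f X = restrict id X" using assms(2) by auto
  then show ?thesis using Tmap_id assms by simp
qed

lemma tm_id: "small X \<Longrightarrow> \<xx> \<in> T \<T> X \<Longrightarrow> tm X X (\<lambda>x. x) \<xx> = \<xx>"
  by (rule tm_ident) auto

lemma tm_cong: "(\<And>x. x \<in> X \<Longrightarrow> f x = g x) \<Longrightarrow> tm X Y f = tm X Y g"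
  by (metis restrict_ext)

lemma tm_comp:
  assumes "small X" "small Y" "small Z" "f \<in> X \<rightarrow> Y" "g \<in> Y \<rightarrow> Z" "\<xx> \<in> T \<T> X"
  shows "tm Y Z g (tm X Y f \<xx>) = tm X Z (\<lambda>x. g (f x)) \<xx>"
proof -
  have "Tmap \<T> X Z (compose X (restrict g Y) (restrict f X))
      = compose (T \<T> X) (tm Y Z g) (tm X Y f)"
    using assms by (intro Tmap_compose) auto
  then show ?thesis using assms by (simp add: compose_restrict compose_eq)
qed

lemma Te_mem [simp]: "small X \<Longrightarrow> x \<in> X \<Longrightarrow> Te \<T> X x \<in> T \<T> X"
  using Te_in by blast

lemma Tm_mem [simp]: "small X \<Longrightarrow> \<XX> \<in> T \<T> (T \<T> X) \<Longrightarrow> Tm \<T> X \<XX> \<in> T \<T> X"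
  using Tm_in by blast

lemma Te_natural:
  assumes "small X" "small Y" "f \<in> X \<rightarrow> Y" "x \<in> X"
  shows "tm X Y f (Te \<T> X x) = Te \<T> Y (f x)"
proof -
  have "compose X (tm X Y f) (Te \<T> X) = compose X (Te \<T> Y) (restrict f X)"
    using assms by (intro Te_naturality) auto
  from fun_cong[OF this, of x] show ?thesis using assms by (simp add: compose_def)
qed

lemma Tm_natural:
  assumes "small X" "small Y" "f \<in> X \<rightarrow> Y" "\<XX> \<in> T \<T> (T \<T> X)"
  shows "Tm \<T> Y (tm (T \<T> X) (T \<T> Y) (tm X Y f) \<XX>) = tm X Y f (Tm \<T> X \<XX>)"
proof -
  have "compose (T \<T> (T \<T> X)) (tm X Y f) (Tm \<T> X)
      = compose (T \<T> (T \<T> X)) (Tm \<T> Y) (Tmap \<T> (T \<T> X) (T \<T> Y) (tm X Y f))"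
    using assms by (intro Tm_naturality) auto
  from fun_cong[OF this, of \<XX>] show ?thesis
    using assms tm_in[OF assms(1-3)] by (simp add: compose_def)
qed

lemma Tm_Te:
  assumes "small X" "\<xx> \<in> T \<T> X"
  shows "Tm \<T> X (Te \<T> (T \<T> X) \<xx>) = \<xx>"
proof -
  have "compose (T \<T> X) (Tm \<T> X) (Te \<T> (T \<T> X)) = restrict id (T \<T> X)"
    using assms by (intro Tm_comp_Te)
  from fun_cong[OF this, of \<xx>] show ?thesis using assms by (simp add: compose_def)
qed

lemma Tm_TTe:
  assumes "small X" "\<xx> \<in> T \<T> X"
  shows "Tm \<T> X (tm X (T \<T> X) (Te \<T> X) \<xx>) = \<xx>"
proof -
  have "compose (T \<T> X) (Tm \<T> X) (Tmap \<T> X (T \<T> X) (Te \<T> X)) = restrict id (T \<T> X)"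
    using assms by (intro Tm_comp_TTe)
  from fun_cong[OF this, of \<xx>] show ?thesis
    using assms Te_in[OF assms(1)] by (simp add: compose_def)
qed

lemma T_weak_pullback:
  assumes small: "small P" "small A" "small B" "small D"
    and maps: "p \<in> P \<rightarrow> A" "q \<in> P \<rightarrow> B" "f \<in> A \<rightarrow> D" "g \<in> B \<rightarrow> D"
    and "\<And>w. w \<in> P \<Longrightarrow> f (p w) = g (q w)"
    and "\<And>a b. a \<in> A \<Longrightarrow> b \<in> B \<Longrightarrow> f a = g b \<Longrightarrow> \<exists>w\<in>P. p w = a \<and> q w = b"
    and "\<aa> \<in> T \<T> A" "\<bb> \<in> T \<T> B" "tm A D f \<aa> = tm B D g \<bb>"
  shows "\<exists>\<ww>\<in>T \<T> P. tm P A p \<ww> = \<aa> \<and> tm P B q \<ww> = \<bb>"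
proof -
  have "is_weak_pullback SET P A B D (restrict p P) (restrict q P) (restrict f A) (restrict g B)"
    by (rule weak_pullback_SET_I) (use assms in auto)
  then have "is_weak_pullback SET (T \<T> P) (T \<T> A) (T \<T> B) (T \<T> D)
        (tm P A p) (tm P B q) (tm A D f) (tm B D g)"
    using small by (intro T_preserves_weak_pullback)
  then show ?thesis by (rule weak_pullback_SET_D) (use assms in auto)
qed

lemma Tm_weak_pullback:
  assumes "small X" "small Y" "f \<in> X \<rightarrow> Y"
    and "\<xx> \<in> T \<T> X" "\<YY> \<in> T \<T> (T \<T> Y)" "tm X Y f \<xx> = Tm \<T> Y \<YY>"
  shows "\<exists>\<XX>\<in>T \<T> (T \<T> X). Tm \<T> X \<XX> = \<xx> \<and> tm (T \<T> X) (T \<T> Y) (tm X Y f) \<XX> = \<YY>"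
proof -
  have "is_weak_pullback SET (T \<T> (T \<T> X)) (T \<T> X) (T \<T> (T \<T> Y)) (T \<T> Y)
        (Tm \<T> X) (Tmap \<T> (T \<T> X) (T \<T> Y) (tm X Y f)) (tm X Y f) (Tm \<T> Y)"
    using assms(1-3) by (intro Tm_is_weak_pullback) auto
  then have "is_weak_pullback SET (T \<T> (T \<T> X)) (T \<T> X) (T \<T> (T \<T> Y)) (T \<T> Y)
        (Tm \<T> X) (tm (T \<T> X) (T \<T> Y) (tm X Y f)) (tm X Y f) (Tm \<T> Y)"
    using tm_in[OF assms(1-3)] by simp
  then show ?thesis by (rule weak_pullback_SET_D) (use assms in auto)
qed

section \<open>Extending quantale-valued maps along the functor\<close>

lemma val_emb [simp]: "val \<T> (emb \<T> v) = v"
  using inj_emb by (simp add: val_def)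

lemma emb_in_Vset [simp]: "emb \<T> v \<in> Vset \<T>"
  by (simp add: Vset_def)

lemma emb_val [simp]: "v \<in> Vset \<T> \<Longrightarrow> emb \<T> (val \<T> v) = v"
  by (auto simp: Vset_def)

lemma xiT_eq: "xiT \<T> X \<phi> \<xx> = xi \<T> (tm X (Vset \<T>) (\<lambda>x. emb \<T> (\<phi> x)) \<xx>)"
  by (simp add: xiT_def vmap_def)

lemma xiT_cong: "(\<And>x. x \<in> X \<Longrightarrow> \<phi> x = \<psi> x) \<Longrightarrow> xiT \<T> X \<phi> = xiT \<T> X \<psi>"
  unfolding xiT_def vmap_def by (metis (mono_tags, lifting) restrict_ext)

lemma xiT_reindex:
  assumes "small X" "small Y" "f \<in> X \<rightarrow> Y" "\<xx> \<in> T \<T> X"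
  shows "xiT \<T> Y \<phi> (tm X Y f \<xx>) = xiT \<T> X (\<lambda>x. \<phi> (f x)) \<xx>"
  using assms by (simp add: xiT_eq tm_comp)

lemma xiT_direct_image:
  assumes "small X" "small Y" "f \<in> X \<rightarrow> Y" "\<yy> \<in> T \<T> Y"
    and "\<And>y. y \<in> Y \<Longrightarrow> \<psi> y = (SUP x\<in>{x\<in>X. f x = y}. \<phi> x)"
  shows "xiT \<T> Y \<psi> \<yy> = (SUP \<xx>\<in>{\<xx>\<in>T \<T> X. tm X Y f \<xx> = \<yy>}. xiT \<T> X \<phi> \<xx>)"
proof -
  have "xiT \<T> Y \<psi> \<yy> = xiT \<T> Y (direct_image X (restrict f X) \<phi>) \<yy>"
  proof (rule fun_cong[OF xiT_cong])
    fix y assume "y \<in> Y"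
    have "{x \<in> X. restrict f X x = y} = {x \<in> X. f x = y}" by auto
    then show "\<psi> y = direct_image X (restrict f X) \<phi> y"
      using assms(5)[OF \<open>y \<in> Y\<close>] by (simp add: direct_image_def)
  qed
  also have "\<dots> = direct_image (T \<T> X) (tm X Y f) (xiT \<T> X \<phi>) \<yy>"
  proof -
    have "restrict f X \<in> X \<rightarrow>\<^sub>E Y" using assms by auto
    with assms(1,2,4) show ?thesis by (intro xi_direct_image)
  qed
  finally show ?thesis by (simp add: direct_image_def)
qed

lemma xiT_one:
  assumes "small X" "\<xx> \<in> T \<T> X"
  shows "xiT \<T> X (\<lambda>_. 1) \<xx> = 1"
proof -
  fix o' :: 'u
  have "xiT \<T> X (\<lambda>_. 1) \<xx> = xiT \<T> {o'} (\<lambda>_. 1) (tm X {o'} (\<lambda>_. o') \<xx>)"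
    using assms by (simp add: xiT_reindex small_singleton)
  moreover have "tm X {o'} (\<lambda>_. o') \<xx> \<in> T \<T> {o'}"
    using assms by (intro tm_mem) (auto simp: small_singleton)
  ultimately show ?thesis using xi_one by metis
qed

text \<open>The compatibility of \<open>\<xi>\<close> with the tensor is an axiom about \<open>T(\<V> \<times> \<V>)\<close>; it is transported along the
  pairing of \<open>\<phi>\<close> and \<open>\<psi>\<close>.\<close>

lemma xiT_mult:
  assumes "small X" "\<xx> \<in> T \<T> X"
  shows "xiT \<T> X (\<lambda>x. \<phi> x * \<psi> x) \<xx> = xiT \<T> X \<phi> \<xx> * xiT \<T> X \<psi> \<xx>"
proof -
  let ?V = "Vset \<T>"
  let ?VV = "prod_set ?V ?V"
  define f where "f = (\<lambda>x. pair (emb \<T> (\<phi> x), emb \<T> (\<psi> x)))"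
  define \<ww> where "\<ww> = tm X ?VV f \<xx>"
  have f: "f \<in> X \<rightarrow> ?VV" and sVV: "small ?VV"
    by (auto simp: f_def small_prod_set)
  have w: "\<ww> \<in> T \<T> ?VV" unfolding \<ww>_def using assms f sVV by (intro tm_mem)
  have p1: "Tmap \<T> ?VV ?V (proj1 ?V ?V) \<ww> = tm X ?V (\<lambda>x. emb \<T> (\<phi> x)) \<xx>"
  proof -
    have "tm ?VV ?V (proj1 ?V ?V) \<ww> = tm X ?V (\<lambda>x. proj1 ?V ?V (f x)) \<xx>"
      unfolding \<ww>_def using assms f sVV proj1_in[of ?V ?V] by (intro tm_comp) auto
    then show ?thesis using proj1_in[of ?V ?V] by (simp add: f_def)
  qed
  have p2: "Tmap \<T> ?VV ?V (proj2 ?V ?V) \<ww> = tm X ?V (\<lambda>x. emb \<T> (\<psi> x)) \<xx>"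
  proof -
    have "tm ?VV ?V (proj2 ?V ?V) \<ww> = tm X ?V (\<lambda>x. proj2 ?V ?V (f x)) \<xx>"
      unfolding \<ww>_def using assms f sVV proj2_in[of ?V ?V] by (intro tm_comp) auto
    then show ?thesis using proj2_in[of ?V ?V] by (simp add: f_def)
  qed
  have "xiT \<T> X (\<lambda>x. \<phi> x * \<psi> x) \<xx> = xiT \<T> ?VV (\<lambda>p. val \<T> (proj1 ?V ?V p) * val \<T> (proj2 ?V ?V p)) \<ww>"
    unfolding \<ww>_def by (subst xiT_reindex) (use assms f sVV in \<open>auto simp: f_def\<close>)
  also have "\<dots> = xi \<T> (Tmap \<T> ?VV ?V (proj1 ?V ?V) \<ww>) * xi \<T> (Tmap \<T> ?VV ?V (proj2 ?V ?V) \<ww>)"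
    using w by (rule xi_mult)
  finally show ?thesis by (simp add: p1 p2 xiT_eq)
qed

lemma xi_Te: "v \<in> Vset \<T> \<Longrightarrow> emb \<T> (xi \<T> (Te \<T> (Vset \<T>) v)) = v"
proof -
  assume v: "v \<in> Vset \<T>"
  have "compose (Vset \<T>) (vmap \<T> (T \<T> (Vset \<T>)) (xi \<T>)) (Te \<T> (Vset \<T>)) = restrict id (Vset \<T>)"
    using xi_algebra by (simp add: is_em_algebra_def SET_def)
  from fun_cong[OF this, of v] v show ?thesis
    by (simp add: compose_def vmap_def)
qed

lemma xi_Tm:
  assumes "\<VV> \<in> T \<T> (T \<T> (Vset \<T>))"
  shows "xi \<T> (tm (T \<T> (Vset \<T>)) (Vset \<T>) (\<lambda>\<vv>. emb \<T> (xi \<T> \<vv>)) \<VV>) = xi \<T> (Tm \<T> (Vset \<T>) \<VV>)"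
proof -
  let ?V = "Vset \<T>" and ?x = "vmap \<T> (T \<T> (Vset \<T>)) (xi \<T>)"
  have "compose (T \<T> (T \<T> ?V)) ?x (Tmap \<T> (T \<T> ?V) ?V ?x) = compose (T \<T> (T \<T> ?V)) ?x (Tm \<T> ?V)"
    using xi_algebra by (simp add: is_em_algebra_def SET_def)
  from fun_cong[OF this, of \<VV>] have "?x (Tmap \<T> (T \<T> ?V) ?V ?x \<VV>) = ?x (Tm \<T> ?V \<VV>)"
    using assms by (simp add: compose_def)
  moreover have "Tmap \<T> (T \<T> ?V) ?V ?x \<VV> \<in> T \<T> ?V"
    using assms tm_mem[of "T \<T> ?V" ?V "\<lambda>\<vv>. emb \<T> (xi \<T> \<vv>)" \<VV>] by (simp add: vmap_def)
  ultimately have "emb \<T> (xi \<T> (Tmap \<T> (T \<T> ?V) ?V ?x \<VV>)) = emb \<T> (xi \<T> (Tm \<T> ?V \<VV>))"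
    using assms by (simp add: vmap_def)
  then have "xi \<T> (Tmap \<T> (T \<T> ?V) ?V ?x \<VV>) = xi \<T> (Tm \<T> ?V \<VV>)" by (metis val_emb)
  then show ?thesis by (simp add: vmap_def)
qed

lemma xiT_Te:
  assumes "small X" "x \<in> X"
  shows "xiT \<T> X \<phi> (Te \<T> X x) = \<phi> x"
proof -
  have "xiT \<T> X \<phi> (Te \<T> X x) = xi \<T> (Te \<T> (Vset \<T>) (emb \<T> (\<phi> x)))"
    unfolding xiT_eq by (subst Te_natural) (use assms in auto)
  also have "\<dots> = \<phi> x" using xi_Te[of "emb \<T> (\<phi> x)"] by (metis val_emb emb_in_Vset)
  finally show ?thesis .
qed

text \<open>This is the associativity of the algebra \<open>\<xi>\<close>, combined with the naturality of \<open>m\<close>.\<close>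

lemma xiT_Tm:
  assumes "small X" "\<XX> \<in> T \<T> (T \<T> X)"
  shows "xiT \<T> X \<phi> (Tm \<T> X \<XX>) = xiT \<T> (T \<T> X) (xiT \<T> X \<phi>) \<XX>"
proof -
  let ?V = "Vset \<T>" and ?f = "\<lambda>x. emb \<T> (\<phi> x)"
  have f: "?f \<in> X \<rightarrow> ?V" by auto
  note Tf = tm_in[OF assms(1) Vset_small f]
  have "xiT \<T> X \<phi> (Tm \<T> X \<XX>) = xi \<T> (Tm \<T> ?V (tm (T \<T> X) (T \<T> ?V) (tm X ?V ?f) \<XX>))"
    unfolding xiT_eq using assms f by (simp only: Tm_natural Vset_small)
  also have "\<dots> = xi \<T> (tm (T \<T> ?V) ?V (\<lambda>\<vv>. emb \<T> (xi \<T> \<vv>)) (tm (T \<T> X) (T \<T> ?V) (tm X ?V ?f) \<XX>))"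
    by (rule xi_Tm[symmetric]) (use assms Tf in \<open>intro tm_mem, auto\<close>)
  also have "\<dots> = xi \<T> (tm (T \<T> X) ?V (\<lambda>\<xx>. emb \<T> (xi \<T> (tm X ?V ?f \<xx>))) \<XX>)"
    by (subst tm_comp) (use assms Tf in auto)
  finally show ?thesis by (simp add: xiT_eq)
qed

text \<open>Monotonicity is not among the axioms but follows from the one on direct images: if
  \<open>\<phi> \<le> \<psi>\<close>, then \<open>\<psi>\<close> is the direct image, along the projection to \<open>X\<close>, of the second projection on the
  union of the graphs of \<open>\<phi>\<close> and \<open>\<psi>\<close>, and \<open>\<phi>\<close> is the restriction of the same map to a section.\<close>

lemma xiT_mono:
  assumes "small X" "\<xx> \<in> T \<T> X" and le: "\<And>x. x \<in> X \<Longrightarrow> \<phi> x \<le> \<psi> x"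
  shows "xiT \<T> X \<phi> \<xx> \<le> xiT \<T> X \<psi> \<xx>"
proof -
  let ?V = "Vset \<T>"
  \<comment> \<open>The union of the two graphs; on it \<open>\<phi>\<close> and \<open>\<psi>\<close> are both the second projection.\<close>
  define P where "P = {p \<in> prod_set X ?V. val \<T> (proj2 X ?V p) \<in> {\<phi> (proj1 X ?V p), \<psi> (proj1 X ?V p)}}"
  define s where "s = (\<lambda>x. pair (x, emb \<T> (\<phi> x)))"
  have P: "small P"
    using small_prod_set[OF assms(1) Vset_small] by (rule small_subset) (auto simp: P_def)
  have s: "s \<in> X \<rightarrow> P" by (auto simp: s_def P_def)
  have p1: "proj1 X ?V \<in> P \<rightarrow> X" using proj1_in[of X ?V] by (auto simp: P_def)
  have "xiT \<T> X \<phi> \<xx> = xiT \<T> P (\<lambda>p. val \<T> (proj2 X ?V p)) (tm X P s \<xx>)"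
    by (subst xiT_reindex) (use assms P s in \<open>auto simp: s_def cong: xiT_cong\<close>)
  also have "\<dots> \<le> (SUP \<pp>\<in>{\<pp>\<in>T \<T> P. tm P X (proj1 X ?V) \<pp> = \<xx>}. xiT \<T> P (\<lambda>p. val \<T> (proj2 X ?V p)) \<pp>)"
  proof (rule SUP_upper, safe)
    show "tm X P s \<xx> \<in> T \<T> P" using assms P s by (intro tm_mem)
    have "tm P X (proj1 X ?V) (tm X P s \<xx>) = tm X X (\<lambda>x. proj1 X ?V (s x)) \<xx>"
      using assms P s p1 by (intro tm_comp)
    also have "\<dots> = \<xx>" using assms by (intro tm_ident) (auto simp: s_def)
    finally show "tm P X (proj1 X ?V) (tm X P s \<xx>) = \<xx>" .
  qed
  also have "\<dots> = xiT \<T> X \<psi> \<xx>"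
  proof (rule xiT_direct_image[symmetric, OF P assms(1) p1 assms(2)])
    fix x assume x: "x \<in> X"
    show "\<psi> x = (SUP p\<in>{p\<in>P. proj1 X ?V p = x}. val \<T> (proj2 X ?V p))"
    proof (rule antisym)
      have "pair (x, emb \<T> (\<psi> x)) \<in> {p\<in>P. proj1 X ?V p = x}" using x by (auto simp: P_def)
      then have "val \<T> (proj2 X ?V (pair (x, emb \<T> (\<psi> x)))) \<le> (SUP p\<in>{p\<in>P. proj1 X ?V p = x}. val \<T> (proj2 X ?V p))"
        by (rule SUP_upper)
      then show "\<psi> x \<le> (SUP p\<in>{p\<in>P. proj1 X ?V p = x}. val \<T> (proj2 X ?V p))" using x by simp
      show "(SUP p\<in>{p\<in>P. proj1 X ?V p = x}. val \<T> (proj2 X ?V p)) \<le> \<psi> x"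
        by (rule SUP_least) (use le x in \<open>auto simp: P_def\<close>)
    qed
  qed
  finally show ?thesis .
qed

section \<open>The extension of relations\<close>

text \<open>The compatibility of \<open>\<xi>\<close> with direct images along \<open>\<langle>p, q\<rangle> : W \<rightarrow> X \<times> Y\<close> makes it possible to replace the
  product by any other span that presents \<open>r\<close>. All properties of the extension of relations are obtained
  by choosing a convenient span.\<close>

lemma Txi_span:
  assumes small: "small W" "small X" "small Y" and p: "p \<in> W \<rightarrow> X" and q: "q \<in> W \<rightarrow> Y"
    and r: "\<And>x y. x \<in> X \<Longrightarrow> y \<in> Y \<Longrightarrow> r x y = (SUP w\<in>{w\<in>W. p w = x \<and> q w = y}. \<phi> w)"
  shows "Txi \<T> X Y r \<xx> \<yy> = (SUP \<ww>\<in>{\<ww>\<in>T \<T> W. tm W X p \<ww> = \<xx> \<and> tm W Y q \<ww> = \<yy>}. xiT \<T> W \<phi> \<ww>)"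
proof -
  let ?P = "prod_set X Y"
  let ?p1 = "proj1 X Y" and ?p2 = "proj2 X Y"
  define f where "f = (\<lambda>w. pair (p w, q w))"
  have P: "small ?P" using small by (simp add: small_prod_set)
  have f: "f \<in> W \<rightarrow> ?P" using p q by (auto simp: f_def)
  have hat: "xiT \<T> ?P (\<lambda>p. r (?p1 p) (?p2 p)) \<uu> = (SUP \<ww>\<in>{\<ww>\<in>T \<T> W. tm W ?P f \<ww> = \<uu>}. xiT \<T> W \<phi> \<ww>)"
    if "\<uu> \<in> T \<T> ?P" for \<uu>
  proof (rule xiT_direct_image[OF small(1) P f that])
    fix z assume "z \<in> ?P"
    then obtain x y where z: "z = pair (x, y)" "x \<in> X" "y \<in> Y" by (auto simp: prod_set_iff)
    have "{w \<in> W. f w = z} = {w \<in> W. p w = x \<and> q w = y}"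
      by (auto simp: f_def z)
    then show "r (?p1 z) (?p2 z) = (SUP w\<in>{w\<in>W. f w = z}. \<phi> w)" using r z by simp
  qed
  have fT: "tm W ?P f \<ww> \<in> T \<T> ?P" if "\<ww> \<in> T \<T> W" for \<ww>
    using small P f that by (intro tm_mem)
  have pf: "Tmap \<T> ?P X ?p1 (tm W ?P f \<ww>) = tm W X p \<ww>" if "\<ww> \<in> T \<T> W" for \<ww>
  proof -
    have "tm ?P X ?p1 (tm W ?P f \<ww>) = tm W X (\<lambda>w. ?p1 (f w)) \<ww>"
      using small P f that proj1_in[of X Y] by (intro tm_comp) auto
    also have "\<dots> = tm W X p \<ww>" using p q by (intro fun_cong[OF tm_cong]) (auto simp: f_def Pi_iff)
    finally show ?thesis using proj1_in[of X Y] by simp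
  qed
  have qf: "Tmap \<T> ?P Y ?p2 (tm W ?P f \<ww>) = tm W Y q \<ww>" if "\<ww> \<in> T \<T> W" for \<ww>
  proof -
    have "tm ?P Y ?p2 (tm W ?P f \<ww>) = tm W Y (\<lambda>w. ?p2 (f w)) \<ww>"
      using small P f that proj2_in[of X Y] by (intro tm_comp) auto
    also have "\<dots> = tm W Y q \<ww>" using p q by (intro fun_cong[OF tm_cong]) (auto simp: f_def Pi_iff)
    finally show ?thesis using proj2_in[of X Y] by simp
  qed
  show ?thesis
  proof (rule antisym)
    show "Txi \<T> X Y r \<xx> \<yy> \<le> (SUP \<ww>\<in>{\<ww>\<in>T \<T> W. tm W X p \<ww> = \<xx> \<and> tm W Y q \<ww> = \<yy>}. xiT \<T> W \<phi> \<ww>)"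
      unfolding Txi_def
      by (rule SUP_least) (auto simp: hat pf qf intro!: SUP_least intro: SUP_upper)
    show "(SUP \<ww>\<in>{\<ww>\<in>T \<T> W. tm W X p \<ww> = \<xx> \<and> tm W Y q \<ww> = \<yy>}. xiT \<T> W \<phi> \<ww>) \<le> Txi \<T> X Y r \<xx> \<yy>"
    proof (rule SUP_least)
      fix \<ww> assume w: "\<ww> \<in> {\<ww>\<in>T \<T> W. tm W X p \<ww> = \<xx> \<and> tm W Y q \<ww> = \<yy>}"
      have "xiT \<T> W \<phi> \<ww> \<le> xiT \<T> ?P (\<lambda>p. r (?p1 p) (?p2 p)) (tm W ?P f \<ww>)"
        using w by (simp add: hat fT SUP_upper)
      also have "\<dots> \<le> Txi \<T> X Y r \<xx> \<yy>"
        unfolding Txi_def by (rule SUP_upper) (use w fT pf qf in auto)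
      finally show "xiT \<T> W \<phi> \<ww> \<le> Txi \<T> X Y r \<xx> \<yy>" .
    qed
  qed
qed

lemma Txi_mono_on:
  assumes "small X" "small Y" and "\<And>x y. x \<in> X \<Longrightarrow> y \<in> Y \<Longrightarrow> r x y \<le> s x y"
  shows "Txi \<T> X Y r \<le> Txi \<T> X Y s"
proof -
  have "xiT \<T> (prod_set X Y) (\<lambda>p. r (proj1 X Y p) (proj2 X Y p)) \<ww>
      \<le> xiT \<T> (prod_set X Y) (\<lambda>p. s (proj1 X Y p) (proj2 X Y p)) \<ww>" if "\<ww> \<in> T \<T> (prod_set X Y)" for \<ww>
    using assms that by (intro xiT_mono) (auto simp: prod_set_iff small_prod_set)
  then show ?thesis unfolding Txi_def le_fun_def
    by (auto intro!: SUP_mono)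
qed

lemma Txi_cong: "small X \<Longrightarrow> small Y \<Longrightarrow> (\<And>x y. x \<in> X \<Longrightarrow> y \<in> Y \<Longrightarrow> r x y = s x y) \<Longrightarrow>
    Txi \<T> X Y r = Txi \<T> X Y s"
  by (rule antisym; rule Txi_mono_on) auto

lemma Txi_vgraph:
  assumes small: "small X" "small Y" and f: "f \<in> X \<rightarrow> Y"
  shows "Txi \<T> X Y (vgraph X f) = vgraph (T \<T> X) (tm X Y f)"
proof (intro ext)
  fix \<xx> \<yy>
  have span: "Txi \<T> X Y (vgraph X f) \<xx> \<yy>
      = (SUP \<ww>\<in>{\<ww>\<in>T \<T> X. tm X X (\<lambda>x. x) \<ww> = \<xx> \<and> tm X Y f \<ww> = \<yy>}. xiT \<T> X (\<lambda>_. 1) \<ww>)"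
  proof (rule Txi_span)
    fix x y assume "x \<in> X" "y \<in> Y"
    then have "{w \<in> X. w = x \<and> f w = y} = (if f x = y then {x} else {})" by auto
    then show "vgraph X f x y = (SUP w\<in>{w\<in>X. w = x \<and> f w = y}. 1)"
      using \<open>x \<in> X\<close> by (simp add: vgraph_def)
  qed (use assms in auto)
  have set: "{\<ww>\<in>T \<T> X. tm X X (\<lambda>x. x) \<ww> = \<xx> \<and> tm X Y f \<ww> = \<yy>}
      = (if \<xx> \<in> T \<T> X \<and> tm X Y f \<xx> = \<yy> then {\<xx>} else {})"
    by (simp only: tm_id[OF small(1)] cong: conj_cong) auto
  show "Txi \<T> X Y (vgraph X f) \<xx> \<yy> = vgraph (T \<T> X) (tm X Y f) \<xx> \<yy>"
    unfolding span set using small by (simp add: vgraph_def xiT_one)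
qed

text \<open>The composite is presented by the triples \<open>(x, y, z)\<close>, which form the pullback of
  \<open>X \<times> Y\<close> and \<open>Y \<times> Z\<close> over \<open>Y\<close>; that the functor preserves this weak pullback gives the
  inequality from right to left.\<close>

lemma Txi_vcomp:
  assumes small: "small X" "small Y" "small Z"
  shows "Txi \<T> X Z (vcomp Y s r) = vcomp (T \<T> Y) (Txi \<T> Y Z s) (Txi \<T> X Y r)"
proof (intro ext)
  fix \<xx> \<zz>
  let ?XY = "prod_set X Y" and ?YZ = "prod_set Y Z"
  let ?W = "prod_set X ?YZ"
  define p where "p = (\<lambda>w. proj1 X ?YZ w)"
  define q where "q = (\<lambda>w. proj1 Y Z (proj2 X ?YZ w))"
  define l where "l = (\<lambda>w. proj2 Y Z (proj2 X ?YZ w))"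
  define pq where "pq = (\<lambda>w. pair (p w, q w))"
  define ql where "ql = (\<lambda>w. proj2 X ?YZ w)"
  have XY: "small ?XY" and YZ: "small ?YZ" and W: "small ?W"
    using small by (simp_all add: small_prod_set)
  have triple: "\<exists>x\<in>X. \<exists>y\<in>Y. \<exists>z\<in>Z. w = pair (x, pair (y, z))" if "w \<in> ?W" for w
    using that by (auto simp: prod_set_iff)
  have maps: "p \<in> ?W \<rightarrow> X" "q \<in> ?W \<rightarrow> Y" "l \<in> ?W \<rightarrow> Z" "pq \<in> ?W \<rightarrow> ?XY" "ql \<in> ?W \<rightarrow> ?YZ"
    by (auto simp: p_def q_def l_def pq_def ql_def dest!: triple)
  have projs: "proj1 X Y \<in> ?XY \<rightarrow> X" "proj2 X Y \<in> ?XY \<rightarrow> Y" "proj1 Y Z \<in> ?YZ \<rightarrow> Y" "proj2 Y Z \<in> ?YZ \<rightarrow> Z"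
    by (auto simp: prod_set_iff)
  let ?r = "\<lambda>u. r (proj1 X Y u) (proj2 X Y u)" and ?s = "\<lambda>u. s (proj1 Y Z u) (proj2 Y Z u)"
  have Txi_r: "Txi \<T> X Y r \<xx> \<yy> = (SUP \<uu>\<in>{\<uu>\<in>T \<T> ?XY. tm ?XY X (proj1 X Y) \<uu> = \<xx> \<and> tm ?XY Y (proj2 X Y) \<uu> = \<yy>}. xiT \<T> ?XY ?r \<uu>)" for \<xx> \<yy>
    using proj1_in[of X Y] proj2_in[of X Y] by (simp add: Txi_def)
  have Txi_s: "Txi \<T> Y Z s \<yy> \<zz> = (SUP \<uu>\<in>{\<uu>\<in>T \<T> ?YZ. tm ?YZ Y (proj1 Y Z) \<uu> = \<yy> \<and> tm ?YZ Z (proj2 Y Z) \<uu> = \<zz>}. xiT \<T> ?YZ ?s \<uu>)" for \<yy> \<zz>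
    using proj1_in[of Y Z] proj2_in[of Y Z] by (simp add: Txi_def)
  have "Txi \<T> X Z (vcomp Y s r) \<xx> \<zz> = (SUP \<ww>\<in>{\<ww>\<in>T \<T> ?W. tm ?W X p \<ww> = \<xx> \<and> tm ?W Z l \<ww> = \<zz>}.
      xiT \<T> ?W (\<lambda>w. r (p w) (q w) * s (q w) (l w)) \<ww>)"
  proof (rule Txi_span)
    fix x z assume xz: "x \<in> X" "z \<in> Z"
    show "vcomp Y s r x z = (SUP w\<in>{w\<in>?W. p w = x \<and> l w = z}. r (p w) (q w) * s (q w) (l w))"
    proof (rule antisym)
      have "r x y * s y z \<le> (SUP w\<in>{w\<in>?W. p w = x \<and> l w = z}. r (p w) (q w) * s (q w) (l w))" if "y \<in> Y" for y
        using xz that by (intro SUP_upper2[of "pair (x, pair (y, z))"]) (auto simp: p_def q_def l_def)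
      then show "vcomp Y s r x z \<le> (SUP w\<in>{w\<in>?W. p w = x \<and> l w = z}. r (p w) (q w) * s (q w) (l w))"
        by (simp add: vcomp_le_iff)
      show "(SUP w\<in>{w\<in>?W. p w = x \<and> l w = z}. r (p w) (q w) * s (q w) (l w)) \<le> vcomp Y s r x z"
        by (rule SUP_least) (use maps in \<open>auto intro!: vcomp_upper\<close>)
    qed
  qed (use W small maps in auto)
  also have "\<dots> = (SUP \<ww>\<in>{\<ww>\<in>T \<T> ?W. tm ?W X p \<ww> = \<xx> \<and> tm ?W Z l \<ww> = \<zz>}.
      xiT \<T> ?XY ?r (tm ?W ?XY pq \<ww>) * xiT \<T> ?YZ ?s (tm ?W ?YZ ql \<ww>))" (is "_ = ?M")
  proof (rule SUP_cong[OF refl])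
    fix \<ww> assume "\<ww> \<in> {\<ww>\<in>T \<T> ?W. tm ?W X p \<ww> = \<xx> \<and> tm ?W Z l \<ww> = \<zz>}"
    then have w: "\<ww> \<in> T \<T> ?W" by simp
    have "xiT \<T> ?XY ?r (tm ?W ?XY pq \<ww>) = xiT \<T> ?W (\<lambda>w. r (p w) (q w)) \<ww>"
      unfolding xiT_reindex[OF W XY maps(4) w]
      by (rule fun_cong[OF xiT_cong]) (use maps in \<open>auto simp: pq_def Pi_iff\<close>)
    moreover have "xiT \<T> ?YZ ?s (tm ?W ?YZ ql \<ww>) = xiT \<T> ?W (\<lambda>w. s (q w) (l w)) \<ww>"
      unfolding xiT_reindex[OF W YZ maps(5) w]
      by (rule fun_cong[OF xiT_cong]) (auto simp: ql_def q_def l_def)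
    ultimately show "xiT \<T> ?W (\<lambda>w. r (p w) (q w) * s (q w) (l w)) \<ww>
        = xiT \<T> ?XY ?r (tm ?W ?XY pq \<ww>) * xiT \<T> ?YZ ?s (tm ?W ?YZ ql \<ww>)"
      using xiT_mult[OF W w] by simp
  qed
  also have "\<dots> = vcomp (T \<T> Y) (Txi \<T> Y Z s) (Txi \<T> X Y r) \<xx> \<zz>"
  proof (rule antisym)
    show "?M \<le> vcomp (T \<T> Y) (Txi \<T> Y Z s) (Txi \<T> X Y r) \<xx> \<zz>"
    proof (rule SUP_least, clarify)
      fix \<ww> assume w: "\<ww> \<in> T \<T> ?W"
      define \<uu> where "\<uu> = tm ?W ?XY pq \<ww>"
      define \<vv> where "\<vv> = tm ?W ?YZ ql \<ww>"
      have u: "\<uu> \<in> T \<T> ?XY" "\<vv> \<in> T \<T> ?YZ"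
        unfolding \<uu>_def \<vv>_def using w maps W XY YZ by (auto intro!: tm_mem)
      have y: "tm ?W Y q \<ww> \<in> T \<T> Y" using w maps W small by (auto intro!: tm_mem)
      have "tm ?XY X (proj1 X Y) \<uu> = tm ?W X p \<ww>" "tm ?XY Y (proj2 X Y) \<uu> = tm ?W Y q \<ww>"
        "tm ?YZ Y (proj1 Y Z) \<vv> = tm ?W Y q \<ww>" "tm ?YZ Z (proj2 Y Z) \<vv> = tm ?W Z l \<ww>"
        unfolding \<uu>_def \<vv>_def
        by (subst tm_comp; (intro fun_cong[OF tm_cong])?;
            use small W XY YZ maps projs w in \<open>auto simp: pq_def ql_def q_def l_def Pi_iff\<close>)+
      then have "xiT \<T> ?XY ?r \<uu> \<le> Txi \<T> X Y r (tm ?W X p \<ww>) (tm ?W Y q \<ww>)"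
        "xiT \<T> ?YZ ?s \<vv> \<le> Txi \<T> Y Z s (tm ?W Y q \<ww>) (tm ?W Z l \<ww>)"
        unfolding Txi_r Txi_s using u by (auto intro!: SUP_upper)
      then have "xiT \<T> ?XY ?r \<uu> * xiT \<T> ?YZ ?s \<vv>
          \<le> Txi \<T> X Y r (tm ?W X p \<ww>) (tm ?W Y q \<ww>) * Txi \<T> Y Z s (tm ?W Y q \<ww>) (tm ?W Z l \<ww>)"
        by (rule quantale_mult_mono)
      also have "\<dots> \<le> vcomp (T \<T> Y) (Txi \<T> Y Z s) (Txi \<T> X Y r) (tm ?W X p \<ww>) (tm ?W Z l \<ww>)"
        using y by (rule vcomp_upper)
      finally show "xiT \<T> ?XY ?r \<uu> * xiT \<T> ?YZ ?s \<vv>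
          \<le> vcomp (T \<T> Y) (Txi \<T> Y Z s) (Txi \<T> X Y r) (tm ?W X p \<ww>) (tm ?W Z l \<ww>)" .
    qed
    have "Txi \<T> X Y r \<xx> \<yy> * Txi \<T> Y Z s \<yy> \<zz> \<le> ?M" for \<yy>
      unfolding Txi_r Txi_s quantale_SUP_mult quantale_mult_SUP
    proof (intro SUP_least)
      fix \<uu> \<vv>
      assume "\<uu> \<in> {\<uu>\<in>T \<T> ?XY. tm ?XY X (proj1 X Y) \<uu> = \<xx> \<and> tm ?XY Y (proj2 X Y) \<uu> = \<yy>}"
        and "\<vv> \<in> {\<uu>\<in>T \<T> ?YZ. tm ?YZ Y (proj1 Y Z) \<uu> = \<yy> \<and> tm ?YZ Z (proj2 Y Z) \<uu> = \<zz>}"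
      then have u: "\<uu> \<in> T \<T> ?XY" "tm ?XY X (proj1 X Y) \<uu> = \<xx>" "tm ?XY Y (proj2 X Y) \<uu> = \<yy>"
        and v: "\<vv> \<in> T \<T> ?YZ" "tm ?YZ Y (proj1 Y Z) \<vv> = \<yy>" "tm ?YZ Z (proj2 Y Z) \<vv> = \<zz>"
        by auto
      have "\<exists>\<ww>\<in>T \<T> ?W. tm ?W ?XY pq \<ww> = \<uu> \<and> tm ?W ?YZ ql \<ww> = \<vv>"
      proof (rule T_weak_pullback[OF W XY YZ small(2) maps(4,5) projs(2,3)])
        show "proj2 X Y (pq w) = proj1 Y Z (ql w)" if "w \<in> ?W" for w
          using that maps by (auto simp: pq_def ql_def q_def Pi_iff)
        show "\<exists>w\<in>?W. pq w = a \<and> ql w = b"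
          if "a \<in> ?XY" "b \<in> ?YZ" "proj2 X Y a = proj1 Y Z b" for a b
        proof -
          from that obtain x y z where "a = pair (x, y)" "b = pair (y, z)" "x \<in> X" "y \<in> Y" "z \<in> Z"
            by (auto simp: prod_set_iff)
          then show ?thesis
            by (intro bexI[of _ "pair (x, b)"]) (auto simp: pq_def ql_def p_def q_def)
        qed
      qed (use u v in auto)
      then obtain \<ww> where w: "\<ww> \<in> T \<T> ?W" "tm ?W ?XY pq \<ww> = \<uu>" "tm ?W ?YZ ql \<ww> = \<vv>" by blast
      have "tm ?XY X (proj1 X Y) (tm ?W ?XY pq \<ww>) = tm ?W X p \<ww>"
        "tm ?YZ Z (proj2 Y Z) (tm ?W ?YZ ql \<ww>) = tm ?W Z l \<ww>"
        by (subst tm_comp; (intro fun_cong[OF tm_cong])?;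
            use small W XY YZ maps projs w(1) in \<open>auto simp: pq_def ql_def q_def l_def Pi_iff\<close>)+
      then have "\<ww> \<in> {\<ww>\<in>T \<T> ?W. tm ?W X p \<ww> = \<xx> \<and> tm ?W Z l \<ww> = \<zz>}"
        using w u v by simp
      then show "xiT \<T> ?XY ?r \<uu> * xiT \<T> ?YZ ?s \<vv> \<le> ?M"
        by (rule SUP_upper2) (simp add: w)
    qed
    then show "vcomp (T \<T> Y) (Txi \<T> Y Z s) (Txi \<T> X Y r) \<xx> \<zz> \<le> ?M"
      by (simp add: vcomp_le_iff)
  qed
  finally show "Txi \<T> X Z (vcomp Y s r) \<xx> \<zz> = vcomp (T \<T> Y) (Txi \<T> Y Z s) (Txi \<T> X Y r) \<xx> \<zz>" .
qed

lemma Txi_reindex: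
  assumes "small S" "small P" "small Y" "f \<in> S \<rightarrow> P" "\<ss> \<in> T \<T> S"
  shows "Txi \<T> S Y (\<lambda>s. r (f s)) \<ss> \<yy> = Txi \<T> P Y r (tm S P f \<ss>) \<yy>"
proof -
  have "Txi \<T> S Y (\<lambda>s. r (f s)) = Txi \<T> S Y (vcomp P r (vgraph S f))"
    using assms by (intro Txi_cong) (simp_all add: vcomp_vgraph)
  then have "Txi \<T> S Y (\<lambda>s. r (f s)) = vcomp (T \<T> P) (Txi \<T> P Y r) (vgraph (T \<T> S) (tm S P f))"
    using assms by (simp add: Txi_vcomp Txi_vgraph)
  then show ?thesis
    using vcomp_vgraph[of "tm S P f" "T \<T> S" "T \<T> P" \<ss>] tm_in[OF assms(1,2,4)] assms(5) by auto
qed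

text \<open>The hypothesis says that \<open>r\<close> contains the graph of \<open>f\<close>, and the extension of this graph is the
  graph of \<open>Tf\<close>.\<close>

lemma Txi_ge_one:
  assumes "small X" "small Y" "f \<in> X \<rightarrow> Y" "\<xx> \<in> T \<T> X" and "\<And>x. x \<in> X \<Longrightarrow> 1 \<le> r x (f x)"
  shows "1 \<le> Txi \<T> X Y r \<xx> (tm X Y f \<xx>)"
proof -
  have "1 = Txi \<T> X Y (vgraph X f) \<xx> (tm X Y f \<xx>)"
    using assms by (simp add: Txi_vgraph) (simp add: vgraph_def)
  also have "\<dots> \<le> Txi \<T> X Y r \<xx> (tm X Y f \<xx>)"
    by (rule le_funD[OF le_funD[OF Txi_mono_on]]) (use assms in \<open>auto simp: vgraph_def\<close>)
  finally show ?thesis .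
qed

lemma Txi_Te:
  assumes "small X" "small Y" "x \<in> X" "y \<in> Y"
  shows "r x y \<le> Txi \<T> X Y r (Te \<T> X x) (Te \<T> Y y)"
proof -
  let ?P = "prod_set X Y"
  have P: "small ?P" and p: "pair (x, y) \<in> ?P" using assms by (simp_all add: small_prod_set)
  have "tm ?P X (proj1 X Y) (Te \<T> ?P (pair (x, y))) = Te \<T> X x"
    "tm ?P Y (proj2 X Y) (Te \<T> ?P (pair (x, y))) = Te \<T> Y y"
    by (subst Te_natural; use assms P p proj1_in[of X Y] proj2_in[of X Y] in auto)+
  then have "Te \<T> ?P (pair (x, y)) \<in> {\<ww>\<in>T \<T> ?P. Tmap \<T> ?P X (proj1 X Y) \<ww> = Te \<T> X x \<and>
      Tmap \<T> ?P Y (proj2 X Y) \<ww> = Te \<T> Y y}"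
    using P p proj1_in[of X Y] proj2_in[of X Y] by simp
  then show ?thesis unfolding Txi_def
    by (rule SUP_upper2) (use P p assms in \<open>simp add: xiT_Te\<close>)
qed

text \<open>The definition presents \<open>T\<^sub>\<xi> r\<close> by the span of the two maps \<open>T\<pi>\<^sub>1\<close> and \<open>T\<pi>\<^sub>2\<close> on \<open>T(X \<times> Y)\<close>, so the
  extension of \<open>T\<^sub>\<xi> r\<close> can be computed on \<open>TT(X \<times> Y)\<close>. There \<open>xiT_Tm\<close> replaces the double
  extension of \<open>r\<close> by a single one.\<close>

lemma Txi_Txi:
  assumes small: "small X" "small Y"
  shows "Txi \<T> (T \<T> X) (T \<T> Y) (Txi \<T> X Y r) \<XX> \<YY> = (SUP \<WW>\<in>{\<WW>\<in>T \<T> (T \<T> (prod_set X Y)).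
      tm (T \<T> (prod_set X Y)) (T \<T> X) (tm (prod_set X Y) X (proj1 X Y)) \<WW> = \<XX> \<and>
      tm (T \<T> (prod_set X Y)) (T \<T> Y) (tm (prod_set X Y) Y (proj2 X Y)) \<WW> = \<YY>}.
      xiT \<T> (prod_set X Y) (\<lambda>p. r (proj1 X Y p) (proj2 X Y p)) (Tm \<T> (prod_set X Y) \<WW>))"
    (is "_ = (SUP \<WW>\<in>?S. ?h (Tm \<T> _ \<WW>))")
proof -
  let ?P = "prod_set X Y"
  have P: "small ?P" using small by (simp add: small_prod_set)
  have "tm ?P X (proj1 X Y) \<in> T \<T> ?P \<rightarrow> T \<T> X" "tm ?P Y (proj2 X Y) \<in> T \<T> ?P \<rightarrow> T \<T> Y"
    using tm_in[OF P small(1), of "proj1 X Y"] tm_in[OF P small(2), of "proj2 X Y"]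
      proj1_in[of X Y] proj2_in[of X Y] by auto
  then have "Txi \<T> (T \<T> X) (T \<T> Y) (Txi \<T> X Y r) \<XX> \<YY> = (SUP \<WW>\<in>{\<WW>\<in>T \<T> (T \<T> ?P).
      tm (T \<T> ?P) (T \<T> X) (tm ?P X (proj1 X Y)) \<WW> = \<XX> \<and>
      tm (T \<T> ?P) (T \<T> Y) (tm ?P Y (proj2 X Y)) \<WW> = \<YY>}.
      xiT \<T> (T \<T> ?P) (xiT \<T> ?P (\<lambda>p. r (proj1 X Y p) (proj2 X Y p))) \<WW>)"
    by (rule Txi_span[rotated 3]) (use small P proj1_in[of X Y] proj2_in[of X Y] in \<open>simp_all add: Txi_def\<close>)
  also have "\<dots> = (SUP \<WW>\<in>?S. ?h (Tm \<T> ?P \<WW>))"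
    using P by (intro SUP_cong refl) (simp add: xiT_Tm)
  finally show ?thesis .
qed

lemma Txi_Tm_le:
  assumes small: "small X" "small Y"
  shows "Txi \<T> (T \<T> X) (T \<T> Y) (Txi \<T> X Y r) \<XX> \<YY> \<le> Txi \<T> X Y r (Tm \<T> X \<XX>) (Tm \<T> Y \<YY>)"
proof -
  let ?P = "prod_set X Y"
  have P: "small ?P" using small by (simp add: small_prod_set)
  have "proj1 X Y \<in> ?P \<rightarrow> X" "proj2 X Y \<in> ?P \<rightarrow> Y" using proj1_in[of X Y] proj2_in[of X Y] by auto
  then have "tm ?P X (proj1 X Y) (Tm \<T> ?P \<WW>) = Tm \<T> X (tm (T \<T> ?P) (T \<T> X) (tm ?P X (proj1 X Y)) \<WW>)"
    "tm ?P Y (proj2 X Y) (Tm \<T> ?P \<WW>) = Tm \<T> Y (tm (T \<T> ?P) (T \<T> Y) (tm ?P Y (proj2 X Y)) \<WW>)"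
    if "\<WW> \<in> T \<T> (T \<T> ?P)" for \<WW>
    using Tm_natural small P that by simp_all
  then show ?thesis unfolding Txi_Txi[OF small] unfolding Txi_def
    using P proj1_in[of X Y] proj2_in[of X Y]
    by (auto intro!: SUP_least SUP_upper)
qed

text \<open>The converse of the previous inequality up to the choice of a preimage: every witness over
  \<open>m \<XX>\<close> lifts to a witness over \<open>\<XX>\<close>, because the naturality square of \<open>m\<close> at the first projection is a
  weak pullback.\<close>

lemma Txi_Tm_ge:
  assumes small: "small X" "small Y" and X: "\<XX> \<in> T \<T> (T \<T> X)"
  shows "Txi \<T> X Y r (Tm \<T> X \<XX>) \<yy>
    \<le> vcomp (T \<T> (T \<T> Y)) (vgraph (T \<T> (T \<T> Y)) (Tm \<T> Y)) (Txi \<T> (T \<T> X) (T \<T> Y) (Txi \<T> X Y r)) \<XX> \<yy>"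
    (is "_ \<le> ?R")
proof -
  let ?P = "prod_set X Y"
  have P: "small ?P" using small by (simp add: small_prod_set)
  have proj: "proj1 X Y \<in> ?P \<rightarrow> X" "proj2 X Y \<in> ?P \<rightarrow> Y"
    using proj1_in[of X Y] proj2_in[of X Y] by auto
  have "xiT \<T> ?P (\<lambda>p. r (proj1 X Y p) (proj2 X Y p)) \<ww> \<le> ?R"
    if w: "\<ww> \<in> T \<T> ?P" and w1: "tm ?P X (proj1 X Y) \<ww> = Tm \<T> X \<XX>" and w2: "tm ?P Y (proj2 X Y) \<ww> = \<yy>" for \<ww>
  proof -
    obtain \<WW> where W: "\<WW> \<in> T \<T> (T \<T> ?P)" "Tm \<T> ?P \<WW> = \<ww>"
      "tm (T \<T> ?P) (T \<T> X) (tm ?P X (proj1 X Y)) \<WW> = \<XX>"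
      using Tm_weak_pullback[OF P small(1) proj(1) w X w1] by blast
    define \<YY> where "\<YY> = tm (T \<T> ?P) (T \<T> Y) (tm ?P Y (proj2 X Y)) \<WW>"
    have mY: "Tm \<T> Y \<YY> = \<yy>"
      unfolding \<YY>_def using Tm_natural[OF P small(2) proj(2) W(1)] W(2) w2 by simp
    have Y: "\<YY> \<in> T \<T> (T \<T> Y)"
      unfolding \<YY>_def using small P W(1) tm_in[OF P small(2) proj(2)] by (intro tm_mem) auto
    have "xiT \<T> ?P (\<lambda>p. r (proj1 X Y p) (proj2 X Y p)) \<ww>
        \<le> Txi \<T> (T \<T> X) (T \<T> Y) (Txi \<T> X Y r) \<XX> \<YY>"
      unfolding Txi_Txi[OF small] by (rule SUP_upper2[of \<WW>]) (use W \<YY>_def in auto)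
    also have "\<dots> \<le> ?R" using vgraph_vcomp[OF Y] mY by metis
    finally show ?thesis .
  qed
  moreover have "Txi \<T> X Y r \<xx> \<yy> \<le> u"
    if "\<And>\<ww>. \<ww> \<in> T \<T> ?P \<Longrightarrow> tm ?P X (proj1 X Y) \<ww> = \<xx> \<Longrightarrow> tm ?P Y (proj2 X Y) \<ww> = \<yy> \<Longrightarrow>
        xiT \<T> ?P (\<lambda>p. r (proj1 X Y p) (proj2 X Y p)) \<ww> \<le> u" for \<xx> u
    unfolding Txi_def using that proj1_in[of X Y] proj2_in[of X Y] by (intro SUP_least) auto
  ultimately show ?thesis by blast
qed

end

text \<open>That \<open>T\<close> preserves one-point sets makes constants stable under extension (\<open>xiT_const\<close>) and the rows
  of the extension of a relation computable (\<open>Txi_row\<close>).\<close>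

locale pointed_theory_context = top_theory_context \<T>
  for \<T> :: "('u::set_universe, 'v::comm_quantale) top_theory" +
  assumes T_singleton: "\<And>x. is_singleton (T \<T> {x})"
begin

lemma T_singleton_eq: "t \<in> T \<T> {x} \<Longrightarrow> t' \<in> T \<T> {x} \<Longrightarrow> t = t'"
  using T_singleton[of x] by (auto simp: is_singleton_def)

lemma xiT_const:
  assumes "small X" "\<xx> \<in> T \<T> X"
  shows "xiT \<T> X (\<lambda>_. u) \<xx> = u"
proof -
  fix o' :: 'u
  have s: "small {o'}" by (rule small_singleton)
  have "tm X {o'} (\<lambda>_. o') \<xx> \<in> T \<T> {o'}"
    using assms s by (intro tm_mem) auto
  then have "tm X {o'} (\<lambda>_. o') \<xx> = Te \<T> {o'} o'"
    using s by (intro T_singleton_eq) auto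
  then have "xiT \<T> {o'} (\<lambda>_. u) (tm X {o'} (\<lambda>_. o') \<xx>) = u"
    using s by (simp add: xiT_Te)
  then show ?thesis using assms s by (simp add: xiT_reindex)
qed

lemma Txi_point:
  assumes "small Y" "t \<in> T \<T> {x}" "\<yy> \<in> T \<T> Y"
  shows "Txi \<T> {x} Y r t \<yy> = xiT \<T> Y (r x) \<yy>"
proof -
  have s: "small {x}" by (rule small_singleton)
  have span: "Txi \<T> {x} Y r t \<yy> = (SUP \<ww>\<in>{\<ww>\<in>T \<T> Y. tm Y {x} (\<lambda>_. x) \<ww> = t \<and> tm Y Y (\<lambda>y. y) \<ww> = \<yy>}. xiT \<T> Y (r x) \<ww>)"
  proof (rule Txi_span)
    fix x' y assume *: "x' \<in> {x}" "y \<in> Y"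
    then have "{w \<in> Y. x = x' \<and> w = y} = {y}" by auto
    then show "r x' y = (SUP w\<in>{w\<in>Y. x = x' \<and> w = y}. r x w)" using * by simp
  qed (use s assms in auto)
  have set: "{\<ww>\<in>T \<T> Y. tm Y {x} (\<lambda>_. x) \<ww> = t \<and> tm Y Y (\<lambda>y. y) \<ww> = \<yy>} = {\<yy>}"
  proof -
    have "tm Y {x} (\<lambda>_. x) \<yy> \<in> T \<T> {x}"
      using assms s by (intro tm_mem) auto
    then have "tm Y {x} (\<lambda>_. x) \<yy> = t"
      using assms(2) by (rule T_singleton_eq)
    then show ?thesis using assms(3) by (simp only: tm_id[OF assms(1)] cong: conj_cong) auto
  qed
  show ?thesis unfolding span set by simp
qed

text \<open>Restricting \<open>r\<close> along the inclusion of \<open>x\<close> gives a relation on a one-point set, which amounts to the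
  map \<open>r x\<close>; as \<open>T\<close> of a point is a point, the extension of this relation amounts to the extension of
  that map.\<close>

lemma Txi_row:
  assumes small: "small X" "small Y" and x: "x \<in> X" and y: "\<yy> \<in> T \<T> Y"
  shows "Txi \<T> X Y r (Te \<T> X x) \<yy> = xiT \<T> Y (r x) \<yy>"
proof -
  have s: "small {x}" and i: "(\<lambda>z. z) \<in> {x} \<rightarrow> X" using x by (auto simp: small_singleton)
  have e: "Te \<T> {x} x \<in> T \<T> {x}" using s by simp
  have "Txi \<T> X Y r (Te \<T> X x) \<yy> = Txi \<T> X Y r (tm {x} X (\<lambda>z. z) (Te \<T> {x} x)) \<yy>"
    using s small i by (simp add: Te_natural)
  also have "\<dots> = vcomp (T \<T> X) (Txi \<T> X Y r) (vgraph (T \<T> {x}) (tm {x} X (\<lambda>z. z))) (Te \<T> {x} x) \<yy>"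
    using tm_in[OF s small(1) i] e by (subst vcomp_vgraph) auto
  also have "\<dots> = Txi \<T> {x} Y (vcomp X r (vgraph {x} (\<lambda>z. z))) (Te \<T> {x} x) \<yy>"
    using s small i by (simp add: Txi_vcomp Txi_vgraph)
  also have "\<dots> = xiT \<T> Y (vcomp X r (vgraph {x} (\<lambda>z. z)) x) \<yy>"
    using small(2) e y by (rule Txi_point)
  also have "\<dots> = xiT \<T> Y (r x) \<yy>"
    by (rule fun_cong[OF xiT_cong]) (simp add: vcomp_vgraph[OF i])
  finally show ?thesis .
qed

section \<open>\<open>\<T>\<close>-categories and \<open>\<T>\<close>-functors\<close>

lemma tcat_small: "is_tcat \<T> A \<Longrightarrow> small (fst A)"
  by (auto simp: is_tcat_def)

lemma tcat_refl:
  assumes "is_tcat \<T> A" "x \<in> fst A"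
  shows "1 \<le> snd A (Te \<T> (fst A) x) x"
proof -
  have "vconv (vgraph (fst A) (Te \<T> (fst A))) \<le> snd A"
    using assms(1) by (auto simp: is_tcat_def)
  then have "vconv (vgraph (fst A) (Te \<T> (fst A))) (Te \<T> (fst A) x) x \<le> snd A (Te \<T> (fst A) x) x"
    by (simp add: le_fun_def)
  then show ?thesis using assms(2) by (simp add: vconv_def vgraph_def)
qed

lemma tcat_trans:
  assumes "is_tcat \<T> A" "\<XX> \<in> T \<T> (T \<T> (fst A))" "\<xx> \<in> T \<T> (fst A)"
  shows "Txi \<T> (T \<T> (fst A)) (fst A) (snd A) \<XX> \<xx> * snd A \<xx> x \<le> snd A (Tm \<T> (fst A) \<XX>) x"
proof -
  let ?X = "fst A" and ?a = "snd A"
  let ?m = "vgraph (T \<T> (T \<T> ?X)) (Tm \<T> ?X)"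
  let ?r = "vcomp (T \<T> (T \<T> ?X)) (Txi \<T> (T \<T> ?X) ?X ?a) (vconv ?m)"
  have "Txi \<T> (T \<T> ?X) ?X ?a \<XX> \<xx> \<le> ?r (Tm \<T> ?X \<XX>) \<xx>"
    using vcomp_upper[of \<XX> "T \<T> (T \<T> ?X)" "vconv ?m" "Tm \<T> ?X \<XX>" "Txi \<T> (T \<T> ?X) ?X ?a" \<xx>] assms(2)
    by (simp add: vconv_def vgraph_def)
  then have "Txi \<T> (T \<T> ?X) ?X ?a \<XX> \<xx> * ?a \<xx> x \<le> ?r (Tm \<T> ?X \<XX>) \<xx> * ?a \<xx> x"
    by (intro quantale_mult_mono) auto
  also have "\<dots> \<le> vcomp (T \<T> ?X) ?a ?r (Tm \<T> ?X \<XX>) x"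
    using assms(3) by (rule vcomp_upper)
  also have "\<dots> \<le> ?a (Tm \<T> ?X \<XX>) x"
    using assms(1) by (auto simp: is_tcat_def le_fun_def)
  finally show ?thesis .
qed

lemma is_tcatI:
  assumes X: "small X" and a: "a \<in> vrel (T \<T> X) X"
    and refl: "\<And>x. x \<in> X \<Longrightarrow> 1 \<le> a (Te \<T> X x) x"
    and trans: "\<And>\<XX> \<xx> x. \<XX> \<in> T \<T> (T \<T> X) \<Longrightarrow> \<xx> \<in> T \<T> X \<Longrightarrow> x \<in> X \<Longrightarrow>
      Txi \<T> (T \<T> X) X a \<XX> \<xx> * a \<xx> x \<le> a (Tm \<T> X \<XX>) x"
  shows "is_tcat \<T> (X, a)"
proof -
  have "vconv (vgraph X (Te \<T> X)) \<le> a"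
    using refl by (auto simp: le_fun_def vconv_def vgraph_def)
  moreover have "vcomp (T \<T> X) a (vcomp (T \<T> (T \<T> X)) (Txi \<T> (T \<T> X) X a)
      (vconv (vgraph (T \<T> (T \<T> X)) (Tm \<T> X)))) \<zz> x \<le> a \<zz> x" for \<zz> x
  proof (cases "x \<in> X")
    case True
    show ?thesis
      unfolding vcomp_le_iff
    proof
      fix \<xx> assume x: "\<xx> \<in> T \<T> X"
      show "vcomp (T \<T> (T \<T> X)) (Txi \<T> (T \<T> X) X a)
          (vconv (vgraph (T \<T> (T \<T> X)) (Tm \<T> X))) \<zz> \<xx> * a \<xx> x \<le> a \<zz> x"
        unfolding vcomp_def quantale_SUP_mult
        by (rule SUP_least) (use trans x True in \<open>auto simp: vconv_def vgraph_def\<close>)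
    qed
  next
    case False
    then show ?thesis using a by (simp add: vcomp_def vrel_def)
  qed
  ultimately show ?thesis using X a by (simp add: is_tcat_def le_fun_def)
qed

lemma tcat_trans_under:
  assumes "is_tcat \<T> A" "\<xx> \<in> T \<T> (fst A)" "x \<in> fst A"
  shows "snd A \<xx> x * snd A (Te \<T> (fst A) x) z \<le> snd A \<xx> z"
proof -
  note X = tcat_small[OF assms(1)]
  have "snd A \<xx> x \<le> Txi \<T> (T \<T> (fst A)) (fst A) (snd A) (Te \<T> (T \<T> (fst A)) \<xx>) (Te \<T> (fst A) x)"
    using X assms by (intro Txi_Te) auto
  then have "snd A \<xx> x * snd A (Te \<T> (fst A) x) z
      \<le> Txi \<T> (T \<T> (fst A)) (fst A) (snd A) (Te \<T> (T \<T> (fst A)) \<xx>) (Te \<T> (fst A) x) * snd A (Te \<T> (fst A) x) z"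
    by (intro quantale_mult_mono) auto
  also have "\<dots> \<le> snd A (Tm \<T> (fst A) (Te \<T> (T \<T> (fst A)) \<xx>)) z"
    using X assms by (intro tcat_trans) auto
  finally show ?thesis using X assms by (simp add: Tm_Te)
qed

lemma under_eq:
  assumes "small (fst A)" "x \<in> fst A"
  shows "under \<T> A x z = snd A (Te \<T> (fst A) x) z"
  using assms Te_in[OF assms(1)] by (cases A) (auto simp: under_def intro!: vcomp_vgraph)

lemma tfunctors_iff: "f \<in> tfunctors \<T> A B \<longleftrightarrow> f \<in> fst A \<rightarrow>\<^sub>E fst B \<and>
    (\<forall>\<xx>\<in>T \<T> (fst A). \<forall>x\<in>fst A. snd A \<xx> x \<le> snd B (tm (fst A) (fst B) f \<xx>) (f x))"
  by (cases A; cases B) (auto simp: tfunctors_def)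

lemma tfunctors_in: "f \<in> tfunctors \<T> A B \<Longrightarrow> f \<in> fst A \<rightarrow>\<^sub>E fst B"
  by (simp add: tfunctors_iff)

lemma tfunctors_mem: "f \<in> tfunctors \<T> A B \<Longrightarrow> x \<in> fst A \<Longrightarrow> f x \<in> fst B"
  by (auto simp: tfunctors_iff)

lemma tfunctors_le: "f \<in> tfunctors \<T> A B \<Longrightarrow> \<xx> \<in> T \<T> (fst A) \<Longrightarrow> x \<in> fst A \<Longrightarrow>
    snd A \<xx> x \<le> snd B (tm (fst A) (fst B) f \<xx>) (f x)"
  by (simp add: tfunctors_iff)

lemma tfunctors_ident:
  assumes "is_tcat \<T> A"
  shows "restrict id (fst A) \<in> tfunctors \<T> A A"
  using assms tm_ident[OF tcat_small[OF assms], of id] by (auto simp: tfunctors_iff)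

lemma tfunctors_compose:
  assumes "is_tcat \<T> A" "is_tcat \<T> B" "is_tcat \<T> D" and f: "f \<in> tfunctors \<T> A B" and g: "g \<in> tfunctors \<T> B D"
  shows "compose (fst A) g f \<in> tfunctors \<T> A D"
proof -
  note small = tcat_small[OF assms(1)] tcat_small[OF assms(2)] tcat_small[OF assms(3)]
  have f': "f \<in> fst A \<rightarrow> fst B" and g': "g \<in> fst B \<rightarrow> fst D" using f g tfunctors_mem by auto
  have "snd A \<xx> x \<le> snd D (tm (fst A) (fst D) (compose (fst A) g f) \<xx>) (g (f x))"
    if x: "\<xx> \<in> T \<T> (fst A)" "x \<in> fst A" for \<xx> x
  proof -
    have Tf: "tm (fst A) (fst B) f \<xx> \<in> T \<T> (fst B)" using small f' x by (intro tm_mem)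
    have "snd A \<xx> x \<le> snd B (tm (fst A) (fst B) f \<xx>) (f x)" using f x by (rule tfunctors_le)
    also have "\<dots> \<le> snd D (tm (fst B) (fst D) g (tm (fst A) (fst B) f \<xx>)) (g (f x))"
      using g Tf f' x by (intro tfunctors_le) auto
    also have "tm (fst B) (fst D) g (tm (fst A) (fst B) f \<xx>) = tm (fst A) (fst D) (\<lambda>x. g (f x)) \<xx>"
      using small f' g' x by (intro tm_comp)
    also have "\<dots> = tm (fst A) (fst D) (compose (fst A) g f) \<xx>"
      by (rule fun_cong[OF tm_cong]) (simp add: compose_def)
    finally show ?thesis .
  qed
  then show ?thesis using f' g' by (auto simp: tfunctors_iff compose_def)
qed

lemma tfunctors_under:
  assumes small: "small (fst A)" "small (fst B)" and "f \<in> tfunctors \<T> A B" "x \<in> fst A" "y \<in> fst A"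
  shows "under \<T> A x y \<le> under \<T> B (f x) (f y)"
proof -
  have f: "f \<in> fst A \<rightarrow> fst B" using assms tfunctors_mem by auto
  then have fx: "f x \<in> fst B" using assms by auto
  have "snd A (Te \<T> (fst A) x) y \<le> snd B (tm (fst A) (fst B) f (Te \<T> (fst A) x)) (f y)"
    using assms small by (intro tfunctors_le) auto
  then show ?thesis using assms small f fx by (simp add: under_eq Te_natural del: restrict_apply)
qed

lemma under_refl: "is_tcat \<T> A \<Longrightarrow> x \<in> fst A \<Longrightarrow> 1 \<le> under \<T> A x x"
  by (simp add: under_eq tcat_small tcat_refl)

lemma under_trans:
  assumes "is_tcat \<T> A" "x \<in> fst A" "y \<in> fst A"
  shows "under \<T> A x y * under \<T> A y z \<le> under \<T> A x z"
  using tcat_trans_under[OF assms(1), of "Te \<T> (fst A) x" y z] assms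
  by (simp add: under_eq tcat_small)

lemma under_one_trans:
  assumes "is_tcat \<T> A" "x \<in> fst A" "y \<in> fst A" "1 \<le> under \<T> A x y" "1 \<le> under \<T> A y z"
  shows "1 \<le> under \<T> A x z"
proof -
  have "1 * 1 \<le> under \<T> A x y * under \<T> A y z" using assms by (intro quantale_mult_mono)
  also have "\<dots> \<le> under \<T> A x z" using assms by (intro under_trans)
  finally show ?thesis by simp
qed

lemma TCat_is_ord_category: "is_ord_category (TCat \<T>)"
proof -
  have cat: "is_category (TCat \<T>)"
    unfolding is_category_def
  proof (intro conjI ballI)
    fix A B f assume "A \<in> Ob (TCat \<T>)" "B \<in> Ob (TCat \<T>)" "f \<in> Hom (TCat \<T>) A B"
    then have f: "f \<in> fst A \<rightarrow>\<^sub>E fst B" by (simp add: TCat_def tfunctors_iff)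
    show "cmp (TCat \<T>) A A B f (ident (TCat \<T>) A) = f"
      using f by (auto simp: TCat_def compose_def fun_eq_iff PiE_def extensional_def)
    show "cmp (TCat \<T>) A B B (ident (TCat \<T>) B) f = f"
      using f by (auto simp: TCat_def compose_def fun_eq_iff PiE_def extensional_def)
  next
    fix A B D E f g h assume "A \<in> Ob (TCat \<T>)" "B \<in> Ob (TCat \<T>)" "f \<in> Hom (TCat \<T>) A B"
    then have f: "f \<in> fst A \<rightarrow>\<^sub>E fst B" by (simp add: TCat_def tfunctors_iff)
    then show "cmp (TCat \<T>) A D E h (cmp (TCat \<T>) A B D g f) = cmp (TCat \<T>) A B E (cmp (TCat \<T>) B D E h g) f"
      by (auto simp: TCat_def compose_def fun_eq_iff)
  qed (auto simp: TCat_def tfunctors_ident intro: tfunctors_compose[of "(X, a)" "(Y, b)" "(Z, c)" for X a Y b Z c, simplified])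
  show ?thesis
    unfolding is_ord_category_def
  proof (intro conjI ballI impI cat)
    fix A B f assume "A \<in> Ob (TCat \<T>)" "B \<in> Ob (TCat \<T>)" "f \<in> Hom (TCat \<T>) A B"
    then show "le (TCat \<T>) A B f f" by (auto simp: TCat_def intro: under_refl tfunctors_mem)
  next
    fix A B f g h assume "A \<in> Ob (TCat \<T>)" "B \<in> Ob (TCat \<T>)" "f \<in> Hom (TCat \<T>) A B" "g \<in> Hom (TCat \<T>) A B"
      "le (TCat \<T>) A B f g" "le (TCat \<T>) A B g h"
    then show "le (TCat \<T>) A B f h"
      by (auto simp: TCat_def intro: under_one_trans tfunctors_mem)
  next
    fix A B D f f' g g'
    assume *: "A \<in> Ob (TCat \<T>)" "B \<in> Ob (TCat \<T>)" "D \<in> Ob (TCat \<T>)" "f \<in> Hom (TCat \<T>) A B" "f' \<in> Hom (TCat \<T>) A B"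
      "g \<in> Hom (TCat \<T>) B D" "g' \<in> Hom (TCat \<T>) B D" "le (TCat \<T>) A B f f'" "le (TCat \<T>) B D g g'"
    have "1 \<le> under \<T> D (g (f x)) (g' (f' x))" if x: "x \<in> fst A" for x
    proof (rule under_one_trans)
      have fx: "f x \<in> fst B" "f' x \<in> fst B" using * x tfunctors_mem by (auto simp: TCat_def)
      show "is_tcat \<T> D" using * by (simp add: TCat_def)
      show "g (f x) \<in> fst D" "g (f' x) \<in> fst D" using * fx tfunctors_mem by (auto simp: TCat_def)
      have "1 \<le> under \<T> B (f x) (f' x)" using * x by (simp add: TCat_def)
      also have "\<dots> \<le> under \<T> D (g (f x)) (g (f' x))"
        using * fx by (intro tfunctors_under) (simp_all add: TCat_def tcat_small)
      finally show "1 \<le> under \<T> D (g (f x)) (g (f' x))" .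
      show "1 \<le> under \<T> D (g (f' x)) (g' (f' x))" using * fx by (simp add: TCat_def)
    qed
    then show "le (TCat \<T>) A D (cmp (TCat \<T>) A B D g f) (cmp (TCat \<T>) A B D g' f')"
      by (simp add: TCat_def compose_def)
  qed
qed

section \<open>Functors into the quantale\<close>

text \<open>The exponential transpose of the condition for \<open>\<phi>\<close> to be a \<open>\<T>\<close>-functor from \<open>A\<close> to \<open>\<V>\<close>.\<close>

definition vfunctor :: "('u, 'v) tcat \<Rightarrow> ('u \<Rightarrow> 'v) \<Rightarrow> bool" where
  "vfunctor A \<phi> \<longleftrightarrow> (\<forall>\<xx>\<in>T \<T> (fst A). \<forall>x\<in>fst A. xiT \<T> (fst A) \<phi> \<xx> * snd A \<xx> x \<le> \<phi> x)"

abbreviation enc :: "('u, 'v) tcat \<Rightarrow> ('u \<Rightarrow> 'v) \<Rightarrow> 'u" where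
  "enc A \<equiv> vencode \<T> (fst A)"

abbreviation dec :: "('u, 'v) tcat \<Rightarrow> 'u \<Rightarrow> 'u \<Rightarrow> 'v" where
  "dec A \<equiv> vdecode \<T> (fst A)"

lemma vmap_tfunctor_iff:
  assumes "small (fst A)"
  shows "vmap \<T> (fst A) \<phi> \<in> tfunctors \<T> A (Vtcat \<T>) \<longleftrightarrow> vfunctor A \<phi>"
proof -
  have m: "(\<lambda>x. emb \<T> (\<phi> x)) \<in> fst A \<rightarrow> Vset \<T>" by auto
  have "tm (fst A) (Vset \<T>) (vmap \<T> (fst A) \<phi>) \<xx> \<in> T \<T> (Vset \<T>)" if "\<xx> \<in> T \<T> (fst A)" for \<xx>
    using assms that m by (auto simp: vmap_def intro!: tm_mem)
  then show ?thesis
    by (auto simp: tfunctors_iff Vtcat_def vfunctor_def le_qhom_iff xiT_eq mult.commute vmap_def)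
qed

lemma vdecode_vencode:
  assumes "small X" "x \<in> X"
  shows "vdecode \<T> X (vencode \<T> X \<phi>) x = \<phi> x"
proof -
  have "vmap \<T> X \<phi> \<in> X \<rightarrow>\<^sub>E Vset \<T>" by (simp add: vmap_def)
  then have "inv_into (X \<rightarrow>\<^sub>E Vset \<T>) fcode (fcode (vmap \<T> X \<phi>)) = vmap \<T> X \<phi>"
    using inj_on_fcode[OF assms(1) Vset_small] by (rule inv_into_f_f[rotated])
  then show ?thesis using assms by (simp add: vdecode_def vencode_def vmap_def)
qed

lemma vencode_in_Vpow: "small (fst A) \<Longrightarrow> vfunctor A \<phi> \<Longrightarrow> enc A \<phi> \<in> Vpow \<T> A"
  unfolding Vpow_def vencode_def by (simp add: vmap_tfunctor_iff)

lemma vencode_cong: "(\<And>x. x \<in> X \<Longrightarrow> \<phi> x = \<psi> x) \<Longrightarrow> vencode \<T> X \<phi> = vencode \<T> X \<psi>"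
  unfolding vencode_def vmap_def by (metis (mono_tags, lifting) restrict_ext)

lemma vfunctor_cong: "(\<And>x. x \<in> fst A \<Longrightarrow> \<phi> x = \<psi> x) \<Longrightarrow> vfunctor A \<phi> \<longleftrightarrow> vfunctor A \<psi>"
  using xiT_cong[of "fst A" \<phi> \<psi>] by (simp add: vfunctor_def)

text \<open>Only values on the underlying set matter, so every code is obtained from a map with values in the
  quantale itself.\<close>

lemma Vpow_cases:
  assumes "small (fst A)" "c \<in> Vpow \<T> A"
  obtains \<phi> where "vfunctor A \<phi>" "c = enc A \<phi>"
proof -
  obtain f where f: "f \<in> tfunctors \<T> A (Vtcat \<T>)" "c = fcode f"
    using assms(2) by (auto simp: Vpow_def)
  have "f \<in> fst A \<rightarrow>\<^sub>E Vset \<T>" using tfunctors_in[OF f(1)] by (simp add: Vtcat_def)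
  then have "f = vmap \<T> (fst A) (\<lambda>x. val \<T> (f x))"
    by (auto simp: vmap_def fun_eq_iff PiE_def extensional_def Pi_iff)
  then show ?thesis
    using that f assms(1) by (metis vencode_def vmap_tfunctor_iff)
qed

lemma vdecode_vfunctor:
  assumes "small (fst A)" "c \<in> Vpow \<T> A"
  shows "vfunctor A (dec A c)"
proof -
  from Vpow_cases[OF assms] obtain \<phi> where "vfunctor A \<phi>" "c = enc A \<phi>" .
  then show ?thesis using assms by (subst vfunctor_cong) (auto simp: vdecode_vencode)
qed

lemma Vpow_eqI:
  assumes "small (fst A)" "c \<in> Vpow \<T> A" "d \<in> Vpow \<T> A"
    and "\<And>x. x \<in> fst A \<Longrightarrow> dec A c x = dec A d x"
  shows "c = d"
proof -
  have enc: "c = enc A (dec A c)" if "c \<in> Vpow \<T> A" for c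
  proof -
    from Vpow_cases[OF assms(1) that] obtain \<phi> where c: "c = enc A \<phi>" .
    show ?thesis
      unfolding c by (rule vencode_cong) (simp add: vdecode_vencode assms(1))
  qed
  have "enc A (dec A c) = enc A (dec A d)" using assms(4) by (rule vencode_cong)
  then show ?thesis using enc[OF assms(2)] enc[OF assms(3)] by simp
qed

lemma small_Vpow:
  assumes "small (fst A)"
  shows "small (Vpow \<T> A)"
proof (rule small_subset)
  show "small (fcode ` (fst A \<rightarrow>\<^sub>E Vset \<T>))" using assms Vset_small by (rule small_fcode)
  show "Vpow \<T> A \<subseteq> fcode ` (fst A \<rightarrow>\<^sub>E Vset \<T>)"
    unfolding Vpow_def by (rule image_mono) (auto simp: tfunctors_iff Vtcat_def)
qed

lemma vfunctorD: "vfunctor A \<phi> \<Longrightarrow> \<xx> \<in> T \<T> (fst A) \<Longrightarrow> x \<in> fst A \<Longrightarrow> xiT \<T> (fst A) \<phi> \<xx> * snd A \<xx> x \<le> \<phi> x"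
  by (simp add: vfunctor_def)

lemma vfunctor_under:
  assumes "small (fst A)" "vfunctor A \<phi>" "x \<in> fst A" "y \<in> fst A"
  shows "\<phi> x * under \<T> A x y \<le> \<phi> y"
  using vfunctorD[OF assms(2), of "Te \<T> (fst A) x" y] assms by (simp add: xiT_Te under_eq)

lemma vfunctor_comp:
  assumes "small (fst A)" "small (fst B)" and f: "f \<in> tfunctors \<T> A B" and "vfunctor B \<psi>"
  shows "vfunctor A (\<lambda>x. \<psi> (f x))"
  unfolding vfunctor_def
proof (intro ballI)
  fix \<xx> x assume x: "\<xx> \<in> T \<T> (fst A)" "x \<in> fst A"
  have f': "f \<in> fst A \<rightarrow> fst B" using f tfunctors_mem by auto
  have "xiT \<T> (fst A) (\<lambda>x. \<psi> (f x)) \<xx> * snd A \<xx> x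
      \<le> xiT \<T> (fst B) \<psi> (tm (fst A) (fst B) f \<xx>) * snd B (tm (fst A) (fst B) f \<xx>) (f x)"
    using assms x f' by (simp add: xiT_reindex quantale_mult_mono tfunctors_le del: restrict_apply)
  also have "\<dots> \<le> \<psi> (f x)"
    using assms x f' by (intro vfunctorD tm_mem) auto
  finally show "xiT \<T> (fst A) (\<lambda>x. \<psi> (f x)) \<xx> * snd A \<xx> x \<le> \<psi> (f x)" .
qed

text \<open>Taking \<open>y = x\<close> gives one half by reflexivity, and the other half is monotonicity of \<open>\<psi>\<close>; the scalar \<open>u\<close>
  makes this a statement about the value \<open>[a\<^sub>0(x,-), \<psi>] = \<psi> x\<close> and not only about the order.\<close>

lemma Yoneda:
  assumes A: "is_tcat \<T> A" and "vfunctor A \<psi>" and x: "x \<in> fst A"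
  shows "(\<forall>y\<in>fst A. u * under \<T> A x y \<le> \<psi> y) \<longleftrightarrow> u \<le> \<psi> x"
proof
  assume *: "\<forall>y\<in>fst A. u * under \<T> A x y \<le> \<psi> y"
  have "u * 1 \<le> u * under \<T> A x x"
    using A x by (intro quantale_mult_mono under_refl) auto
  also have "\<dots> \<le> \<psi> x" using * x by blast
  finally show "u \<le> \<psi> x" by simp
next
  assume *: "u \<le> \<psi> x"
  show "\<forall>y\<in>fst A. u * under \<T> A x y \<le> \<psi> y"
  proof
    fix y assume y: "y \<in> fst A"
    have "u * under \<T> A x y \<le> \<psi> x * under \<T> A x y" using * by (intro quantale_mult_mono) auto
    also have "\<dots> \<le> \<psi> y" using assms y by (intro vfunctor_under tcat_small)
    finally show "u * under \<T> A x y \<le> \<psi> y" .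
  qed
qed

section \<open>Lifting relations into a \<open>\<T>\<close>-category\<close>

text \<open>The relation \<open>a \<cdot> T\<^sub>\<xi> r : TS \<nrightarrow> X\<close>. For \<open>r = ev\<close> it is the relation \<open>\<mu>\<close> from which the structure of the
  power object is built.\<close>

definition lift :: "('u, 'v) tcat \<Rightarrow> 'u set \<Rightarrow> ('u \<Rightarrow> 'u \<Rightarrow> 'v) \<Rightarrow> 'u \<Rightarrow> 'u \<Rightarrow> 'v" where
  "lift A S r = vcomp (T \<T> (fst A)) (snd A) (Txi \<T> S (fst A) r)"

lemma lift_mono_on:
  assumes "small (fst A)" "small S" "\<And>s x. s \<in> S \<Longrightarrow> x \<in> fst A \<Longrightarrow> r s x \<le> r' s x"
  shows "lift A S r \<ss> x \<le> lift A S r' \<ss> x"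
  unfolding lift_def using vcomp_mono[OF order_refl Txi_mono_on[OF assms(2,1,3)]] by (simp add: le_fun_def)

lemma lift_vcomp:
  assumes "small (fst A)" "small S" "small P"
  shows "lift A S (vcomp P r q) = vcomp (T \<T> P) (lift A P r) (Txi \<T> S P q)"
  using assms by (simp add: lift_def Txi_vcomp vcomp_assoc)

lemma lift_reindex:
  assumes "small (fst A)" "small S" "small P" "f \<in> S \<rightarrow> P" "\<ss> \<in> T \<T> S"
  shows "lift A S (\<lambda>s. r (f s)) \<ss> x = lift A P r (tm S P f \<ss>) x"
  unfolding lift_def vcomp_def Txi_reindex[OF assms(2,3,1,4,5)] ..

lemma lift_Te:
  assumes "small (fst A)" "small S" "s \<in> S"
  shows "lift A S r (Te \<T> S s) x = (SUP \<xx>\<in>T \<T> (fst A). xiT \<T> (fst A) (r s) \<xx> * snd A \<xx> x)"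
  unfolding lift_def vcomp_def using assms by (intro SUP_cong refl) (simp add: Txi_row)

lemma lift_Te_ge:
  assumes A: "is_tcat \<T> A" and "small S" "s \<in> S" and x: "x \<in> fst A"
  shows "r s x \<le> lift A S r (Te \<T> S s) x"
proof -
  note X = tcat_small[OF A]
  have "r s x * 1 \<le> xiT \<T> (fst A) (r s) (Te \<T> (fst A) x) * snd A (Te \<T> (fst A) x) x"
    using A X x by (intro quantale_mult_mono tcat_refl) (simp_all add: xiT_Te)
  also have "\<dots> \<le> lift A S r (Te \<T> S s) x"
    unfolding lift_Te[OF X assms(2,3)] using X x by (intro SUP_upper) auto
  finally show ?thesis by simp
qed

lemma lift_Te_vfunctor:
  assumes A: "is_tcat \<T> A" and "small S" "s \<in> S" "x \<in> fst A" "vfunctor A (r s)"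
  shows "lift A S r (Te \<T> S s) x = r s x"
proof (rule antisym)
  show "lift A S r (Te \<T> S s) x \<le> r s x"
    unfolding lift_Te[OF tcat_small[OF A] assms(2,3)]
    using assms by (intro SUP_least vfunctorD)
qed (use assms in \<open>intro lift_Te_ge\<close>)

text \<open>The transitivity \<open>a \<cdot> T\<^sub>\<xi> a \<le> a \<cdot> m\<close> and the inequality \<open>m \<cdot> T\<^sub>\<xi> T\<^sub>\<xi> r \<le> T\<^sub>\<xi> r \<cdot> m\<close> give
  \<open>a \<cdot> T\<^sub>\<xi> a \<cdot> T\<^sub>\<xi> T\<^sub>\<xi> r \<le> a \<cdot> m \<cdot> T\<^sub>\<xi> T\<^sub>\<xi> r \<le> a \<cdot> T\<^sub>\<xi> r \<cdot> m\<close>.\<close>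

lemma lift_lift_le:
  assumes A: "is_tcat \<T> A" and S: "small S" and \<SS>: "\<SS> \<in> T \<T> (T \<T> S)"
  shows "lift A (T \<T> S) (lift A S r) \<SS> x \<le> lift A S r (Tm \<T> S \<SS>) x"
proof -
  let ?X = "fst A" and ?a = "snd A"
  let ?TTX = "T \<T> (T \<T> ?X)"
  let ?Tr = "Txi \<T> S ?X r" and ?TTr = "Txi \<T> (T \<T> S) (T \<T> ?X) (Txi \<T> S ?X r)"
  note X = tcat_small[OF A]
  have "lift A (T \<T> S) (lift A S r)
      = vcomp (T \<T> ?X) ?a (vcomp ?TTX (Txi \<T> (T \<T> ?X) ?X ?a) ?TTr)"
    unfolding lift_def using X S by (simp add: Txi_vcomp)
  then have eq: "lift A (T \<T> S) (lift A S r) = vcomp ?TTX (vcomp (T \<T> ?X) ?a (Txi \<T> (T \<T> ?X) ?X ?a)) ?TTr"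
    by (simp add: vcomp_assoc)
  show ?thesis
    unfolding eq vcomp_le_iff
  proof
    fix \<XX> assume \<XX>: "\<XX> \<in> ?TTX"
    have "vcomp (T \<T> ?X) ?a (Txi \<T> (T \<T> ?X) ?X ?a) \<XX> x \<le> ?a (Tm \<T> ?X \<XX>) x"
      unfolding vcomp_le_iff using tcat_trans[OF A \<XX>] by blast
    then have "?TTr \<SS> \<XX> * vcomp (T \<T> ?X) ?a (Txi \<T> (T \<T> ?X) ?X ?a) \<XX> x
        \<le> ?Tr (Tm \<T> S \<SS>) (Tm \<T> ?X \<XX>) * ?a (Tm \<T> ?X \<XX>) x"
      using X S by (intro quantale_mult_mono Txi_Tm_le)
    also have "\<dots> \<le> lift A S r (Tm \<T> S \<SS>) x"
      unfolding lift_def using X \<XX> by (intro vcomp_upper) simp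
    finally show "?TTr \<SS> \<XX> * vcomp (T \<T> ?X) ?a (Txi \<T> (T \<T> ?X) ?X ?a) \<XX> x \<le> lift A S r (Tm \<T> S \<SS>) x" .
  qed
qed

text \<open>At \<open>e s\<close> the lift is the supremum that occurs in the definition of a functor into the quantale.\<close>

lemma vfunctor_rowI:
  assumes A: "small (fst A)" and S: "small S" "s \<in> S"
    and le: "\<And>x. x \<in> fst A \<Longrightarrow> lift A S r (Te \<T> S s) x \<le> r s x"
  shows "vfunctor A (r s)"
  unfolding vfunctor_def
proof (intro ballI)
  fix \<xx> x assume x: "\<xx> \<in> T \<T> (fst A)" "x \<in> fst A"
  have "xiT \<T> (fst A) (r s) \<xx> * snd A \<xx> x \<le> lift A S r (Te \<T> S s) x"
    unfolding lift_Te[OF A S] using x by (intro SUP_upper)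
  also have "\<dots> \<le> r s x" using x by (intro le)
  finally show "xiT \<T> (fst A) (r s) \<xx> * snd A \<xx> x \<le> r s x" .
qed

text \<open>Apply the criterion for rows to the lift itself: by \<open>m \<cdot> e = 1\<close>, its own lift at \<open>e \<ss>\<close> is bounded by
  its value at \<open>\<ss>\<close>.\<close>

lemma vfunctor_lift:
  assumes A: "is_tcat \<T> A" and S: "small S" "\<ss> \<in> T \<T> S"
  shows "vfunctor A (lift A S r \<ss>)"
proof (rule vfunctor_rowI)
  show "lift A (T \<T> S) (lift A S r) (Te \<T> (T \<T> S) \<ss>) x \<le> lift A S r \<ss> x" for x
    using lift_lift_le[OF A S(1), of "Te \<T> (T \<T> S) \<ss>" r x] S by (simp add: Tm_Te)
qed (use A S in \<open>simp_all add: tcat_small\<close>)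

text \<open>\<open>b \<cdot> T\<^sub>\<xi> (f \<cdot> r) = (b \<cdot> Tf) \<cdot> T\<^sub>\<xi> r\<close>, written out.\<close>

lemma lift_postcompose:
  assumes X: "small X" and Y: "small (fst B)" and f: "f \<in> X \<rightarrow> fst B" and S: "small S"
  shows "lift B S (vcomp X (vgraph X f) r) \<ss> y
    = (SUP \<xx>\<in>T \<T> X. Txi \<T> S X r \<ss> \<xx> * snd B (tm X (fst B) f \<xx>) y)"
proof -
  have Tf: "tm X (fst B) f \<in> T \<T> X \<rightarrow> T \<T> (fst B)" using tm_in[OF X Y f] by auto
  have "lift B S (vcomp X (vgraph X f) r)
      = vcomp (T \<T> X) (vcomp (T \<T> (fst B)) (snd B) (vgraph (T \<T> X) (tm X (fst B) f))) (Txi \<T> S X r)"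
    unfolding lift_def using X Y S f by (simp add: Txi_vcomp Txi_vgraph vcomp_assoc)
  then show ?thesis
    unfolding vcomp_def[of "T \<T> X"] by (simp add: vcomp_vgraph[OF Tf] cong: SUP_cong)
qed

text \<open>In terms of relations, a \<open>\<T>\<close>-functor \<open>f\<close> satisfies \<open>a \<le> f\<degree> \<cdot> b \<cdot> Tf\<close>.\<close>

lemma lift_tfunctor:
  assumes A: "is_tcat \<T> A" and B: "is_tcat \<T> B" and f: "f \<in> tfunctors \<T> A B" and S: "small S" and x: "x \<in> fst A"
  shows "lift A S r \<ss> x \<le> lift B S (vcomp (fst A) (vgraph (fst A) f) r) \<ss> (f x)"
proof -
  have f': "f \<in> fst A \<rightarrow> fst B" using f tfunctors_mem by auto
  show ?thesis
    unfolding lift_postcompose[OF tcat_small[OF A] tcat_small[OF B] f' S]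
    unfolding lift_def vcomp_def
    using tfunctors_le[OF f _ x] by (intro SUP_mono) (blast intro: quantale_mult_mono)
qed

lemma vfunctor_under_row:
  assumes A: "is_tcat \<T> A" and x: "x \<in> fst A"
  shows "vfunctor A (under \<T> A x)"
proof -
  note X = tcat_small[OF A]
  have e: "Te \<T> (fst A) x \<in> T \<T> (fst A)" using X x by simp
  have "vfunctor A (snd A (Te \<T> (fst A) x))"
  proof (rule vfunctor_rowI[OF X T_small[OF X] e])
    fix z
    show "lift A (T \<T> (fst A)) (snd A) (Te \<T> (T \<T> (fst A)) (Te \<T> (fst A) x)) z \<le> snd A (Te \<T> (fst A) x) z"
      unfolding lift_def vcomp_le_iff
      using tcat_trans[OF A, of "Te \<T> (T \<T> (fst A)) (Te \<T> (fst A) x)"] X e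
      by (simp add: Tm_Te)
  qed
  then show ?thesis using X x by (subst vfunctor_cong[OF under_eq]) auto
qed

section \<open>The power object\<close>

abbreviation VP :: "('u, 'v) tcat \<Rightarrow> 'u set" where
  "VP A \<equiv> Vpow \<T> A"

abbreviation VO :: "('u, 'v) tcat \<Rightarrow> ('u, 'v) tcat" where
  "VO A \<equiv> Vobj \<T> A"

lemma fst_Vobj [simp]: "fst (VO A) = VP A"
  by (simp add: Vobj_def)

lemma ev_mu_eq:
  assumes "small (fst A)"
  shows "ev_mu \<T> A = lift A (VP A) (dec A)"
proof -
  have "Txi \<T> (VP A) (fst A) (ev \<T> A) = Txi \<T> (VP A) (fst A) (dec A)"
    using assms by (intro Txi_cong small_Vpow) (simp_all add: ev_def)
  then show ?thesis by (cases A) (simp add: ev_mu_def lift_def)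
qed

text \<open>The structure of the power object is the largest relation \<open>c\<close> with \<open>ev \<cdot> c \<le> \<mu>\<close>.\<close>

lemma le_Vobj_iff:
  assumes "small (fst A)" "\<pp> \<in> T \<T> (VP A)" "c \<in> VP A"
  shows "u \<le> snd (VO A) \<pp> c \<longleftrightarrow> (\<forall>x\<in>fst A. u * dec A c x \<le> lift A (VP A) (dec A) \<pp> x)"
  using assms by (simp add: Vobj_def ev_mu_eq le_INF_iff le_qhom_iff)

lemma Vobj_apply:
  assumes "small (fst A)" "\<pp> \<in> T \<T> (VP A)" "c \<in> VP A" "x \<in> fst A"
  shows "snd (VO A) \<pp> c * dec A c x \<le> lift A (VP A) (dec A) \<pp> x"
  using le_Vobj_iff[OF assms(1-3)] assms(4) by blast

text \<open>With \<open>c\<close> the structure of the power object,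
  \<open>\<mu> \<cdot> T\<^sub>\<xi> c = a \<cdot> T\<^sub>\<xi> (ev \<cdot> c) \<le> a \<cdot> T\<^sub>\<xi> \<mu> \<le> \<mu> \<cdot> m\<close>. Transitivity of \<open>c\<close> is its
  consequence under the adjunction that defines \<open>c\<close>.\<close>

lemma Txi_Vobj_lift:
  assumes A: "is_tcat \<T> A" and \<PP>: "\<PP> \<in> T \<T> (T \<T> (VP A))" and \<pp>: "\<pp> \<in> T \<T> (VP A)" and x: "x \<in> fst A"
  shows "Txi \<T> (T \<T> (VP A)) (VP A) (snd (VO A)) \<PP> \<pp> * lift A (VP A) (dec A) \<pp> x
    \<le> lift A (VP A) (dec A) (Tm \<T> (VP A) \<PP>) x"
proof -
  let ?P = "VP A" and ?c = "snd (VO A)"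
  note X = tcat_small[OF A]
  note P = small_Vpow[OF X]
  have "Txi \<T> (T \<T> ?P) ?P ?c \<PP> \<pp> * lift A ?P (dec A) \<pp> x
      \<le> vcomp (T \<T> ?P) (lift A ?P (dec A)) (Txi \<T> (T \<T> ?P) ?P ?c) \<PP> x"
    using \<pp> by (rule vcomp_upper)
  also have "\<dots> = lift A (T \<T> ?P) (vcomp ?P (dec A) ?c) \<PP> x"
    using X P by (simp add: lift_vcomp)
  also have "\<dots> \<le> lift A (T \<T> ?P) (lift A ?P (dec A)) \<PP> x"
    using X P by (intro lift_mono_on) (auto simp: vcomp_le_iff intro: Vobj_apply)
  also have "\<dots> \<le> lift A ?P (dec A) (Tm \<T> ?P \<PP>) x"
    using A P \<PP> by (rule lift_lift_le)
  finally show ?thesis .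
qed

lemma Vobj_tcat:
  assumes A: "is_tcat \<T> A"
  shows "is_tcat \<T> (VO A)"
proof -
  let ?X = "fst A" and ?P = "VP A" and ?c = "snd (VO A)"
  note X = tcat_small[OF A]
  note P = small_Vpow[OF X]
  have "is_tcat \<T> (?P, ?c)"
  proof (rule is_tcatI[OF P])
    show "?c \<in> vrel (T \<T> ?P) ?P" by (auto simp: Vobj_def vrel_def)
    show "1 \<le> ?c (Te \<T> ?P c) c" if c: "c \<in> ?P" for c
      unfolding le_Vobj_iff[OF X Te_mem[OF P c] c]
      using lift_Te_ge[OF A P c] by simp
    fix \<PP> \<pp> c assume \<PP>: "\<PP> \<in> T \<T> (T \<T> ?P)" and \<pp>: "\<pp> \<in> T \<T> ?P" and c: "c \<in> ?P"
    show "Txi \<T> (T \<T> ?P) ?P ?c \<PP> \<pp> * ?c \<pp> c \<le> ?c (Tm \<T> ?P \<PP>) c"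
      unfolding le_Vobj_iff[OF X Tm_mem[OF P \<PP>] c]
    proof
      fix x assume x: "x \<in> ?X"
      have "Txi \<T> (T \<T> ?P) ?P ?c \<PP> \<pp> * (?c \<pp> c * dec A c x)
          \<le> Txi \<T> (T \<T> ?P) ?P ?c \<PP> \<pp> * lift A ?P (dec A) \<pp> x"
        using X \<pp> c x by (intro quantale_mult_mono Vobj_apply) auto
      also have "\<dots> \<le> lift A ?P (dec A) (Tm \<T> ?P \<PP>) x"
        using A \<PP> \<pp> x by (rule Txi_Vobj_lift)
      finally show "Txi \<T> (T \<T> ?P) ?P ?c \<PP> \<pp> * ?c \<pp> c * dec A c x \<le> lift A ?P (dec A) (Tm \<T> ?P \<PP>) x"
        by (simp add: mult.assoc)
    qed
  qed
  then show ?thesis by (metis fst_Vobj prod.collapse)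
qed

text \<open>At \<open>e c\<close> the relation \<open>\<mu>\<close> is \<open>c\<close> itself, since \<open>c\<close> is closed. Note the direction: \<open>c \<le> d\<close> in the
  power object means that \<open>d\<close> is pointwise below \<open>c\<close>.\<close>

lemma le_under_Vobj_iff:
  assumes A: "is_tcat \<T> A" and "c \<in> VP A" "d \<in> VP A"
  shows "u \<le> under \<T> (VO A) c d \<longleftrightarrow> (\<forall>x\<in>fst A. u * dec A d x \<le> dec A c x)"
proof -
  note X = tcat_small[OF A]
  note P = small_Vpow[OF X]
  have "under \<T> (VO A) c d = snd (VO A) (Te \<T> (VP A) c) d"
    using assms P by (simp add: under_eq)
  then show ?thesis
    using assms X P by (simp add: le_Vobj_iff lift_Te_vfunctor vdecode_vfunctor)
qed

text \<open>Composed with \<open>Tf\<close>, the relation \<open>\<mu>\<close> becomes the lift of \<open>ev \<cdot> f\<close>, so that the condition no longer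
  mentions elements of \<open>T(VA)\<close>.\<close>

lemma tfunctor_Vobj_iff:
  assumes A: "is_tcat \<T> A" and B: "is_tcat \<T> B" and f: "f \<in> fst B \<rightarrow>\<^sub>E VP A"
  shows "f \<in> tfunctors \<T> B (VO A) \<longleftrightarrow> (\<forall>\<yy>\<in>T \<T> (fst B). \<forall>y\<in>fst B. \<forall>x\<in>fst A.
      snd B \<yy> y * dec A (f y) x \<le> lift A (fst B) (\<lambda>y. dec A (f y)) \<yy> x)"
proof -
  note X = tcat_small[OF A] and Y = tcat_small[OF B]
  note P = small_Vpow[OF X]
  have f': "f \<in> fst B \<rightarrow> VP A" using f by auto
  then have "tm (fst B) (VP A) f \<yy> \<in> T \<T> (VP A)" if "\<yy> \<in> T \<T> (fst B)" for \<yy>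
    using that Y P by (intro tm_mem)
  with X Y P f f' show ?thesis
    by (auto simp: tfunctors_iff le_Vobj_iff lift_reindex Pi_iff simp del: restrict_apply)
qed

lemma Vpow_eqI_vfunctor:
  assumes A: "is_tcat \<T> A" and c: "c \<in> VP A" and d: "d \<in> VP A"
    and "\<And>\<psi>. vfunctor A \<psi> \<Longrightarrow> (\<forall>x\<in>fst A. dec A c x \<le> \<psi> x) \<longleftrightarrow> (\<forall>x\<in>fst A. dec A d x \<le> \<psi> x)"
  shows "c = d"
proof (rule Vpow_eqI[OF tcat_small[OF A] c d])
  have "vfunctor A (dec A c)" "vfunctor A (dec A d)"
    using A c d by (simp_all add: vdecode_vfunctor tcat_small)
  with assms(4)[of "dec A c"] assms(4)[of "dec A d"] show "dec A c x = dec A d x" if "x \<in> fst A" for x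
    using that by (intro antisym) auto
qed

section \<open>Functoriality\<close>

text \<open>The second formula presents \<open>Vf c\<close> as a row of a lift of \<open>f \<cdot> ev\<close>. It shows that \<open>Vf c\<close> is a
  functor into the quantale, and it is the form that can be lifted further.\<close>

lemma dec_Vfun_eq_lift:
  assumes A: "is_tcat \<T> A" and B: "is_tcat \<T> B" and f: "f \<in> tfunctors \<T> A B" and c: "c \<in> VP A"
  shows "Vfun \<T> A B f c \<in> VP B"
    and "y \<in> fst B \<Longrightarrow> dec B (Vfun \<T> A B f c) y
      = lift B (VP A) (vcomp (fst A) (vgraph (fst A) f) (dec A)) (Te \<T> (VP A) c) y"
    and "y \<in> fst B \<Longrightarrow> dec B (Vfun \<T> A B f c) y
      = (SUP \<xx>\<in>T \<T> (fst A). xiT \<T> (fst A) (dec A c) \<xx> * snd B (tm (fst A) (fst B) f \<xx>) y)"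
proof -
  let ?X = "fst A" and ?Y = "fst B"
  let ?\<phi> = "\<lambda>y. SUP \<xx>\<in>T \<T> ?X. xiT \<T> ?X (dec A c) \<xx> * snd B (tm ?X ?Y f \<xx>) y"
  let ?l = "lift B (VP A) (vcomp ?X (vgraph ?X f) (dec A)) (Te \<T> (VP A) c)"
  note X = tcat_small[OF A] and Y = tcat_small[OF B]
  note P = small_Vpow[OF X]
  have f': "f \<in> ?X \<rightarrow> ?Y" using f tfunctors_mem by auto
  have fE: "restrict f ?X = f" using tfunctors_in[OF f] by simp
  have l: "?\<phi> = ?l"
    by (intro ext) (simp add: lift_postcompose[OF X Y f' P] Txi_row[OF P X c] cong: SUP_cong)
  have "vfunctor B ?l" using B P c by (intro vfunctor_lift) auto
  then have "vfunctor B ?\<phi>" by (simp add: l)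
  moreover have V: "Vfun \<T> A B f c = enc B ?\<phi>"
    using c fE by (cases A; cases B) (simp add: Vfun_def)
  ultimately show "Vfun \<T> A B f c \<in> VP B" using vencode_in_Vpow[OF Y] by simp
  show dec: "dec B (Vfun \<T> A B f c) y = ?\<phi> y" if "y \<in> ?Y"
    unfolding V using Y that by (rule vdecode_vencode)
  show "dec B (Vfun \<T> A B f c) y = ?l y" if "y \<in> ?Y"
    using dec[OF that] fun_cong[OF l, of y] by simp
qed

text \<open>From left to right because \<open>Vf c\<close> lies above the direct image of \<open>c\<close>; from right to left because
  \<open>\<psi>\<close> is closed. Scalars may be moved inside the extension as \<open>T1 = 1\<close> makes \<open>\<xi> \<cdot> Tu = u\<close> for
  constants \<open>u\<close>.\<close>

lemma Vfun_adjunction: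
  assumes A: "is_tcat \<T> A" and B: "is_tcat \<T> B" and f: "f \<in> tfunctors \<T> A B" and c: "c \<in> VP A"
    and \<psi>: "vfunctor B \<psi>"
  shows "(\<forall>y\<in>fst B. u * dec B (Vfun \<T> A B f c) y \<le> \<psi> y) \<longleftrightarrow> (\<forall>x\<in>fst A. u * dec A c x \<le> \<psi> (f x))"
proof
  let ?X = "fst A" and ?Y = "fst B"
  note X = tcat_small[OF A] and Y = tcat_small[OF B]
  note P = small_Vpow[OF X]
  note V = dec_Vfun_eq_lift[OF A B f c]
  have f': "f \<in> ?X \<rightarrow> ?Y" using f tfunctors_mem by auto
  {
    assume *: "\<forall>y\<in>?Y. u * dec B (Vfun \<T> A B f c) y \<le> \<psi> y"
    show "\<forall>x\<in>?X. u * dec A c x \<le> \<psi> (f x)"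
    proof
      fix x assume x: "x \<in> ?X"
      have fx: "f x \<in> ?Y" using f' x by auto
      have "dec A c x \<le> vcomp ?X (vgraph ?X f) (dec A) c (f x)" using x by (rule vgraph_vcomp)
      also have "\<dots> \<le> dec B (Vfun \<T> A B f c) (f x)"
        unfolding V(2)[OF fx] using B P c fx by (intro lift_Te_ge)
      finally have "u * dec A c x \<le> u * dec B (Vfun \<T> A B f c) (f x)"
        by (intro quantale_mult_mono) auto
      also have "\<dots> \<le> \<psi> (f x)" using * fx by blast
      finally show "u * dec A c x \<le> \<psi> (f x)" .
    qed
  }
  assume *: "\<forall>x\<in>?X. u * dec A c x \<le> \<psi> (f x)"
  show "\<forall>y\<in>?Y. u * dec B (Vfun \<T> A B f c) y \<le> \<psi> y"
  proof
    fix y assume y: "y \<in> ?Y"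
    show "u * dec B (Vfun \<T> A B f c) y \<le> \<psi> y"
      unfolding V(3)[OF y] quantale_mult_SUP
    proof (rule SUP_least)
      fix \<xx> assume \<xx>: "\<xx> \<in> T \<T> ?X"
      have "u * xiT \<T> ?X (dec A c) \<xx> = xiT \<T> ?X (\<lambda>x. u * dec A c x) \<xx>"
        using X \<xx> by (simp add: xiT_mult xiT_const)
      also have "\<dots> \<le> xiT \<T> ?X (\<lambda>x. \<psi> (f x)) \<xx>"
        using X \<xx> * by (intro xiT_mono) auto
      also have "\<dots> = xiT \<T> ?Y \<psi> (tm ?X ?Y f \<xx>)"
        using X Y f' \<xx> by (simp add: xiT_reindex)
      finally have "u * xiT \<T> ?X (dec A c) \<xx> * snd B (tm ?X ?Y f \<xx>) y
          \<le> xiT \<T> ?Y \<psi> (tm ?X ?Y f \<xx>) * snd B (tm ?X ?Y f \<xx>) y"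
        by (intro quantale_mult_mono) auto
      also have "\<dots> \<le> \<psi> y" using X Y f' \<xx> y \<psi> by (intro vfunctorD tm_mem)
      finally show "u * (xiT \<T> ?X (dec A c) \<xx> * snd B (tm ?X ?Y f \<xx>) y) \<le> \<psi> y"
        by (simp add: mult.assoc)
    qed
  qed
qed

lemmas Vfun_mem = dec_Vfun_eq_lift(1)

lemma Vfun_adjunction_le:
  assumes A: "is_tcat \<T> A" and B: "is_tcat \<T> B" and f: "f \<in> tfunctors \<T> A B" and c: "c \<in> VP A"
    and \<psi>: "vfunctor B \<psi>"
  shows "(\<forall>y\<in>fst B. dec B (Vfun \<T> A B f c) y \<le> \<psi> y) \<longleftrightarrow> (\<forall>x\<in>fst A. dec A c x \<le> \<psi> (f x))"
  using Vfun_adjunction[OF assms, of 1] by simp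

lemma Vfun_unit_ge:
  assumes A: "is_tcat \<T> A" and B: "is_tcat \<T> B" and f: "f \<in> tfunctors \<T> A B" and c: "c \<in> VP A" and x: "x \<in> fst A"
  shows "dec A c x \<le> dec B (Vfun \<T> A B f c) (f x)"
  using Vfun_adjunction_le[OF A B f c, of "dec B (Vfun \<T> A B f c)"] x
    vdecode_vfunctor[OF tcat_small[OF B] Vfun_mem[OF A B f c]] by blast

lemma Vfun_in: 
  assumes A: "is_tcat \<T> A" and B: "is_tcat \<T> B" and f: "f \<in> tfunctors \<T> A B"
  shows "Vfun \<T> A B f \<in> VP A \<rightarrow>\<^sub>E VP B"
proof -
  have "Vfun \<T> A B f \<in> extensional (VP A)" by (cases A; cases B) (simp add: Vfun_def)
  then show ?thesis using Vfun_mem[OF assms] by (auto simp: PiE_def)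
qed

text \<open>By the adjunction the condition can be tested before applying \<open>Vf\<close>, where it reads
  \<open>f \<cdot> a \<cdot> T\<^sub>\<xi> ev \<le> b \<cdot> T\<^sub>\<xi> (f \<cdot> ev) \<le> b \<cdot> T\<^sub>\<xi> (ev \<cdot> Vf)\<close> after bounding the structure of \<open>VA\<close>.\<close>

lemma Vfun_tfunctor:
  assumes A: "is_tcat \<T> A" and B: "is_tcat \<T> B" and f: "f \<in> tfunctors \<T> A B"
  shows "Vfun \<T> A B f \<in> tfunctors \<T> (VO A) (VO B)"
proof -
  let ?V = "Vfun \<T> A B f"
  note X = tcat_small[OF A] and Y = tcat_small[OF B]
  note P = small_Vpow[OF X]
  show ?thesis
    unfolding tfunctor_Vobj_iff[OF B Vobj_tcat[OF A] Vfun_in[OF A B f, folded fst_Vobj[of A]], unfolded fst_Vobj]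
  proof (intro ballI)
    fix \<pp> c y assume \<pp>: "\<pp> \<in> T \<T> (VP A)" and c: "c \<in> VP A" and y: "y \<in> fst B"
    let ?\<psi> = "lift B (VP A) (\<lambda>c. dec B (?V c)) \<pp>"
    have "\<forall>x\<in>fst A. snd (VO A) \<pp> c * dec A c x \<le> ?\<psi> (f x)"
    proof
      fix x assume x: "x \<in> fst A"
      then have fx: "f x \<in> fst B" using f tfunctors_mem by auto
      have "snd (VO A) \<pp> c * dec A c x \<le> lift A (VP A) (dec A) \<pp> x"
        using X \<pp> c x by (rule Vobj_apply)
      also have "\<dots> \<le> lift B (VP A) (vcomp (fst A) (vgraph (fst A) f) (dec A)) \<pp> (f x)"
        using A B f P x by (rule lift_tfunctor)
      also have "\<dots> \<le> ?\<psi> (f x)"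
      proof (rule lift_mono_on[OF Y P])
        fix c y assume c: "c \<in> VP A" and y: "y \<in> fst B"
        show "vcomp (fst A) (vgraph (fst A) f) (dec A) c y \<le> dec B (?V c) y"
          unfolding vcomp_le_iff vgraph_def using Vfun_unit_ge[OF A B f c] by auto
      qed
      finally show "snd (VO A) \<pp> c * dec A c x \<le> ?\<psi> (f x)" .
    qed
    then show "snd (VO A) \<pp> c * dec B (?V c) y \<le> ?\<psi> y"
      using Vfun_adjunction[OF A B f c vfunctor_lift[OF B P \<pp>]] y by blast
  qed
qed

lemma Vfun_ident:
  assumes A: "is_tcat \<T> A"
  shows "Vfun \<T> A A (restrict id (fst A)) = restrict id (VP A)"
proof (rule PiE_ext)
  note i = tfunctors_ident[OF A]
  show "Vfun \<T> A A (restrict id (fst A)) \<in> VP A \<rightarrow>\<^sub>E VP A" using Vfun_in[OF A A i] .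
  fix c assume c: "c \<in> VP A"
  have "Vfun \<T> A A (restrict id (fst A)) c = c"
    using A Vfun_mem[OF A A i c] c
    by (rule Vpow_eqI_vfunctor) (simp add: Vfun_adjunction_le[OF A A i c])
  then show "Vfun \<T> A A (restrict id (fst A)) c = restrict id (VP A) c" using c by simp
qed simp

text \<open>Both sides are left adjoint to precomposition with \<open>g \<cdot> f\<close>.\<close>

lemma Vfun_compose:
  assumes A: "is_tcat \<T> A" and B: "is_tcat \<T> B" and D: "is_tcat \<T> D"
    and f: "f \<in> tfunctors \<T> A B" and g: "g \<in> tfunctors \<T> B D"
  shows "Vfun \<T> A D (compose (fst A) g f) = compose (VP A) (Vfun \<T> B D g) (Vfun \<T> A B f)"
proof (rule PiE_ext)
  note gf = tfunctors_compose[OF A B D f g]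
  show "Vfun \<T> A D (compose (fst A) g f) \<in> VP A \<rightarrow>\<^sub>E VP D" using Vfun_in[OF A D gf] .
  show "compose (VP A) (Vfun \<T> B D g) (Vfun \<T> A B f) \<in> VP A \<rightarrow>\<^sub>E VP D"
    using Vfun_mem[OF A B f] Vfun_mem[OF B D g] by (auto simp: compose_def)
  fix c assume c: "c \<in> VP A"
  note fc = Vfun_mem[OF A B f c]
  have "Vfun \<T> A D (compose (fst A) g f) c = Vfun \<T> B D g (Vfun \<T> A B f c)"
  proof (rule Vpow_eqI_vfunctor[OF D Vfun_mem[OF A D gf c] Vfun_mem[OF B D g fc]])
    fix \<psi> assume \<psi>: "vfunctor D \<psi>"
    have \<psi>g: "vfunctor B (\<lambda>y. \<psi> (g y))" using vfunctor_comp[OF tcat_small[OF B] tcat_small[OF D] g \<psi>] .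
    show "(\<forall>x\<in>fst D. dec D (Vfun \<T> A D (compose (fst A) g f) c) x \<le> \<psi> x) \<longleftrightarrow>
        (\<forall>x\<in>fst D. dec D (Vfun \<T> B D g (Vfun \<T> A B f c)) x \<le> \<psi> x)"
      unfolding Vfun_adjunction_le[OF A D gf c \<psi>] Vfun_adjunction_le[OF B D g fc \<psi>]
        Vfun_adjunction_le[OF A B f c \<psi>g]
      by (simp add: compose_def)
  qed
  then show "Vfun \<T> A D (compose (fst A) g f) c = compose (VP A) (Vfun \<T> B D g) (Vfun \<T> A B f) c"
    using c by (simp add: compose_def)
qed

section \<open>The unit and the multiplication\<close>

lemma Vunit_mem: "is_tcat \<T> A \<Longrightarrow> x \<in> fst A \<Longrightarrow> Vunit \<T> A x \<in> VP A"
  by (simp add: Vunit_def vencode_in_Vpow tcat_small vfunctor_under_row)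

lemma dec_Vunit: "is_tcat \<T> A \<Longrightarrow> x \<in> fst A \<Longrightarrow> z \<in> fst A \<Longrightarrow> dec A (Vunit \<T> A x) z = under \<T> A x z"
  by (simp add: Vunit_def vdecode_vencode tcat_small)

lemma Vunit_in: "is_tcat \<T> A \<Longrightarrow> Vunit \<T> A \<in> fst A \<rightarrow>\<^sub>E VP A"
  using Vunit_mem by (auto simp: PiE_def) (simp add: Vunit_def)

text \<open>The Yoneda lemma: the left-hand side is the hom from the representable \<open>\<h> x\<close> to \<open>c\<close>.\<close>

lemma under_Vobj_Vunit:
  assumes A: "is_tcat \<T> A" and c: "c \<in> VP A" and x: "x \<in> fst A"
  shows "under \<T> (VO A) c (Vunit \<T> A x) = dec A c x"
proof -
  have "u \<le> under \<T> (VO A) c (Vunit \<T> A x) \<longleftrightarrow> u \<le> dec A c x" for u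
    unfolding le_under_Vobj_iff[OF A c Vunit_mem[OF A x]]
    using Yoneda[OF A vdecode_vfunctor[OF tcat_small[OF A] c] x, of u]
    by (simp add: dec_Vunit[OF A x])
  then show ?thesis by (rule eq_if_same_lower_bounds)
qed

text \<open>Again the Yoneda lemma, now for the row of \<open>\<mu>\<close> at \<open>\<pp>\<close>.\<close>

lemma Vobj_Vunit:
  assumes A: "is_tcat \<T> A" and \<pp>: "\<pp> \<in> T \<T> (VP A)" and x: "x \<in> fst A"
  shows "snd (VO A) \<pp> (Vunit \<T> A x) = lift A (VP A) (dec A) \<pp> x"
proof -
  note X = tcat_small[OF A]
  have "u \<le> snd (VO A) \<pp> (Vunit \<T> A x) \<longleftrightarrow> u \<le> lift A (VP A) (dec A) \<pp> x" for u
    unfolding le_Vobj_iff[OF X \<pp> Vunit_mem[OF A x]]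
    using Yoneda[OF A vfunctor_lift[OF A small_Vpow[OF X] \<pp>] x, of u]
    by (simp add: dec_Vunit[OF A x])
  then show ?thesis by (rule eq_if_same_lower_bounds)
qed

text \<open>The relation \<open>a\<^sub>0\<close> is \<open>a \<cdot> e\<close>, so its lift is \<open>a \<cdot> T\<^sub>\<xi> a \<cdot> Te \<le> a \<cdot> m \<cdot> Te = a\<close>.\<close>

lemma lift_under:
  assumes A: "is_tcat \<T> A" and \<xx>: "\<xx> \<in> T \<T> (fst A)"
  shows "lift A (fst A) (under \<T> A) \<xx> z \<le> snd A \<xx> z"
proof -
  let ?X = "fst A"
  note X = tcat_small[OF A]
  have e: "Te \<T> ?X \<in> ?X \<rightarrow> T \<T> ?X" using Te_in[OF X] by auto
  have Te: "tm ?X (T \<T> ?X) (Te \<T> ?X) \<xx> \<in> T \<T> (T \<T> ?X)" using X e \<xx> by (intro tm_mem) auto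
  have "lift A ?X (under \<T> A) \<xx> z \<le> lift A ?X (\<lambda>x. snd A (Te \<T> ?X x)) \<xx> z"
    using X by (intro lift_mono_on) (simp_all add: under_eq)
  also have "\<dots> = lift A (T \<T> ?X) (snd A) (tm ?X (T \<T> ?X) (Te \<T> ?X) \<xx>) z"
    using X e \<xx> by (intro lift_reindex) simp_all
  also have "\<dots> \<le> snd A (Tm \<T> ?X (tm ?X (T \<T> ?X) (Te \<T> ?X) \<xx>)) z"
    unfolding lift_def vcomp_le_iff using tcat_trans[OF A Te] by blast
  also have "Tm \<T> ?X (tm ?X (T \<T> ?X) (Te \<T> ?X) \<xx>) = \<xx>"
    using Tm_TTe[OF X \<xx>] Te_in[OF X] by simp
  finally show ?thesis .
qed

lemma lift_Vunit:
  assumes A: "is_tcat \<T> A" and \<xx>: "\<xx> \<in> T \<T> (fst A)"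
  shows "lift A (fst A) (\<lambda>x. dec A (Vunit \<T> A x)) \<xx> z = lift A (fst A) (under \<T> A) \<xx> z"
  using tcat_small[OF A] by (intro antisym lift_mono_on) (simp_all add: dec_Vunit[OF A])

text \<open>The lift of \<open>a\<^sub>0\<close> is at least \<open>a\<close>, as \<open>a\<^sub>0\<close> is reflexive, and \<open>a\<^sub>0 \<cdot> a \<le> a\<close>.\<close>

lemma Vunit_tfunctor:
  assumes A: "is_tcat \<T> A"
  shows "Vunit \<T> A \<in> tfunctors \<T> A (VO A)"
  unfolding tfunctor_Vobj_iff[OF A A Vunit_in[OF A]]
proof (intro ballI)
  let ?X = "fst A"
  fix \<xx> x z assume \<xx>: "\<xx> \<in> T \<T> ?X" and x: "x \<in> ?X" and z: "z \<in> ?X"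
  note X = tcat_small[OF A]
  have "snd A \<xx> x * under \<T> A x z \<le> 1 * snd A \<xx> z"
    using tcat_trans_under[OF A \<xx> x] X x by (simp add: under_eq)
  also have "\<dots> \<le> Txi \<T> ?X ?X (under \<T> A) \<xx> (tm ?X ?X (\<lambda>x. x) \<xx>) * snd A \<xx> z"
    using X \<xx> under_refl[OF A] by (intro quantale_mult_mono Txi_ge_one) auto
  also have "\<dots> = Txi \<T> ?X ?X (under \<T> A) \<xx> \<xx> * snd A \<xx> z"
    unfolding tm_id[OF X \<xx>] ..
  also have "\<dots> \<le> lift A ?X (under \<T> A) \<xx> z"
    unfolding lift_def using \<xx> by (rule vcomp_upper)
  finally show "snd A \<xx> x * dec A (Vunit \<T> A x) z \<le> lift A ?X (\<lambda>x. dec A (Vunit \<T> A x)) \<xx> z"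
    unfolding lift_Vunit[OF A \<xx>] dec_Vunit[OF A x z] .
qed

lemma Vmult_mem_dec:
  assumes A: "is_tcat \<T> A" and C: "C \<in> VP (VO A)"
  shows "Vmult \<T> A C \<in> VP A"
    and "x \<in> fst A \<Longrightarrow> dec A (Vmult \<T> A C) x = dec (VO A) C (Vunit \<T> A x)"
proof -
  note X = tcat_small[OF A]
  note VA = Vobj_tcat[OF A]
  have "vfunctor A (\<lambda>x. dec (VO A) C (Vunit \<T> A x))"
    using vfunctor_comp[OF X tcat_small[OF VA] Vunit_tfunctor[OF A] vdecode_vfunctor[OF tcat_small[OF VA] C]] .
  then show "Vmult \<T> A C \<in> VP A"
    using C X by (simp add: Vmult_def vencode_in_Vpow)
  show "dec A (Vmult \<T> A C) x = dec (VO A) C (Vunit \<T> A x)" if "x \<in> fst A"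
    using C X that by (simp add: Vmult_def vdecode_vencode)
qed

lemmas Vmult_mem = Vmult_mem_dec(1)
lemmas dec_Vmult = Vmult_mem_dec(2)

lemma Vmult_in: "is_tcat \<T> A \<Longrightarrow> Vmult \<T> A \<in> VP (VO A) \<rightarrow>\<^sub>E VP A"
  using Vmult_mem by (auto simp: PiE_def) (simp add: Vmult_def)

text \<open>\<open>C\<close> is monotone on \<open>VA\<close>, and \<open>c x\<close> is by Yoneda the degree to which \<open>c\<close> lies below \<open>\<h> x\<close> there.\<close>

lemma Vmult_ge:
  assumes A: "is_tcat \<T> A" and C: "C \<in> VP (VO A)" and c: "c \<in> VP A" and x: "x \<in> fst A"
  shows "dec (VO A) C c * dec A c x \<le> dec A (Vmult \<T> A C) x"
proof -
  have VA: "small (fst (VO A))" using A Vobj_tcat tcat_small by blast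
  show ?thesis
    using vfunctor_under[OF VA vdecode_vfunctor[OF VA C], of c "Vunit \<T> A x"] c x Vunit_mem[OF A x]
    by (simp add: under_Vobj_Vunit[OF A c x] dec_Vmult[OF A C x])
qed

text \<open>Both sides say that \<open>u * C c * c x \<le> d x\<close> for all \<open>c\<close> and \<open>x\<close>: the left-hand side because \<open>\<w> C\<close> at \<open>x\<close>
  is the supremum of \<open>C c * c x\<close> over all \<open>c\<close>, attained at \<open>c = \<h> x\<close>. Note that the map \<open>c \<mapsto> [c, d]\<close> on the right is
  the unit of \<open>VA\<close> at \<open>d\<close>.\<close>

lemma Vmult_adjunction:
  assumes A: "is_tcat \<T> A" and C: "C \<in> VP (VO A)" and d: "d \<in> VP A"
  shows "(\<forall>x\<in>fst A. u * dec A (Vmult \<T> A C) x \<le> dec A d x)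
    \<longleftrightarrow> (\<forall>c\<in>VP A. u * dec (VO A) C c \<le> under \<T> (VO A) d c)"
proof
  assume *: "\<forall>x\<in>fst A. u * dec A (Vmult \<T> A C) x \<le> dec A d x"
  show "\<forall>c\<in>VP A. u * dec (VO A) C c \<le> under \<T> (VO A) d c"
  proof
    fix c assume c: "c \<in> VP A"
    show "u * dec (VO A) C c \<le> under \<T> (VO A) d c"
      unfolding le_under_Vobj_iff[OF A d c]
    proof
      fix x assume x: "x \<in> fst A"
      have "u * (dec (VO A) C c * dec A c x) \<le> u * dec A (Vmult \<T> A C) x"
        using Vmult_ge[OF A C c x] by (rule quantale_mult_mono[OF order_refl])
      also have "\<dots> \<le> dec A d x" using * x by blast
      finally show "u * dec (VO A) C c * dec A c x \<le> dec A d x" by (simp add: mult.assoc)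
    qed
  qed
next
  assume *: "\<forall>c\<in>VP A. u * dec (VO A) C c \<le> under \<T> (VO A) d c"
  show "\<forall>x\<in>fst A. u * dec A (Vmult \<T> A C) x \<le> dec A d x"
  proof
    fix x assume x: "x \<in> fst A"
    have "u * dec A (Vmult \<T> A C) x \<le> under \<T> (VO A) d (Vunit \<T> A x)"
      using * Vunit_mem[OF A x] by (simp add: dec_Vmult[OF A C x])
    then show "u * dec A (Vmult \<T> A C) x \<le> dec A d x"
      by (simp add: under_Vobj_Vunit[OF A d x])
  qed
qed

lemma Vmult_adjunction_le:
  assumes A: "is_tcat \<T> A" and C: "C \<in> VP (VO A)" and d: "d \<in> VP A"
  shows "(\<forall>x\<in>fst A. dec A (Vmult \<T> A C) x \<le> dec A d x)
    \<longleftrightarrow> (\<forall>c\<in>VP A. dec (VO A) C c \<le> under \<T> (VO A) d c)"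
  using Vmult_adjunction[OF assms, of 1] by simp

text \<open>As relations \<open>ev \<cdot> ev = ev \<cdot> \<w>\<close>: the supremum of \<open>C c * c x\<close> over all \<open>c\<close> is attained at \<open>\<h> x\<close>.
  Moreover \<open>\<mu>\<close> arises from the structure of \<open>VA\<close> by restriction along \<open>\<h>\<close>. With \<open>c\<close> for this structure,
  \<open>\<h>\<degree> \<cdot> c \<cdot> T\<^sub>\<xi> ev = \<mu> \<cdot> T\<^sub>\<xi> ev = a \<cdot> T\<^sub>\<xi> (ev \<cdot> ev) = a \<cdot> T\<^sub>\<xi> (ev \<cdot> \<w>)\<close>. The equation
  yields both that \<open>\<w>\<close> is a \<open>\<T>\<close>-functor and that it is a pseudo-homomorphism.\<close>

lemma lift_Vobj_Vunit:
  assumes A: "is_tcat \<T> A" and \<PP>: "\<PP> \<in> T \<T> (VP (VO A))" and x: "x \<in> fst A"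
  shows "lift (VO A) (VP (VO A)) (dec (VO A)) \<PP> (Vunit \<T> A x)
    = lift A (VP (VO A)) (\<lambda>C. dec A (Vmult \<T> A C)) \<PP> x"
proof -
  note VA = Vobj_tcat[OF A]
  note X = tcat_small[OF A] and P = small_Vpow[OF tcat_small[OF A]] and PP = small_Vpow[OF tcat_small[OF VA]]
  have le: "vcomp (VP A) (dec A) (dec (VO A)) C x = dec A (Vmult \<T> A C) x" if C: "C \<in> VP (VO A)" and x: "x \<in> fst A" for C x
  proof (rule antisym)
    show "vcomp (VP A) (dec A) (dec (VO A)) C x \<le> dec A (Vmult \<T> A C) x"
      unfolding vcomp_le_iff using Vmult_ge[OF A C _ x] by blast
    have "dec (VO A) C (Vunit \<T> A x) * 1 \<le> dec (VO A) C (Vunit \<T> A x) * dec A (Vunit \<T> A x) x"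
      using under_refl[OF A x] by (intro quantale_mult_mono) (simp_all add: dec_Vunit[OF A x x])
    also have "\<dots> \<le> vcomp (VP A) (dec A) (dec (VO A)) C x"
      using Vunit_mem[OF A x] by (rule vcomp_upper)
    finally show "dec A (Vmult \<T> A C) x \<le> vcomp (VP A) (dec A) (dec (VO A)) C x"
      by (simp add: dec_Vmult[OF A C x])
  qed
  have "lift (VO A) (VP (VO A)) (dec (VO A)) \<PP> (Vunit \<T> A x)
      = vcomp (T \<T> (VP A)) (lift A (VP A) (dec A)) (Txi \<T> (VP (VO A)) (VP A) (dec (VO A))) \<PP> x"
    unfolding lift_def[of "VO A"] vcomp_def[of "T \<T> (fst (VO A))"] vcomp_def[of "T \<T> (VP A)"] fst_Vobj
    by (intro SUP_cong refl) (simp add: Vobj_Vunit[OF A _ x])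
  also have "\<dots> = lift A (VP (VO A)) (vcomp (VP A) (dec A) (dec (VO A))) \<PP> x"
    using X P PP by (simp add: lift_vcomp)
  also have "\<dots> = lift A (VP (VO A)) (\<lambda>C. dec A (Vmult \<T> A C)) \<PP> x"
    using X PP le by (intro antisym lift_mono_on) simp_all
  finally show ?thesis .
qed

lemma Vmult_tfunctor:
  assumes A: "is_tcat \<T> A"
  shows "Vmult \<T> A \<in> tfunctors \<T> (VO (VO A)) (VO A)"
proof -
  note VA = Vobj_tcat[OF A]
  show ?thesis
    unfolding tfunctor_Vobj_iff[OF A Vobj_tcat[OF VA] Vmult_in[OF A, folded fst_Vobj[of "VO A"]], unfolded fst_Vobj]
  proof (intro ballI)
    fix \<PP> C x assume \<PP>: "\<PP> \<in> T \<T> (VP (VO A))" and C: "C \<in> VP (VO A)" and x: "x \<in> fst A"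
    have h: "Vunit \<T> A x \<in> fst (VO A)" using Vunit_mem[OF A x] by simp
    have "snd (VO (VO A)) \<PP> C * dec (VO A) C (Vunit \<T> A x)
        \<le> lift (VO A) (VP (VO A)) (dec (VO A)) \<PP> (Vunit \<T> A x)"
      using tcat_small[OF VA] \<PP> C h by (rule Vobj_apply)
    then show "snd (VO (VO A)) \<PP> C * dec A (Vmult \<T> A C) x \<le> lift A (VP (VO A)) (\<lambda>C. dec A (Vmult \<T> A C)) \<PP> x"
      by (simp only: lift_Vobj_Vunit[OF A \<PP> x] dec_Vmult[OF A C x])
  qed
qed

section \<open>The monad laws\<close>

text \<open>Elements of the power object are functors into the quantale, so it suffices to compare with those.\<close>

lemma Vpow_eqI_le:
  assumes A: "is_tcat \<T> A" and c: "c \<in> VP A" and d: "d \<in> VP A"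
    and "\<And>e. e \<in> VP A \<Longrightarrow> (\<forall>x\<in>fst A. dec A c x \<le> dec A e x) \<longleftrightarrow> (\<forall>x\<in>fst A. dec A d x \<le> dec A e x)"
  shows "c = d"
  using assms(4)[OF c] assms(4)[OF d] by (intro Vpow_eqI[OF tcat_small[OF A] c d] antisym) auto

text \<open>Functors into the quantale above either side are those \<open>\<psi>\<close> with \<open>1 \<le> \<psi> (f x)\<close>.\<close>

lemma Vfun_Vunit:
  assumes A: "is_tcat \<T> A" and B: "is_tcat \<T> B" and f: "f \<in> tfunctors \<T> A B" and x: "x \<in> fst A"
  shows "Vfun \<T> A B f (Vunit \<T> A x) = Vunit \<T> B (f x)"
proof -
  note hx = Vunit_mem[OF A x]
  have fx: "f x \<in> fst B" using f x by (rule tfunctors_mem)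
  show ?thesis
  proof (rule Vpow_eqI_vfunctor[OF B Vfun_mem[OF A B f hx] Vunit_mem[OF B fx]])
    fix \<psi> assume \<psi>: "vfunctor B \<psi>"
    note \<psi>f = vfunctor_comp[OF tcat_small[OF A] tcat_small[OF B] f \<psi>]
    have "(\<forall>y\<in>fst B. dec B (Vfun \<T> A B f (Vunit \<T> A x)) y \<le> \<psi> y) \<longleftrightarrow> 1 \<le> \<psi> (f x)"
      unfolding Vfun_adjunction_le[OF A B f hx \<psi>]
      using Yoneda[OF A \<psi>f x, of 1] by (simp add: dec_Vunit[OF A x])
    also have "\<dots> \<longleftrightarrow> (\<forall>y\<in>fst B. dec B (Vunit \<T> B (f x)) y \<le> \<psi> y)"
      using Yoneda[OF B \<psi> fx, of 1] by (simp add: dec_Vunit[OF B fx])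
    finally show "(\<forall>y\<in>fst B. dec B (Vfun \<T> A B f (Vunit \<T> A x)) y \<le> \<psi> y)
        \<longleftrightarrow> (\<forall>y\<in>fst B. dec B (Vunit \<T> B (f x)) y \<le> \<psi> y)" .
  qed
qed

lemma Vmult_Vunit:
  assumes A: "is_tcat \<T> A" and c: "c \<in> VP A"
  shows "Vmult \<T> A (Vunit \<T> (VO A) c) = c"
proof -
  note VA = Vobj_tcat[OF A]
  have c': "c \<in> fst (VO A)" using c by simp
  note hc = Vunit_mem[OF VA c']
  show ?thesis
  proof (rule Vpow_eqI[OF tcat_small[OF A] Vmult_mem[OF A hc] c])
    fix x assume x: "x \<in> fst A"
    have hx: "Vunit \<T> A x \<in> fst (VO A)" using Vunit_mem[OF A x] by simp
    show "dec A (Vmult \<T> A (Vunit \<T> (VO A) c)) x = dec A c x"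
      unfolding dec_Vmult[OF A hc x] dec_Vunit[OF VA c' hx] under_Vobj_Vunit[OF A c x] ..
  qed
qed

lemma vfunctor_under_Vobj: "is_tcat \<T> A \<Longrightarrow> e \<in> VP A \<Longrightarrow> vfunctor (VO A) (under \<T> (VO A) e)"
  using vfunctor_under_row[OF Vobj_tcat] by simp

text \<open>The right adjoint of the composite sends \<open>e\<close> to \<open>x \<mapsto> [\<h> x, e]\<close>, which is \<open>e\<close>.\<close>

lemma Vmult_Vfun_Vunit:
  assumes A: "is_tcat \<T> A" and c: "c \<in> VP A"
  shows "Vmult \<T> A (Vfun \<T> A (VO A) (Vunit \<T> A) c) = c"
proof -
  note VA = Vobj_tcat[OF A]
  note h = Vunit_tfunctor[OF A]
  note Vh = Vfun_mem[OF A VA h c]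
  show ?thesis
  proof (rule Vpow_eqI_le[OF A Vmult_mem[OF A Vh] c])
    fix e assume e: "e \<in> VP A"
    have "(\<forall>x\<in>fst A. dec A (Vmult \<T> A (Vfun \<T> A (VO A) (Vunit \<T> A) c)) x \<le> dec A e x)
        \<longleftrightarrow> (\<forall>x\<in>fst A. dec A c x \<le> under \<T> (VO A) e (Vunit \<T> A x))"
      unfolding Vmult_adjunction_le[OF A Vh e]
      using Vfun_adjunction_le[OF A VA h c vfunctor_under_Vobj[OF A e]] by simp
    then show "(\<forall>x\<in>fst A. dec A (Vmult \<T> A (Vfun \<T> A (VO A) (Vunit \<T> A) c)) x \<le> dec A e x)
        \<longleftrightarrow> (\<forall>x\<in>fst A. dec A c x \<le> dec A e x)"
      by (simp add: under_Vobj_Vunit[OF A e])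
  qed
qed

text \<open>The right adjoints of the two composites send \<open>e\<close> to \<open>c \<mapsto> [c, e \<cdot> f]\<close> and to \<open>c \<mapsto> [Vf c, e]\<close>, and
  these maps agree by the scaled form of the adjunction for \<open>Vf\<close>.\<close>

lemma Vfun_Vmult:
  assumes A: "is_tcat \<T> A" and B: "is_tcat \<T> B" and f: "f \<in> tfunctors \<T> A B" and C: "C \<in> VP (VO A)"
  shows "Vfun \<T> A B f (Vmult \<T> A C) = Vmult \<T> B (Vfun \<T> (VO A) (VO B) (Vfun \<T> A B f) C)"
proof -
  let ?V = "Vfun \<T> A B f"
  note VA = Vobj_tcat[OF A] and VB = Vobj_tcat[OF B]
  note X = tcat_small[OF A]
  note Vf = Vfun_tfunctor[OF A B f]
  note wC = Vmult_mem[OF A C] and VVC = Vfun_mem[OF VA VB Vf C]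
  show ?thesis
  proof (rule Vpow_eqI_le[OF B Vfun_mem[OF A B f wC] Vmult_mem[OF B VVC]])
    fix e assume e: "e \<in> VP B"
    note ev = vdecode_vfunctor[OF tcat_small[OF B] e]
    \<comment> \<open>The element \<open>e \<cdot> f\<close> of \<open>VA\<close>.\<close>
    define e' where "e' = enc A (\<lambda>x. dec B e (f x))"
    have e': "e' \<in> VP A"
      unfolding e'_def using vencode_in_Vpow[OF X vfunctor_comp[OF X tcat_small[OF B] f ev]] .
    have dec_e': "dec A e' x = dec B e (f x)" if "x \<in> fst A" for x
      unfolding e'_def using X that by (rule vdecode_vencode)
    have under_e': "under \<T> (VO A) e' c = under \<T> (VO B) e (?V c)" if c: "c \<in> VP A" for c
    proof (rule eq_if_same_lower_bounds)
      fix u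
      show "u \<le> under \<T> (VO A) e' c \<longleftrightarrow> u \<le> under \<T> (VO B) e (?V c)"
        unfolding le_under_Vobj_iff[OF A e' c] le_under_Vobj_iff[OF B e Vfun_mem[OF A B f c]]
          Vfun_adjunction[OF A B f c ev]
        by (simp add: dec_e')
    qed
    have "(\<forall>y\<in>fst B. dec B (?V (Vmult \<T> A C)) y \<le> dec B e y)
        \<longleftrightarrow> (\<forall>x\<in>fst A. dec A (Vmult \<T> A C) x \<le> dec A e' x)"
      unfolding Vfun_adjunction_le[OF A B f wC ev] by (simp add: dec_e')
    also have "\<dots> \<longleftrightarrow> (\<forall>c\<in>VP A. dec (VO A) C c \<le> under \<T> (VO B) e (?V c))"
      unfolding Vmult_adjunction_le[OF A C e'] by (simp add: under_e')
    also have "\<dots> \<longleftrightarrow> (\<forall>d\<in>VP B. dec (VO B) (Vfun \<T> (VO A) (VO B) ?V C) d \<le> under \<T> (VO B) e d)"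
      using Vfun_adjunction_le[OF VA VB Vf C vfunctor_under_Vobj[OF B e]] by simp
    also have "\<dots> \<longleftrightarrow> (\<forall>y\<in>fst B. dec B (Vmult \<T> B (Vfun \<T> (VO A) (VO B) ?V C)) y \<le> dec B e y)"
      unfolding Vmult_adjunction_le[OF B VVC e] ..
    finally show "(\<forall>y\<in>fst B. dec B (?V (Vmult \<T> A C)) y \<le> dec B e y)
        \<longleftrightarrow> (\<forall>y\<in>fst B. dec B (Vmult \<T> B (Vfun \<T> (VO A) (VO B) ?V C)) y \<le> dec B e y)" .
  qed
qed

text \<open>The right adjoints of the two composites send \<open>e\<close> to \<open>C \<mapsto> [C, \<h> e]\<close> and to \<open>C \<mapsto> [\<w> C, e]\<close>, and
  these maps agree by the scaled form of the adjunction for \<open>\<w>\<close>.\<close>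

lemma Vmult_assoc:
  assumes A: "is_tcat \<T> A" and \<Theta>: "\<Theta> \<in> VP (VO (VO A))"
  shows "Vmult \<T> A (Vmult \<T> (VO A) \<Theta>) = Vmult \<T> A (Vfun \<T> (VO (VO A)) (VO A) (Vmult \<T> A) \<Theta>)"
proof -
  note VA = Vobj_tcat[OF A]
  note VVA = Vobj_tcat[OF VA]
  note w = Vmult_tfunctor[OF A]
  note w\<Theta> = Vmult_mem[OF VA \<Theta>] and Vw\<Theta> = Vfun_mem[OF VVA VA w \<Theta>]
  show ?thesis
  proof (rule Vpow_eqI_le[OF A Vmult_mem[OF A w\<Theta>] Vmult_mem[OF A Vw\<Theta>]])
    fix e assume e: "e \<in> VP A"
    then have e': "e \<in> fst (VO A)" by simp
    define E where "E = Vunit \<T> (VO A) e"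
    have E: "E \<in> VP (VO A)" unfolding E_def using VA e' by (rule Vunit_mem)
    have dec_E: "dec (VO A) E c = under \<T> (VO A) e c" if "c \<in> VP A" for c
      unfolding E_def using dec_Vunit[OF VA e'] that by simp
    have under_E: "under \<T> (VO (VO A)) E C = under \<T> (VO A) e (Vmult \<T> A C)" if C: "C \<in> VP (VO A)" for C
    proof (rule eq_if_same_lower_bounds)
      fix u
      have "u \<le> under \<T> (VO (VO A)) E C \<longleftrightarrow> (\<forall>c\<in>VP A. u * dec (VO A) C c \<le> under \<T> (VO A) e c)"
        unfolding le_under_Vobj_iff[OF VA E C] using dec_E by simp
      then show "u \<le> under \<T> (VO (VO A)) E C \<longleftrightarrow> u \<le> under \<T> (VO A) e (Vmult \<T> A C)"
        unfolding le_under_Vobj_iff[OF A e Vmult_mem[OF A C]] Vmult_adjunction[OF A C e] .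
    qed
    have "(\<forall>x\<in>fst A. dec A (Vmult \<T> A (Vmult \<T> (VO A) \<Theta>)) x \<le> dec A e x)
        \<longleftrightarrow> (\<forall>c\<in>fst (VO A). dec (VO A) (Vmult \<T> (VO A) \<Theta>) c \<le> dec (VO A) E c)"
      unfolding Vmult_adjunction_le[OF A w\<Theta> e] using dec_E by simp
    also have "\<dots> \<longleftrightarrow> (\<forall>C\<in>VP (VO A). dec (VO (VO A)) \<Theta> C \<le> under \<T> (VO A) e (Vmult \<T> A C))"
      unfolding Vmult_adjunction_le[OF VA \<Theta> E] by (simp add: under_E)
    also have "\<dots> \<longleftrightarrow> (\<forall>c\<in>VP A. dec (VO A) (Vfun \<T> (VO (VO A)) (VO A) (Vmult \<T> A) \<Theta>) c \<le> under \<T> (VO A) e c)"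
      using Vfun_adjunction_le[OF VVA VA w \<Theta> vfunctor_under_Vobj[OF A e]] by simp
    also have "\<dots> \<longleftrightarrow> (\<forall>x\<in>fst A. dec A (Vmult \<T> A (Vfun \<T> (VO (VO A)) (VO A) (Vmult \<T> A) \<Theta>)) x \<le> dec A e x)"
      unfolding Vmult_adjunction_le[OF A Vw\<Theta> e] ..
    finally show "(\<forall>x\<in>fst A. dec A (Vmult \<T> A (Vmult \<T> (VO A) \<Theta>)) x \<le> dec A e x)
        \<longleftrightarrow> (\<forall>x\<in>fst A. dec A (Vmult \<T> A (Vfun \<T> (VO (VO A)) (VO A) (Vmult \<T> A) \<Theta>)) x \<le> dec A e x)" .
  qed
qed

lemma compose_restrict_ext:
  "(\<And>x. x \<in> X \<Longrightarrow> g (f x) = g' (f' x)) \<Longrightarrow> compose X g f = compose X g' f'"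
  by (auto simp: compose_def fun_eq_iff)

lemma Vmonad_TCat: "is_monad (TCat \<T>) (Vmonad \<T>)"
  unfolding is_monad_def is_endofunctor_def
proof (intro conjI ballI)
  let ?C = "TCat \<T>" and ?M = "Vmonad \<T>"
  show "is_category ?C" using TCat_is_ord_category by (simp add: is_ord_category_def)
  fix A assume "A \<in> Ob ?C"
  then have A: "is_tcat \<T> A" by (simp add: TCat_def)
  note VA = Vobj_tcat[OF A]
  show "Fob ?M A \<in> Ob ?C" using VA by (simp add: TCat_def Vmonad_def)
  show "Fmap ?M A A (ident ?C A) = ident ?C (Fob ?M A)"
    using Vfun_ident[OF A] by (simp add: TCat_def Vmonad_def)
  show "monad_data.unit ?M A \<in> Hom ?C A (Fob ?M A)"
    using Vunit_tfunctor[OF A] by (simp add: TCat_def Vmonad_def)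
  show "mult ?M A \<in> Hom ?C (Fob ?M (Fob ?M A)) (Fob ?M A)"
    using Vmult_tfunctor[OF A] by (simp add: TCat_def Vmonad_def)
  show "cmp ?C (Fob ?M A) (Fob ?M (Fob ?M A)) (Fob ?M A) (mult ?M A) (monad_data.unit ?M (Fob ?M A))
    = ident ?C (Fob ?M A)"
    using Vmult_Vunit[OF A] by (auto simp: TCat_def Vmonad_def compose_def fun_eq_iff)
  show "cmp ?C (Fob ?M A) (Fob ?M (Fob ?M A)) (Fob ?M A) (mult ?M A) (Fmap ?M A (Fob ?M A) (monad_data.unit ?M A))
    = ident ?C (Fob ?M A)"
    using Vmult_Vfun_Vunit[OF A] by (auto simp: TCat_def Vmonad_def compose_def fun_eq_iff)
  show "cmp ?C (Fob ?M (Fob ?M (Fob ?M A))) (Fob ?M (Fob ?M A)) (Fob ?M A) (mult ?M A) (mult ?M (Fob ?M A))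
    = cmp ?C (Fob ?M (Fob ?M (Fob ?M A))) (Fob ?M (Fob ?M A)) (Fob ?M A) (mult ?M A) (Fmap ?M (Fob ?M (Fob ?M A)) (Fob ?M A) (mult ?M A))"
    using Vmult_assoc[OF A] by (auto simp: TCat_def Vmonad_def intro!: compose_restrict_ext)
next
  let ?C = "TCat \<T>" and ?M = "Vmonad \<T>"
  fix A B f assume "A \<in> Ob ?C" "B \<in> Ob ?C" "f \<in> Hom ?C A B"
  then have A: "is_tcat \<T> A" and B: "is_tcat \<T> B" and f: "f \<in> tfunctors \<T> A B" by (simp_all add: TCat_def)
  show "Fmap ?M A B f \<in> Hom ?C (Fob ?M A) (Fob ?M B)"
    using Vfun_tfunctor[OF A B f] by (simp add: TCat_def Vmonad_def)
  show "cmp ?C A (Fob ?M A) (Fob ?M B) (Fmap ?M A B f) (monad_data.unit ?M A)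
    = cmp ?C A B (Fob ?M B) (monad_data.unit ?M B) f"
    using Vfun_Vunit[OF A B f] by (auto simp: TCat_def Vmonad_def intro!: compose_restrict_ext)
  show "cmp ?C (Fob ?M (Fob ?M A)) (Fob ?M A) (Fob ?M B) (Fmap ?M A B f) (mult ?M A)
    = cmp ?C (Fob ?M (Fob ?M A)) (Fob ?M (Fob ?M B)) (Fob ?M B) (mult ?M B) (Fmap ?M (Fob ?M A) (Fob ?M B) (Fmap ?M A B f))"
    using Vfun_Vmult[OF A B f] by (auto simp: TCat_def Vmonad_def intro!: compose_restrict_ext)
next
  let ?C = "TCat \<T>" and ?M = "Vmonad \<T>"
  fix A B D f g
  assume "A \<in> Ob ?C" "B \<in> Ob ?C" "D \<in> Ob ?C" "f \<in> Hom ?C A B" "g \<in> Hom ?C B D"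
  then have "is_tcat \<T> A" "is_tcat \<T> B" "is_tcat \<T> D" "f \<in> tfunctors \<T> A B" "g \<in> tfunctors \<T> B D"
    by (simp_all add: TCat_def)
  from Vfun_compose[OF this]
  show "Fmap ?M A D (cmp ?C A B D g f) = cmp ?C (Fob ?M A) (Fob ?M B) (Fob ?M D) (Fmap ?M B D g) (Fmap ?M A B f)"
    by (simp add: TCat_def Vmonad_def)
qed

section \<open>The Kock-Zoeberlein property\<close>

text \<open>If \<open>f \<le> g\<close>, then \<open>c \<le> Vf c \<cdot> f \<le> Vf c \<cdot> g\<close> since \<open>Vf c\<close> is monotone; now use the adjunction for
  \<open>g\<close>. The order of the power object is opposite to the pointwise one, which restores the direction.\<close>

lemma Vfun_mono:
  assumes A: "is_tcat \<T> A" and B: "is_tcat \<T> B" and f: "f \<in> tfunctors \<T> A B" and g: "g \<in> tfunctors \<T> A B"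
    and le: "\<And>x. x \<in> fst A \<Longrightarrow> 1 \<le> under \<T> B (f x) (g x)" and c: "c \<in> VP A"
  shows "1 \<le> under \<T> (VO B) (Vfun \<T> A B f c) (Vfun \<T> A B g c)"
proof -
  note fc = Vfun_mem[OF A B f c] and gc = Vfun_mem[OF A B g c]
  note v = vdecode_vfunctor[OF tcat_small[OF B] fc]
  have "\<forall>x\<in>fst A. dec A c x \<le> dec B (Vfun \<T> A B f c) (g x)"
  proof
    fix x assume x: "x \<in> fst A"
    have "dec A c x * 1 \<le> dec B (Vfun \<T> A B f c) (f x) * under \<T> B (f x) (g x)"
      using Vfun_unit_ge[OF A B f c x] le[OF x] by (rule quantale_mult_mono)
    also have "\<dots> \<le> dec B (Vfun \<T> A B f c) (g x)"
      using tcat_small[OF B] v tfunctors_mem[OF f x] tfunctors_mem[OF g x] by (rule vfunctor_under)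
    finally show "dec A c x \<le> dec B (Vfun \<T> A B f c) (g x)" by simp
  qed
  then show ?thesis
    unfolding le_under_Vobj_iff[OF B fc gc] using Vfun_adjunction_le[OF A B g c v] by simp
qed

text \<open>The unit of the pointwise adjunction between \<open>\<w>\<close> and \<open>\<h>\<close>, read in the opposite order.\<close>

lemma Vmult_Vunit_le:
  assumes A: "is_tcat \<T> A" and C: "C \<in> VP (VO A)"
  shows "1 \<le> under \<T> (VO (VO A)) (Vunit \<T> (VO A) (Vmult \<T> A C)) C"
proof -
  note VA = Vobj_tcat[OF A]
  note wC = Vmult_mem[OF A C]
  then have wC': "Vmult \<T> A C \<in> fst (VO A)" by simp
  have "\<forall>c\<in>VP A. dec (VO A) C c \<le> under \<T> (VO A) (Vmult \<T> A C) c"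
    using Vmult_adjunction_le[OF A C wC] by blast
  then show ?thesis
    unfolding le_under_Vobj_iff[OF VA Vunit_mem[OF VA wC'] C]
    using dec_Vunit[OF VA wC'] by simp
qed

lemma Vmonad_adjunction:
  assumes A: "is_tcat \<T> A"
  shows "left_adjoint (TCat \<T>) (VO A) (VO (VO A)) (Vunit \<T> (VO A)) (Vmult \<T> A)"
  unfolding left_adjoint_def
proof (intro conjI)
  note VA = Vobj_tcat[OF A]
  show "Vunit \<T> (VO A) \<in> Hom (TCat \<T>) (VO A) (VO (VO A))"
    using Vunit_tfunctor[OF VA] by (simp add: TCat_def)
  show "Vmult \<T> A \<in> Hom (TCat \<T>) (VO (VO A)) (VO A)"
    using Vmult_tfunctor[OF A] by (simp add: TCat_def)
  show "le (TCat \<T>) (VO A) (VO A) (ident (TCat \<T>) (VO A)) (cmp (TCat \<T>) (VO A) (VO (VO A)) (VO A) (Vmult \<T> A) (Vunit \<T> (VO A)))"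
    using Vmult_Vunit[OF A] under_refl[OF VA] by (simp add: TCat_def compose_def)
  show "le (TCat \<T>) (VO (VO A)) (VO (VO A)) (cmp (TCat \<T>) (VO (VO A)) (VO A) (VO (VO A)) (Vunit \<T> (VO A)) (Vmult \<T> A)) (ident (TCat \<T>) (VO (VO A)))"
    using Vmult_Vunit_le[OF A] by (simp add: TCat_def compose_def)
qed

section \<open>Representable \<open>\<T>\<close>-categories\<close>

lemma fst_Tobj [simp]: "fst (Tobj \<T> A) = T \<T> (fst A)"
  by (cases A) (simp add: Tobj_def)

lemma snd_Tobj:
  assumes "small (fst A)" "\<XX> \<in> T \<T> (T \<T> (fst A))"
  shows "snd (Tobj \<T> A) \<XX> \<yy> = (SUP \<XX>'\<in>{\<XX>'\<in>T \<T> (T \<T> (fst A)). Tm \<T> (fst A) \<XX>' = Tm \<T> (fst A) \<XX>}.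
    Txi \<T> (T \<T> (fst A)) (fst A) (snd A) \<XX>' \<yy>)"
proof -
  let ?X = "fst A"
  let ?TTX = "T \<T> (T \<T> ?X)"
  let ?m = "vgraph ?TTX (Tm \<T> ?X) :: 'u \<Rightarrow> 'u \<Rightarrow> 'v"
  have m: "Tm \<T> ?X \<in> ?TTX \<rightarrow> T \<T> ?X" using Tm_in[OF assms(1)] by auto
  have mm: "vcomp (T \<T> ?X) (vconv ?m) ?m \<XX> \<XX>' = vgraph ?TTX (Tm \<T> ?X) \<XX>' (Tm \<T> ?X \<XX>)" for \<XX>'
    unfolding vcomp_vgraph[OF m assms(2)] by (simp add: vconv_def)
  have "snd (Tobj \<T> A) = vcomp ?TTX (Txi \<T> (T \<T> ?X) ?X (snd A)) (vcomp (T \<T> ?X) (vconv ?m) ?m)"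
    by (cases A) (simp add: Tobj_def Let_def)
  then have "snd (Tobj \<T> A) \<XX> \<yy> = (SUP \<XX>'\<in>?TTX. vgraph ?TTX (Tm \<T> ?X) \<XX>' (Tm \<T> ?X \<XX>) * Txi \<T> (T \<T> ?X) ?X (snd A) \<XX>' \<yy>)"
    by (simp add: vcomp_def[of ?TTX] mm)
  also have "\<dots> = (SUP \<XX>'\<in>{\<XX>'\<in>?TTX. Tm \<T> ?X \<XX>' = Tm \<T> ?X \<XX>}. Txi \<T> (T \<T> ?X) ?X (snd A) \<XX>' \<yy>)"
    by (rule antisym; rule SUP_least) (auto simp: vgraph_def intro: SUP_upper2)
  finally show ?thesis .
qed

lemma Tobj_Te:
  assumes "small (fst A)" "\<XX> \<in> T \<T> (T \<T> (fst A))" "\<yy> \<in> T \<T> (fst A)" "Tm \<T> (fst A) \<XX> = \<yy>" "x \<in> fst A"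
  shows "snd A \<yy> x \<le> snd (Tobj \<T> A) \<XX> (Te \<T> (fst A) x)"
  unfolding snd_Tobj[OF assms(1,2)]
  by (rule SUP_upper2[of "Te \<T> (T \<T> (fst A)) \<yy>"]) (use assms in \<open>auto simp: Tm_Te intro: Txi_Te\<close>)

lemma representationD:
  assumes "representation \<T> A \<alpha>"
  shows "\<alpha> \<in> tfunctors \<T> (Tobj \<T> A) A"
    and "\<And>\<xx>. \<xx> \<in> T \<T> (fst A) \<Longrightarrow> 1 \<le> under \<T> (Tobj \<T> A) \<xx> (Te \<T> (fst A) (\<alpha> \<xx>))"
    and "\<And>x. x \<in> fst A \<Longrightarrow> 1 \<le> under \<T> A (\<alpha> (Te \<T> (fst A) x)) x"
  using assms by (simp_all add: representation_def left_adjoint_def TCat_def compose_def)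

lemma representation_mem: "representation \<T> A \<alpha> \<Longrightarrow> \<xx> \<in> T \<T> (fst A) \<Longrightarrow> \<alpha> \<xx> \<in> fst A"
  using tfunctors_mem[OF representationD(1)] by simp

text \<open>The unit of the adjunction gives some \<open>\<XX>\<close> over \<open>\<xx>\<close> that is related to \<open>e (\<alpha> \<xx>)\<close>; then apply
  transitivity to \<open>\<XX>\<close>, \<open>e (\<alpha> \<xx>)\<close> and \<open>\<alpha> \<xx>\<close>. Since the unit only bounds a supremum, this is done for each
  candidate.\<close>

lemma representation_ge_one:
  assumes A: "is_tcat \<T> A" and rep: "representation \<T> A \<alpha>" and \<xx>: "\<xx> \<in> T \<T> (fst A)"
  shows "1 \<le> snd A \<xx> (\<alpha> \<xx>)"
proof -
  let ?X = "fst A"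
  note X = tcat_small[OF A]
  note \<alpha>x = representation_mem[OF rep \<xx>]
  have "1 \<le> snd (Tobj \<T> A) (Te \<T> (T \<T> ?X) \<xx>) (Te \<T> ?X (\<alpha> \<xx>))"
    using representationD(2)[OF rep \<xx>] X \<xx> by (simp add: under_eq)
  also have "\<dots> \<le> snd A \<xx> (\<alpha> \<xx>)"
    unfolding snd_Tobj[OF X Te_mem[OF T_small[OF X] \<xx>]]
  proof (rule SUP_least, clarify)
    fix \<XX> assume \<XX>: "\<XX> \<in> T \<T> (T \<T> ?X)" "Tm \<T> ?X \<XX> = Tm \<T> ?X (Te \<T> (T \<T> ?X) \<xx>)"
    have "Txi \<T> (T \<T> ?X) ?X (snd A) \<XX> (Te \<T> ?X (\<alpha> \<xx>)) * 1
        \<le> Txi \<T> (T \<T> ?X) ?X (snd A) \<XX> (Te \<T> ?X (\<alpha> \<xx>)) * snd A (Te \<T> ?X (\<alpha> \<xx>)) (\<alpha> \<xx>)"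
      using A \<alpha>x by (intro quantale_mult_mono tcat_refl) auto
    also have "\<dots> \<le> snd A (Tm \<T> ?X \<XX>) (\<alpha> \<xx>)"
      using A \<XX> X \<alpha>x by (intro tcat_trans) auto
    finally show "Txi \<T> (T \<T> ?X) ?X (snd A) \<XX> (Te \<T> ?X (\<alpha> \<xx>)) \<le> snd A \<xx> (\<alpha> \<xx>)"
      using \<XX> X \<xx> by (simp add: Tm_Te)
  qed
  finally show ?thesis .
qed

text \<open>The adjunction \<open>\<alpha> \<stileturn> e\<close> transposes \<open>\<alpha> \<xx> \<le> x\<close> to \<open>\<xx> \<le> e x\<close>, and the degree to which the latter holds
  in \<open>TA\<close> is at least \<open>a \<xx> x\<close>. The other inequality is \<open>a\<^sub>0 \<cdot> a \<le> a\<close>, since \<open>a\<close> contains the graph of \<open>\<alpha>\<close>.\<close>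

lemma representation_structure:
  assumes A: "is_tcat \<T> A" and rep: "representation \<T> A \<alpha>" and \<xx>: "\<xx> \<in> T \<T> (fst A)" and x: "x \<in> fst A"
  shows "snd A \<xx> x = under \<T> A (\<alpha> \<xx>) x"
proof (rule antisym)
  let ?X = "fst A"
  note X = tcat_small[OF A]
  note \<alpha>x = representation_mem[OF rep \<xx>] and \<alpha>e = representation_mem[OF rep Te_mem[OF X x]]
  have "snd A \<xx> x \<le> under \<T> (Tobj \<T> A) \<xx> (Te \<T> ?X x)"
    using X \<xx> x by (simp add: under_eq Tobj_Te Tm_Te)
  also have "\<dots> \<le> under \<T> A (\<alpha> \<xx>) (\<alpha> (Te \<T> ?X x))"
    using X \<xx> x representationD(1)[OF rep] by (intro tfunctors_under) auto
  finally have "snd A \<xx> x * 1 \<le> under \<T> A (\<alpha> \<xx>) (\<alpha> (Te \<T> ?X x)) * under \<T> A (\<alpha> (Te \<T> ?X x)) x"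
    using representationD(3)[OF rep x] by (rule quantale_mult_mono)
  also have "\<dots> \<le> under \<T> A (\<alpha> \<xx>) x" using A \<alpha>x \<alpha>e by (rule under_trans)
  finally show "snd A \<xx> x \<le> under \<T> A (\<alpha> \<xx>) x" by simp
  have "1 * under \<T> A (\<alpha> \<xx>) x \<le> snd A \<xx> (\<alpha> \<xx>) * under \<T> A (\<alpha> \<xx>) x"
    using representation_ge_one[OF A rep \<xx>] by (intro quantale_mult_mono) auto
  also have "\<dots> \<le> snd A \<xx> x"
    using tcat_trans_under[OF A \<xx> \<alpha>x] X \<alpha>x by (simp add: under_eq)
  finally show "under \<T> A (\<alpha> \<xx>) x \<le> snd A \<xx> x" by simp
qed

text \<open>The inequality \<open>a \<cdot> m \<le> a \<cdot> T\<^sub>\<xi> a\<close>. As \<open>\<XX>\<close> is related to \<open>m \<XX>\<close> in \<open>TA\<close>, the \<open>\<T>\<close>-functor \<open>\<alpha>\<close> relates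
  \<open>T\<alpha> \<XX>\<close> to \<open>\<alpha> (m \<XX>)\<close>; and \<open>T\<^sub>\<xi> a\<close> relates \<open>\<XX>\<close> to \<open>T\<alpha> \<XX>\<close>, because \<open>a\<close> contains the graph of \<open>\<alpha>\<close>.\<close>

lemma representation_Tm:
  assumes A: "is_tcat \<T> A" and rep: "representation \<T> A \<alpha>" and \<XX>: "\<XX> \<in> T \<T> (T \<T> (fst A))" and x: "x \<in> fst A"
  shows "snd A (Tm \<T> (fst A) \<XX>) x \<le> lift A (T \<T> (fst A)) (snd A) \<XX> x"
proof -
  let ?X = "fst A"
  note X = tcat_small[OF A]
  have \<alpha>: "\<alpha> \<in> T \<T> ?X \<rightarrow> ?X" using representation_mem[OF rep] by auto
  define \<zz> where "\<zz> = tm (T \<T> ?X) ?X \<alpha> \<XX>"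
  have \<zz>: "\<zz> \<in> T \<T> ?X" unfolding \<zz>_def using X \<alpha> \<XX> by (intro tm_mem) auto
  define \<yy> where "\<yy> = Tm \<T> ?X \<XX>"
  have \<yy>: "\<yy> \<in> T \<T> ?X" unfolding \<yy>_def using X \<XX> by simp
  have e: "Te \<T> ?X \<in> ?X \<rightarrow> T \<T> ?X" using Te_in[OF X] by auto
  \<comment> \<open>A witness in \<open>TTX\<close> with \<open>m \<YY> = m \<XX>\<close>, related to \<open>\<yy>\<close> by reflexivity of \<open>a\<close>.\<close>
  define \<YY> where "\<YY> = tm ?X (T \<T> ?X) (Te \<T> ?X) \<yy>"
  have \<YY>: "\<YY> \<in> T \<T> (T \<T> ?X)" unfolding \<YY>_def using X e \<yy> by (intro tm_mem) auto
  have mY: "Tm \<T> ?X \<YY> = \<yy>" unfolding \<YY>_def using Tm_TTe[OF X \<yy>] Te_in[OF X] by simp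
  have "1 \<le> Txi \<T> ?X ?X (\<lambda>x. snd A (Te \<T> ?X x)) \<yy> (tm ?X ?X (\<lambda>x. x) \<yy>)"
    using X \<yy> tcat_refl[OF A] by (intro Txi_ge_one) auto
  also have "\<dots> = Txi \<T> (T \<T> ?X) ?X (snd A) \<YY> \<yy>"
    unfolding tm_id[OF X \<yy>] \<YY>_def using X e \<yy> by (intro Txi_reindex) auto
  also have "\<dots> \<le> snd (Tobj \<T> A) \<XX> \<yy>"
    unfolding snd_Tobj[OF X \<XX>] using \<YY> mY by (intro SUP_upper) (simp add: \<yy>_def)
  also have "\<dots> \<le> snd A \<zz> (\<alpha> \<yy>)"
    unfolding \<zz>_def using tfunctors_le[OF representationD(1)[OF rep], of \<XX> \<yy>] \<XX> \<yy> by simp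
  finally have "1 * under \<T> A (\<alpha> \<yy>) x \<le> snd A \<zz> (\<alpha> \<yy>) * under \<T> A (\<alpha> \<yy>) x"
    by (intro quantale_mult_mono) auto
  also have "\<dots> \<le> snd A \<zz> x"
    using tcat_trans_under[OF A \<zz>] X \<alpha> \<yy> by (simp add: under_eq Pi_iff)
  finally have "snd A \<yy> x \<le> 1 * snd A \<zz> x"
    using representation_structure[OF A rep \<yy> x] by simp
  also have "\<dots> \<le> Txi \<T> (T \<T> ?X) ?X (snd A) \<XX> \<zz> * snd A \<zz> x"
    unfolding \<zz>_def using X \<alpha> \<XX> representation_ge_one[OF A rep] by (intro quantale_mult_mono Txi_ge_one) auto
  also have "\<dots> \<le> lift A (T \<T> ?X) (snd A) \<XX> x"
    unfolding lift_def using \<zz> by (rule vcomp_upper)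
  finally show ?thesis by (simp add: \<yy>_def)
qed

text \<open>Now that \<open>a \<cdot> T\<^sub>\<xi> a = a \<cdot> m\<close>, the weak pullback property of \<open>m\<close> gives the converse of the general
  inequality.\<close>

lemma lift_lift_representable:
  assumes A: "is_tcat \<T> A" and rep: "representation \<T> A \<alpha>" and S: "small S" and \<SS>: "\<SS> \<in> T \<T> (T \<T> S)"
    and x: "x \<in> fst A"
  shows "lift A (T \<T> S) (lift A S r) \<SS> x = lift A S r (Tm \<T> S \<SS>) x"
proof (rule antisym)
  show "lift A (T \<T> S) (lift A S r) \<SS> x \<le> lift A S r (Tm \<T> S \<SS>) x"
    using A S \<SS> by (rule lift_lift_le)
  let ?X = "fst A"
  let ?TTX = "T \<T> (T \<T> ?X)"
  let ?TTr = "Txi \<T> (T \<T> S) (T \<T> ?X) (Txi \<T> S ?X r)"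
  note X = tcat_small[OF A]
  have eq: "lift A (T \<T> S) (lift A S r) = vcomp ?TTX (lift A (T \<T> ?X) (snd A)) ?TTr"
    unfolding lift_def[of A S] using X S by (simp add: lift_vcomp)
  show "lift A S r (Tm \<T> S \<SS>) x \<le> lift A (T \<T> S) (lift A S r) \<SS> x"
    unfolding lift_def[of A S r] vcomp_le_iff
  proof
    fix \<xx> assume \<xx>: "\<xx> \<in> T \<T> ?X"
    have "Txi \<T> S ?X r (Tm \<T> S \<SS>) \<xx> * snd A \<xx> x
        \<le> vcomp ?TTX (vgraph ?TTX (Tm \<T> ?X)) ?TTr \<SS> \<xx> * snd A \<xx> x"
      using S X \<SS> by (intro quantale_mult_mono Txi_Tm_ge) auto
    also have "\<dots> \<le> vcomp ?TTX (lift A (T \<T> ?X) (snd A)) ?TTr \<SS> x"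
      unfolding vcomp_def[of ?TTX "vgraph ?TTX (Tm \<T> ?X)"] quantale_SUP_mult
    proof (rule SUP_least)
      fix \<XX> assume \<XX>: "\<XX> \<in> ?TTX"
      have "vgraph ?TTX (Tm \<T> ?X) \<XX> \<xx> * snd A \<xx> x \<le> lift A (T \<T> ?X) (snd A) \<XX> x"
        using representation_Tm[OF A rep \<XX> x] by (auto simp: vgraph_def)
      then have "?TTr \<SS> \<XX> * (vgraph ?TTX (Tm \<T> ?X) \<XX> \<xx> * snd A \<xx> x) \<le> ?TTr \<SS> \<XX> * lift A (T \<T> ?X) (snd A) \<XX> x"
        by (intro quantale_mult_mono) auto
      also have "\<dots> \<le> vcomp ?TTX (lift A (T \<T> ?X) (snd A)) ?TTr \<SS> x"
        using \<XX> by (rule vcomp_upper)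
      finally show "?TTr \<SS> \<XX> * vgraph ?TTX (Tm \<T> ?X) \<XX> \<xx> * snd A \<xx> x
          \<le> vcomp ?TTX (lift A (T \<T> ?X) (snd A)) ?TTr \<SS> x"
        by (simp add: mult.assoc)
    qed
    finally show "Txi \<T> S ?X r (Tm \<T> S \<SS>) \<xx> * snd A \<xx> x
        \<le> lift A (T \<T> S) (vcomp (T \<T> ?X) (snd A) (Txi \<T> S ?X r)) \<SS> x"
      using eq by (simp add: lift_def)
  qed
qed

section \<open>The power object of a representable \<open>\<T>\<close>-category\<close>

text \<open>The relation \<open>\<mu>\<close> as a map into the power object; its values are functors by \<open>vfunctor_lift\<close>.\<close>

definition Vrep :: "('u, 'v) tcat \<Rightarrow> 'u \<Rightarrow> 'u" where
  "Vrep A = restrict (\<lambda>\<pp>. enc A (lift A (VP A) (dec A) \<pp>)) (T \<T> (VP A))"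

lemma Vrep_mem:
  assumes A: "is_tcat \<T> A" and \<pp>: "\<pp> \<in> T \<T> (VP A)"
  shows "Vrep A \<pp> \<in> VP A"
  using vencode_in_Vpow[OF tcat_small[OF A] vfunctor_lift[OF A small_Vpow[OF tcat_small[OF A]] \<pp>]] \<pp>
  by (simp add: Vrep_def)

lemma dec_Vrep:
  assumes A: "is_tcat \<T> A" and \<pp>: "\<pp> \<in> T \<T> (VP A)" and x: "x \<in> fst A"
  shows "dec A (Vrep A \<pp>) x = lift A (VP A) (dec A) \<pp> x"
  using \<pp> vdecode_vencode[OF tcat_small[OF A] x] by (simp add: Vrep_def)

lemma Te_tfunctor:
  assumes A: "is_tcat \<T> A"
  shows "Te \<T> (fst A) \<in> tfunctors \<T> A (Tobj \<T> A)"
proof -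
  note X = tcat_small[OF A]
  have e: "Te \<T> (fst A) \<in> fst A \<rightarrow> T \<T> (fst A)" using Te_in[OF X] by auto
  have "snd A \<xx> x \<le> snd (Tobj \<T> A) (tm (fst A) (T \<T> (fst A)) (Te \<T> (fst A)) \<xx>) (Te \<T> (fst A) x)"
    if "\<xx> \<in> T \<T> (fst A)" "x \<in> fst A" for \<xx> x
  proof (rule Tobj_Te[OF X])
    show "tm (fst A) (T \<T> (fst A)) (Te \<T> (fst A)) \<xx> \<in> T \<T> (T \<T> (fst A))"
      using X e that by (intro tm_mem) auto
    show "Tm \<T> (fst A) (tm (fst A) (T \<T> (fst A)) (Te \<T> (fst A)) \<xx>) = \<xx>"
      using Tm_TTe[OF X that(1)] Te_in[OF X] by simp
  qed (use that in auto)
  then show ?thesis using Te_in[OF X] by (simp add: tfunctors_iff)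
qed

text \<open>The elements \<open>\<PP>'\<close> over which the structure of \<open>T(VA)\<close> takes its supremum satisfy \<open>m \<PP>' = m \<PP>\<close>, and the
  bound in \<open>Txi_Vobj_lift\<close> depends on \<open>\<PP>'\<close> only through \<open>m \<PP>'\<close>. The equation \<open>\<mu> \<cdot> T\<mu> = \<mu> \<cdot> m\<close>,
  which needs a representable \<open>A\<close>, identifies this bound with the required one.\<close>

lemma Vrep_tfunctor:
  assumes A: "is_tcat \<T> A" and rep: "representation \<T> A \<alpha>"
  shows "Vrep A \<in> tfunctors \<T> (Tobj \<T> (VO A)) (VO A)"
proof -
  let ?P = "VP A"
  note X = tcat_small[OF A]
  note P = small_Vpow[OF X]
  have V: "Vrep A \<in> T \<T> ?P \<rightarrow> ?P" using Vrep_mem[OF A] by auto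
  have "snd (Tobj \<T> (VO A)) \<PP> \<qq> \<le> snd (VO A) (tm (T \<T> ?P) ?P (Vrep A) \<PP>) (Vrep A \<qq>)"
    if \<PP>: "\<PP> \<in> T \<T> (T \<T> ?P)" and \<qq>: "\<qq> \<in> T \<T> ?P" for \<PP> \<qq>
  proof -
    have TV: "tm (T \<T> ?P) ?P (Vrep A) \<PP> \<in> T \<T> ?P" using P V \<PP> by (intro tm_mem) auto
    have lift_TV: "lift A ?P (dec A) (tm (T \<T> ?P) ?P (Vrep A) \<PP>) x = lift A ?P (dec A) (Tm \<T> ?P \<PP>) x"
      if x: "x \<in> fst A" for x
    proof -
      have "lift A ?P (dec A) (tm (T \<T> ?P) ?P (Vrep A) \<PP>) x = lift A (T \<T> ?P) (\<lambda>\<pp>. dec A (Vrep A \<pp>)) \<PP> x"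
        using X P V \<PP> by (intro lift_reindex[symmetric]) auto
      also have "\<dots> = lift A (T \<T> ?P) (lift A ?P (dec A)) \<PP> x"
        using X P by (intro antisym lift_mono_on) (simp_all add: dec_Vrep[OF A])
      also have "\<dots> = lift A ?P (dec A) (Tm \<T> ?P \<PP>) x"
        using A rep P \<PP> x by (rule lift_lift_representable)
      finally show ?thesis .
    qed
    have P': "small (fst (VO A))" "\<PP> \<in> T \<T> (T \<T> (fst (VO A)))" using P \<PP> by simp_all
    show ?thesis
      unfolding snd_Tobj[OF P', unfolded fst_Vobj]
    proof (rule SUP_least, clarify)
      fix \<PP>' assume \<PP>': "\<PP>' \<in> T \<T> (T \<T> ?P)" and m: "Tm \<T> ?P \<PP>' = Tm \<T> ?P \<PP>"
      show "Txi \<T> (T \<T> ?P) ?P (snd (VO A)) \<PP>' \<qq> \<le> snd (VO A) (tm (T \<T> ?P) ?P (Vrep A) \<PP>) (Vrep A \<qq>)"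
        unfolding le_Vobj_iff[OF X TV Vrep_mem[OF A \<qq>]]
        using Txi_Vobj_lift[OF A \<PP>' \<qq>] m by (simp add: dec_Vrep[OF A \<qq>] lift_TV del: restrict_apply)
    qed
  qed
  moreover have "Vrep A \<in> T \<T> ?P \<rightarrow>\<^sub>E ?P" using V by (auto simp: PiE_def Vrep_def)
  ultimately show ?thesis by (simp add: tfunctors_iff)
qed

lemma Vrep_representation:
  assumes A: "is_tcat \<T> A" and rep: "representation \<T> A \<alpha>"
  shows "representation \<T> (VO A) (Vrep A)"
  unfolding representation_def left_adjoint_def
proof (intro conjI)
  let ?P = "VP A"
  note X = tcat_small[OF A]
  note P = small_Vpow[OF X]
  note VA = Vobj_tcat[OF A]
  show "Vrep A \<in> Hom (TCat \<T>) (Tobj \<T> (VO A)) (VO A)"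
    using Vrep_tfunctor[OF A rep] by (simp add: TCat_def)
  show "Te \<T> (fst (VO A)) \<in> Hom (TCat \<T>) (VO A) (Tobj \<T> (VO A))"
    using Te_tfunctor[OF VA] by (simp add: TCat_def)
  have "1 \<le> under \<T> (Tobj \<T> (VO A)) \<pp> (Te \<T> ?P (Vrep A \<pp>))" if \<pp>: "\<pp> \<in> T \<T> ?P" for \<pp>
  proof -
    have "1 \<le> snd (VO A) \<pp> (Vrep A \<pp>)"
      unfolding le_Vobj_iff[OF X \<pp> Vrep_mem[OF A \<pp>]] by (simp add: dec_Vrep[OF A \<pp>])
    also have "\<dots> \<le> snd (Tobj \<T> (VO A)) (Te \<T> (T \<T> ?P) \<pp>) (Te \<T> ?P (Vrep A \<pp>))"
      using Tobj_Te[of "VO A" "Te \<T> (T \<T> ?P) \<pp>" \<pp> "Vrep A \<pp>"] P \<pp> Vrep_mem[OF A \<pp>] by (simp add: Tm_Te)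
    finally show ?thesis using P \<pp> by (simp add: under_eq)
  qed
  then show "le (TCat \<T>) (Tobj \<T> (VO A)) (Tobj \<T> (VO A)) (ident (TCat \<T>) (Tobj \<T> (VO A)))
      (cmp (TCat \<T>) (Tobj \<T> (VO A)) (VO A) (Tobj \<T> (VO A)) (Te \<T> (fst (VO A))) (Vrep A))"
    by (simp add: TCat_def compose_def)
  have "1 \<le> under \<T> (VO A) (Vrep A (Te \<T> ?P c)) c" if c: "c \<in> ?P" for c
  proof -
    have e: "Te \<T> ?P c \<in> T \<T> ?P" using P c by simp
    show ?thesis
      unfolding le_under_Vobj_iff[OF A Vrep_mem[OF A e] c]
      using lift_Te_ge[OF A P c] by (simp add: dec_Vrep[OF A e])
  qed
  then show "le (TCat \<T>) (VO A) (VO A) (cmp (TCat \<T>) (VO A) (Tobj \<T> (VO A)) (VO A) (Vrep A) (Te \<T> (fst (VO A))))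
      (ident (TCat \<T>) (VO A))"
    by (simp add: TCat_def compose_def)
qed

lemma Vobj_representable: "is_tcat \<T> A \<Longrightarrow> representable \<T> A \<Longrightarrow> representable \<T> (VO A)"
  unfolding representable_def using Vrep_representation by blast

text \<open>Both \<open>\<beta> \<pp>\<close> and \<open>\<mu> \<pp>\<close> represent the structure of \<open>VA\<close> at \<open>\<pp>\<close>, and the order of \<open>VA\<close> is antisymmetric.\<close>

lemma dec_representation:
  assumes A: "is_tcat \<T> A" and rep: "representation \<T> (VO A) \<beta>" and \<pp>: "\<pp> \<in> T \<T> (VP A)" and x: "x \<in> fst A"
  shows "dec A (\<beta> \<pp>) x = lift A (VP A) (dec A) \<pp> x"
proof -
  note X = tcat_small[OF A]
  note VA = Vobj_tcat[OF A]
  have \<pp>': "\<pp> \<in> T \<T> (fst (VO A))" using \<pp> by simp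
  have \<beta>: "\<beta> \<pp> \<in> VP A" using representation_mem[OF rep \<pp>'] by simp
  have *: "(\<forall>x\<in>fst A. u * dec A c x \<le> lift A (VP A) (dec A) \<pp> x) \<longleftrightarrow> (\<forall>x\<in>fst A. u * dec A c x \<le> dec A (\<beta> \<pp>) x)"
    if c: "c \<in> VP A" for u c
    using representation_structure[OF VA rep \<pp>', of c] c
      le_Vobj_iff[OF X \<pp> c, of u] le_under_Vobj_iff[OF A \<beta> c, of u] by simp
  show ?thesis
  proof (rule antisym)
    show "dec A (\<beta> \<pp>) x \<le> lift A (VP A) (dec A) \<pp> x"
      using *[OF \<beta>, of 1] x by simp
    show "lift A (VP A) (dec A) \<pp> x \<le> dec A (\<beta> \<pp>) x"
      using *[OF Vrep_mem[OF A \<pp>], of 1] x by (simp add: dec_Vrep[OF A \<pp>])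
  qed
qed

section \<open>Pseudo-homomorphisms\<close>

lemma pseudo_homomorphism_iff: "pseudo_homomorphism \<T> A B f \<longleftrightarrow> f \<in> tfunctors \<T> A B \<and>
    (\<forall>\<alpha> \<beta>. representation \<T> A \<alpha> \<longrightarrow> representation \<T> B \<beta> \<longrightarrow> (\<forall>\<xx>\<in>T \<T> (fst A).
      1 \<le> under \<T> B (\<beta> (tm (fst A) (fst B) f \<xx>)) (f (\<alpha> \<xx>)) \<and> 1 \<le> under \<T> B (f (\<alpha> \<xx>)) (\<beta> (tm (fst A) (fst B) f \<xx>))))"
proof -
  have "restrict f (fst A) = f" if "f \<in> tfunctors \<T> A B"
    using tfunctors_in[OF that] by simp
  then show ?thesis
    unfolding pseudo_homomorphism_def Let_def by (auto simp: TCat_def compose_def)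
qed

lemma tfunctors_tm: 
  assumes "is_tcat \<T> A" "is_tcat \<T> B" "f \<in> tfunctors \<T> A B" "\<xx> \<in> T \<T> (fst A)"
  shows "tm (fst A) (fst B) f \<xx> \<in> T \<T> (fst B)"
proof -
  have "f \<in> fst A \<rightarrow> fst B" using assms tfunctors_mem by auto
  then show ?thesis using assms by (intro tm_mem tcat_small)
qed

text \<open>Every \<open>\<T>\<close>-functor is a lax homomorphism, so only the opposite inequality is a condition.\<close>

lemma pseudo_homomorphism_half:
  assumes A: "is_tcat \<T> A" and B: "is_tcat \<T> B" and f: "f \<in> tfunctors \<T> A B"
    and \<alpha>: "representation \<T> A \<alpha>" and \<beta>: "representation \<T> B \<beta>" and \<xx>: "\<xx> \<in> T \<T> (fst A)"
  shows "1 \<le> under \<T> B (\<beta> (tm (fst A) (fst B) f \<xx>)) (f (\<alpha> \<xx>))"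
proof -
  note \<alpha>x = representation_mem[OF \<alpha> \<xx>]
  have "1 \<le> snd A \<xx> (\<alpha> \<xx>)" using A \<alpha> \<xx> by (rule representation_ge_one)
  also have "\<dots> \<le> snd B (tm (fst A) (fst B) f \<xx>) (f (\<alpha> \<xx>))" using f \<xx> \<alpha>x by (rule tfunctors_le)
  also have "\<dots> = under \<T> B (\<beta> (tm (fst A) (fst B) f \<xx>)) (f (\<alpha> \<xx>))"
    using B \<beta> tfunctors_tm[OF A B f \<xx>] tfunctors_mem[OF f \<alpha>x] by (rule representation_structure)
  finally show ?thesis .
qed

lemma pseudo_homomorphismI:
  assumes A: "is_tcat \<T> A" and B: "is_tcat \<T> B" and f: "f \<in> tfunctors \<T> A B"
    and "\<And>\<alpha> \<beta> \<xx>. representation \<T> A \<alpha> \<Longrightarrow> representation \<T> B \<beta> \<Longrightarrow> \<xx> \<in> T \<T> (fst A) \<Longrightarrow>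
      1 \<le> under \<T> B (f (\<alpha> \<xx>)) (\<beta> (tm (fst A) (fst B) f \<xx>))"
  shows "pseudo_homomorphism \<T> A B f"
  using assms pseudo_homomorphism_half[OF A B f] by (simp add: pseudo_homomorphism_iff)

lemma pseudo_homomorphism_ident:
  assumes A: "is_tcat \<T> A"
  shows "pseudo_homomorphism \<T> A A (restrict id (fst A))"
proof (rule pseudo_homomorphismI[OF A A tfunctors_ident[OF A]])
  fix \<alpha> \<beta> \<xx> assume \<alpha>: "representation \<T> A \<alpha>" and \<beta>: "representation \<T> A \<beta>" and \<xx>: "\<xx> \<in> T \<T> (fst A)"
  have "tm (fst A) (fst A) (restrict id (fst A)) \<xx> = \<xx>"
    using tcat_small[OF A] \<xx> by (intro tm_ident) auto
  moreover have "1 \<le> under \<T> A (\<alpha> \<xx>) (\<beta> \<xx>)"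
    using representation_ge_one[OF A \<beta> \<xx>] representation_structure[OF A \<alpha> \<xx> representation_mem[OF \<beta> \<xx>]] by simp
  ultimately show "1 \<le> under \<T> A (restrict id (fst A) (\<alpha> \<xx>)) (\<beta> (tm (fst A) (fst A) (restrict id (fst A)) \<xx>))"
    using representation_mem[OF \<alpha> \<xx>] by (simp del: restrict_restrict)
qed

lemma pseudo_homomorphism_compose:
  assumes A: "is_tcat \<T> A" and B: "is_tcat \<T> B" and D: "is_tcat \<T> D" and repB: "representable \<T> B"
    and f: "pseudo_homomorphism \<T> A B f" and g: "pseudo_homomorphism \<T> B D g"
  shows "pseudo_homomorphism \<T> A D (compose (fst A) g f)"
proof -
  have f': "f \<in> tfunctors \<T> A B" and g': "g \<in> tfunctors \<T> B D"
    using f g by (simp_all add: pseudo_homomorphism_def)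
  obtain \<beta> where \<beta>: "representation \<T> B \<beta>" using repB by (auto simp: representable_def)
  show ?thesis
  proof (rule pseudo_homomorphismI[OF A D tfunctors_compose[OF A B D f' g']])
    fix \<alpha> \<delta> \<xx> assume \<alpha>: "representation \<T> A \<alpha>" and \<delta>: "representation \<T> D \<delta>" and \<xx>: "\<xx> \<in> T \<T> (fst A)"
    let ?y = "tm (fst A) (fst B) f \<xx>"
    note \<alpha>x = representation_mem[OF \<alpha> \<xx>]
    note y = tfunctors_tm[OF A B f' \<xx>]
    note \<beta>y = representation_mem[OF \<beta> y]
    note f\<alpha> = tfunctors_mem[OF f' \<alpha>x]
    have "1 \<le> under \<T> B (f (\<alpha> \<xx>)) (\<beta> ?y)" using f \<alpha> \<beta> \<xx> by (auto simp: pseudo_homomorphism_iff)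
    also have "\<dots> \<le> under \<T> D (g (f (\<alpha> \<xx>))) (g (\<beta> ?y))"
      using tcat_small[OF B] tcat_small[OF D] g' f\<alpha> \<beta>y by (rule tfunctors_under)
    finally have 1: "1 \<le> under \<T> D (g (f (\<alpha> \<xx>))) (g (\<beta> ?y))" .
    have 2: "1 \<le> under \<T> D (g (\<beta> ?y)) (\<delta> (tm (fst B) (fst D) g ?y))"
      using g \<beta> \<delta> y by (auto simp: pseudo_homomorphism_iff)
    have "1 \<le> under \<T> D (g (f (\<alpha> \<xx>))) (\<delta> (tm (fst B) (fst D) g ?y))"
      using D tfunctors_mem[OF g' f\<alpha>] tfunctors_mem[OF g' \<beta>y] 1 2 by (rule under_one_trans)
    moreover have "tm (fst B) (fst D) g ?y = tm (fst A) (fst D) (compose (fst A) g f) \<xx>"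
    proof -
      have "f \<in> fst A \<rightarrow> fst B" "g \<in> fst B \<rightarrow> fst D" using f' g' tfunctors_mem by auto
      then have "tm (fst B) (fst D) g ?y = tm (fst A) (fst D) (\<lambda>x. g (f x)) \<xx>"
        using A B D \<xx> by (intro tm_comp tcat_small)
      also have "\<dots> = tm (fst A) (fst D) (compose (fst A) g f) \<xx>"
        by (rule fun_cong[OF tm_cong]) (simp add: compose_def)
      finally show ?thesis .
    qed
    ultimately show "1 \<le> under \<T> D (compose (fst A) g f (\<alpha> \<xx>)) (\<delta> (tm (fst A) (fst D) (compose (fst A) g f) \<xx>))"
      using \<alpha>x by (simp add: compose_def)
  qed
qed

text \<open>The left-hand side of the hypothesis is \<open>\<mu> (Tf \<yy>)\<close> at \<open>x\<close>, and \<open>\<mu>\<close> is the left adjoint of \<open>e\<close> at \<open>VA\<close>.\<close>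

lemma pseudo_homomorphism_VobjI:
  assumes A: "is_tcat \<T> A" and B: "is_tcat \<T> B" and f: "f \<in> tfunctors \<T> B (VO A)"
    and le: "\<And>\<beta> \<yy> x. representation \<T> B \<beta> \<Longrightarrow> \<yy> \<in> T \<T> (fst B) \<Longrightarrow> x \<in> fst A \<Longrightarrow>
      lift A (fst B) (\<lambda>y. dec A (f y)) \<yy> x \<le> dec A (f (\<beta> \<yy>)) x"
  shows "pseudo_homomorphism \<T> B (VO A) f"
proof (rule pseudo_homomorphismI[OF B Vobj_tcat[OF A] f])
  note VA = Vobj_tcat[OF A]
  note X = tcat_small[OF A]
  fix \<beta> \<gamma> \<yy> assume \<beta>: "representation \<T> B \<beta>" and \<gamma>: "representation \<T> (VO A) \<gamma>" and \<yy>: "\<yy> \<in> T \<T> (fst B)"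
  let ?q = "tm (fst B) (fst (VO A)) f \<yy>"
  note q = tfunctors_tm[OF B VA f \<yy>]
  have f\<beta>: "f (\<beta> \<yy>) \<in> VP A" using tfunctors_mem[OF f representation_mem[OF \<beta> \<yy>]] by simp
  have \<gamma>q: "\<gamma> ?q \<in> VP A" using representation_mem[OF \<gamma> q] by simp
  have f': "f \<in> fst B \<rightarrow> VP A" using tfunctors_mem[OF f] by auto
  have "dec A (\<gamma> ?q) x \<le> dec A (f (\<beta> \<yy>)) x" if x: "x \<in> fst A" for x
  proof -
    have "dec A (\<gamma> ?q) x = lift A (VP A) (dec A) ?q x"
      using A \<gamma> _ x by (rule dec_representation) (use q in simp)
    also have "\<dots> = lift A (fst B) (\<lambda>y. dec A (f y)) \<yy> x"
      using lift_reindex[OF X tcat_small[OF B] small_Vpow[OF X] f' \<yy>, of "dec A" x] by simp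
    finally show ?thesis using le[OF \<beta> \<yy> x] by simp
  qed
  then show "1 \<le> under \<T> (VO A) (f (\<beta> \<yy>)) (\<gamma> ?q)"
    unfolding le_under_Vobj_iff[OF A f\<beta> \<gamma>q] by simp
qed

text \<open>The lift of \<open>a\<^sub>0\<close> is bounded by \<open>a\<close>, which for representable \<open>A\<close> is \<open>a\<^sub>0 \<cdot> \<alpha>\<close>.\<close>

lemma Vunit_pseudo_homomorphism:
  assumes A: "is_tcat \<T> A"
  shows "pseudo_homomorphism \<T> A (VO A) (Vunit \<T> A)"
proof (rule pseudo_homomorphism_VobjI[OF A A Vunit_tfunctor[OF A]])
  fix \<alpha> \<xx> x assume \<alpha>: "representation \<T> A \<alpha>" and \<xx>: "\<xx> \<in> T \<T> (fst A)" and x: "x \<in> fst A"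
  show "lift A (fst A) (\<lambda>x. dec A (Vunit \<T> A x)) \<xx> x \<le> dec A (Vunit \<T> A (\<alpha> \<xx>)) x"
    unfolding lift_Vunit[OF A \<xx>] dec_Vunit[OF A representation_mem[OF \<alpha> \<xx>] x]
      representation_structure[OF A \<alpha> \<xx> x, symmetric]
    using A \<xx> by (rule lift_under)
qed

lemma Vmult_pseudo_homomorphism:
  assumes A: "is_tcat \<T> A"
  shows "pseudo_homomorphism \<T> (VO (VO A)) (VO A) (Vmult \<T> A)"
proof -
  note VA = Vobj_tcat[OF A]
  show ?thesis
  proof (rule pseudo_homomorphism_VobjI[OF A Vobj_tcat[OF VA] Vmult_tfunctor[OF A]])
    fix \<gamma> \<PP> x assume \<gamma>: "representation \<T> (VO (VO A)) \<gamma>" and \<PP>: "\<PP> \<in> T \<T> (fst (VO (VO A)))" and x: "x \<in> fst A"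
    have \<PP>': "\<PP> \<in> T \<T> (VP (VO A))" using \<PP> by simp
    have \<gamma>P: "\<gamma> \<PP> \<in> VP (VO A)" using representation_mem[OF \<gamma> \<PP>] by simp
    have hx: "Vunit \<T> A x \<in> fst (VO A)" using Vunit_mem[OF A x] by simp
    have "dec A (Vmult \<T> A (\<gamma> \<PP>)) x = lift A (VP (VO A)) (\<lambda>C. dec A (Vmult \<T> A C)) \<PP> x"
      unfolding dec_Vmult[OF A \<gamma>P x] dec_representation[OF VA \<gamma> \<PP>' hx] lift_Vobj_Vunit[OF A \<PP>' x] ..
    then show "lift A (fst (VO (VO A))) (\<lambda>C. dec A (Vmult \<T> A C)) \<PP> x \<le> dec A (Vmult \<T> A (\<gamma> \<PP>)) x"
      by simp
  qed
qed

text \<open>As \<open>ev \<cdot> Vf\<close> is the lift of \<open>f \<cdot> ev\<close> restricted along \<open>e\<close>, lifting it once more gives at most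
  \<open>b \<cdot> Tf \<cdot> T\<^sub>\<xi> ev\<close>. Since \<open>f\<close> is a pseudo-homomorphism,
  \<open>b \<cdot> Tf = b\<^sub>0 \<cdot> \<beta> \<cdot> Tf \<le> b\<^sub>0 \<cdot> f \<cdot> \<alpha>\<close>, and \<open>\<alpha> \<cdot> T\<^sub>\<xi> ev \<le> a \<cdot> T\<^sub>\<xi> ev = \<mu>\<close>; finally \<open>b\<^sub>0 \<cdot> f \<cdot> \<mu> \<le> Vf \<mu>\<close>
  because \<open>Vf\<close> takes values in monotone maps above the direct image.\<close>

lemma Vfun_pseudo_homomorphism:
  assumes A: "is_tcat \<T> A" and B: "is_tcat \<T> B" and repA: "representable \<T> A" and repB: "representable \<T> B"
    and f: "pseudo_homomorphism \<T> A B f"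
  shows "pseudo_homomorphism \<T> (VO A) (VO B) (Vfun \<T> A B f)"
proof -
  let ?X = "fst A" and ?Y = "fst B" and ?P = "VP A"
  let ?V = "Vfun \<T> A B f"
  have f': "f \<in> tfunctors \<T> A B" using f by (simp add: pseudo_homomorphism_def)
  then have fPi: "f \<in> ?X \<rightarrow> ?Y" using tfunctors_mem by auto
  obtain \<alpha> \<beta> where \<alpha>: "representation \<T> A \<alpha>" and \<beta>: "representation \<T> B \<beta>"
    using repA repB by (auto simp: representable_def)
  note X = tcat_small[OF A] and Y = tcat_small[OF B]
  note P = small_Vpow[OF X]
  have e: "Te \<T> ?P \<in> ?P \<rightarrow> T \<T> ?P" using Te_in[OF P] by auto
  let ?r = "vcomp ?X (vgraph ?X f) (dec A)"
  show ?thesis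
  proof (rule pseudo_homomorphism_VobjI[OF B Vobj_tcat[OF A] Vfun_tfunctor[OF A B f']])
    fix \<gamma> \<pp> y assume \<gamma>: "representation \<T> (VO A) \<gamma>" and "\<pp> \<in> T \<T> (fst (VO A))" and y: "y \<in> ?Y"
    then have \<pp>: "\<pp> \<in> T \<T> ?P" and \<gamma>p: "\<gamma> \<pp> \<in> ?P" using representation_mem[OF \<gamma>, of \<pp>] by simp_all
    note V\<gamma> = Vfun_mem[OF A B f' \<gamma>p]
    have Te: "tm ?P (T \<T> ?P) (Te \<T> ?P) \<pp> \<in> T \<T> (T \<T> ?P)" using P e \<pp> by (intro tm_mem) auto
    have mTe: "Tm \<T> ?P (tm ?P (T \<T> ?P) (Te \<T> ?P) \<pp>) = \<pp>" using Tm_TTe[OF P \<pp>] Te_in[OF P] by simp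
    have "lift B ?P (\<lambda>c. dec B (?V c)) \<pp> y \<le> lift B ?P (\<lambda>c. lift B ?P ?r (Te \<T> ?P c)) \<pp> y"
      using Y P by (intro lift_mono_on) (simp_all add: dec_Vfun_eq_lift(2)[OF A B f'])
    also have "\<dots> = lift B (T \<T> ?P) (lift B ?P ?r) (tm ?P (T \<T> ?P) (Te \<T> ?P) \<pp>) y"
      using Y P e \<pp> by (intro lift_reindex) auto
    also have "\<dots> \<le> lift B ?P ?r \<pp> y"
      using lift_lift_le[OF B P Te, of ?r y] unfolding mTe .
    also have "\<dots> \<le> dec B (?V (\<gamma> \<pp>)) y"
      unfolding lift_postcompose[OF X Y fPi P]
    proof (rule SUP_least)
      fix \<xx> assume \<xx>: "\<xx> \<in> T \<T> ?X"
      let ?z = "tm ?X ?Y f \<xx>"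
      note z = tfunctors_tm[OF A B f' \<xx>]
      note \<alpha>x = representation_mem[OF \<alpha> \<xx>] and \<beta>z = representation_mem[OF \<beta> z]
      note f\<alpha> = tfunctors_mem[OF f' \<alpha>x]
      have "Txi \<T> ?P ?X (dec A) \<pp> \<xx> * 1 \<le> Txi \<T> ?P ?X (dec A) \<pp> \<xx> * snd A \<xx> (\<alpha> \<xx>)"
        using representation_ge_one[OF A \<alpha> \<xx>] by (intro quantale_mult_mono) auto
      also have "\<dots> \<le> lift A ?P (dec A) \<pp> (\<alpha> \<xx>)"
        unfolding lift_def using \<xx> by (rule vcomp_upper)
      also have "\<dots> = dec A (\<gamma> \<pp>) (\<alpha> \<xx>)"
        using dec_representation[OF A \<gamma> \<pp> \<alpha>x] by simp
      also have "\<dots> \<le> dec B (?V (\<gamma> \<pp>)) (f (\<alpha> \<xx>))"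
        using A B f' \<gamma>p \<alpha>x by (rule Vfun_unit_ge)
      finally have 1: "Txi \<T> ?P ?X (dec A) \<pp> \<xx> \<le> dec B (?V (\<gamma> \<pp>)) (f (\<alpha> \<xx>))" by simp
      have "1 \<le> under \<T> B (f (\<alpha> \<xx>)) (\<beta> ?z)" using f \<alpha> \<beta> \<xx> by (auto simp: pseudo_homomorphism_iff)
      then have "1 * under \<T> B (\<beta> ?z) y \<le> under \<T> B (f (\<alpha> \<xx>)) (\<beta> ?z) * under \<T> B (\<beta> ?z) y"
        by (intro quantale_mult_mono) auto
      also have "\<dots> \<le> under \<T> B (f (\<alpha> \<xx>)) y"
        using B f\<alpha> \<beta>z by (rule under_trans)
      finally have 2: "snd B ?z y \<le> under \<T> B (f (\<alpha> \<xx>)) y"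
        using representation_structure[OF B \<beta> z y] by simp
      have "Txi \<T> ?P ?X (dec A) \<pp> \<xx> * snd B ?z y \<le> dec B (?V (\<gamma> \<pp>)) (f (\<alpha> \<xx>)) * under \<T> B (f (\<alpha> \<xx>)) y"
        using 1 2 by (rule quantale_mult_mono)
      also have "\<dots> \<le> dec B (?V (\<gamma> \<pp>)) y"
        using Y vdecode_vfunctor[OF Y V\<gamma>] f\<alpha> y by (rule vfunctor_under)
      finally show "Txi \<T> ?P ?X (dec A) \<pp> \<xx> * snd B ?z y \<le> dec B (?V (\<gamma> \<pp>)) y" .
    qed
    finally show "lift B (fst (VO A)) (\<lambda>c. dec B (?V c)) \<pp> y \<le> dec B (?V (\<gamma> \<pp>)) y"
      by simp
  qed
qed

end

theorem theorem4p19: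
  fixes \<T> :: "('u::set_universe, 'v::comm_quantale) top_theory"
  assumes "topological_theory \<T>"
    and "(bot :: 'v) \<noteq> 1"
    and "\<forall>x. is_singleton (T \<T> {x})"
  shows "is_monad (TCat \<T>) (Vmonad \<T>) \<and> is_monad (ReprCat \<T>) (Vmonad \<T>) \<and>
    kock_zoeberlein (TCat \<T>) (Vmonad \<T>) \<and> kock_zoeberlein (ReprCat \<T>) (Vmonad \<T>)"
proof -
  interpret pointed_theory_context \<T>
    using assms by unfold_locales auto
  let ?M = "Vmonad \<T>" and ?C = "TCat \<T>"
  let ?P = "{A. is_tcat \<T> A \<and> representable \<T> A}" and ?H = "\<lambda>A B. {f. pseudo_homomorphism \<T> A B f}"
  have mono: "le ?C (Fob ?M A) (Fob ?M B) (Fmap ?M A B f) (Fmap ?M A B g)"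
    if "A \<in> Ob ?C" "B \<in> Ob ?C" "f \<in> Hom ?C A B" "g \<in> Hom ?C A B" "le ?C A B f g" for A B f g
    using that Vfun_mono by (simp add: TCat_def Vmonad_def)
  have adj: "left_adjoint ?C (Fob ?M A) (Fob ?M (Fob ?M A)) (monad_data.unit ?M (Fob ?M A)) (mult ?M A)"
    if "A \<in> Ob ?C" for A
    using that Vmonad_adjunction by (simp add: TCat_def Vmonad_def)
  have KZ: "kock_zoeberlein ?C ?M"
    unfolding kock_zoeberlein_def using TCat_is_ord_category Vmonad_TCat mono adj by blast
  have R: "ReprCat \<T> = ?C\<lparr>Ob := ?P, Hom := ?H\<rparr>"
    by (simp add: ReprCat_def)
  have "kock_zoeberlein (?C\<lparr>Ob := ?P, Hom := ?H\<rparr>) ?M"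
  proof (rule kock_zoeberlein_subcategory[OF TCat_is_ord_category Vmonad_TCat mono adj])
    show "?P \<subseteq> Ob ?C" by (auto simp: TCat_def)
    show "f \<in> Hom ?C A B" if "f \<in> ?H A B" for A B f
      using that by (simp add: TCat_def pseudo_homomorphism_def)
    show "ident ?C A \<in> ?H A A" if "A \<in> ?P" for A
      using that pseudo_homomorphism_ident by (simp add: TCat_def)
    show "cmp ?C A B D g f \<in> ?H A D"
      if "A \<in> ?P" "B \<in> ?P" "D \<in> ?P" "f \<in> ?H A B" "g \<in> ?H B D" for A B D f g
      using that pseudo_homomorphism_compose[of A B D f g] by (simp add: TCat_def)
    show "Fob ?M A \<in> ?P" if "A \<in> ?P" for A
      using that Vobj_tcat Vobj_representable by (simp add: Vmonad_def)
    show "Fmap ?M A B f \<in> ?H (Fob ?M A) (Fob ?M B)" if "A \<in> ?P" "B \<in> ?P" "f \<in> ?H A B" for A B f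
      using that Vfun_pseudo_homomorphism by (simp add: Vmonad_def)
    show "monad_data.unit ?M A \<in> ?H A (Fob ?M A)" if "A \<in> ?P" for A
      using that Vunit_pseudo_homomorphism by (simp add: Vmonad_def)
    show "mult ?M A \<in> ?H (Fob ?M (Fob ?M A)) (Fob ?M A)" if "A \<in> ?P" for A
      using that Vmult_pseudo_homomorphism by (simp add: Vmonad_def)
  qed
  then show ?thesis using KZ unfolding R kock_zoeberlein_def by blast
qed

end
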